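(* Let $d$ be prime, $n\ge1$, $G$ positive and invertible over $\mathbb Z_d$, $\sigma$ an $n$-qudit state, and $\mathcal E_\sigma(\rho)=\rho\boxtimes\sigma$. Then $$n\log d-H(\mathcal M(\sigma))\le\chi_H(\mathcal E_\sigma)\le n\log d-H(\sigma).$$ In particular, if $\sigma$ is an MSPS then $\chi_H(\mathcal E_\sigma)=n\log d-H(\sigma)$.
   Context: Fix a prime $d$; $\chi(k)=e^{2\pi ik/d}$, $X|k\rangle=|k+1\rangle$, $Z|k\rangle=\chi(k)|k\rangle$ on $\mathbb C^d$; Weyl operators $w(p,q)=\chi(-2^{-1}pq)Z^pX^q$ (odd $d$), $w(p,q)=i^{-pq}Z^pX^q$ ($d=2$), $w(\vec p,\vec q)=\bigotimes_kw(p_k,q_k)$; characteristic function $\Xi_\rho(\vec p,\vec q)=\mathrm{Tr}[\rho\,w(-\vec p,-\vec q)]$. The mean state $\mathcal M(\rho)$ has $\Xi_{\mathcal M(\rho)}(\vec x)=\Xi_\rho(\vec x)$ if $|\Xi_\rho(\vec x)|=1$ and $0$ otherwise. An MSPS is a minimal projection of the C*-algebra generated by an abelian group of Weyl operators, divided by its rank. $G=\begin{pmatrix}g_{00}&g_{01}\\ g_{10}&g_{11}\end{pmatrix}$ over $\mathbb Z_d$, $\det G\not\equiv0$, $N=(\det G)^{-1}$; positive means all entries nonzero mod $d$. Key unitary $U|\vec i\rangle|\vec j\rangle=|Ng_{11}\vec i-Ng_{10}\vec j\rangle|-Ng_{01}\vec i+Ng_{00}\vec j\rangle$; $\rho\boxtimes\sigma=\mathrm{Tr}_B[U(\rho\otimes\sigma)U^\dagger]$.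 Holevo capacity: $\chi_H(\mathcal E)=\max_{\{p_i,\rho_i\}}\big[H(\sum_ip_i\mathcal E(\rho_i))-\sum_ip_iH(\mathcal E(\rho_i))\big]$ over ensembles of input states; $H$ is von Neumann entropy. *)

theory Defs
  imports "HOL-Analysis.Analysis" "HOL-Number_Theory.Cong"
    "Jordan_Normal_Form.Jordan_Normal_Form" "Jordan_Normal_Form.DL_Rank"
begin

definition adj :: "complex mat \<Rightarrow> complex mat" where
  "adj A = mat (dim_col A) (dim_row A) (\<lambda>(i,j). cnj (A $$ (j,i)))"

definition mtrace :: "complex mat \<Rightarrow> complex" where
  "mtrace A = (\<Sum>i<dim_row A. A $$ (i,i))"

text \<open>Kronecker (tensor) product; first factor is the most significant index.\<close>
definition kron :: "complex mat \<Rightarrow> complex mat \<Rightarrow> complex mat" where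
  "kron A B = mat (dim_row A * dim_row B) (dim_col A * dim_col B)
     (\<lambda>(i,j). A $$ (i div dim_row B, j div dim_col B) * B $$ (i mod dim_row B, j mod dim_col B))"

definition ptrace2 :: "nat \<Rightarrow> nat \<Rightarrow> complex mat \<Rightarrow> complex mat" where
  "ptrace2 m k M = mat m m (\<lambda>(a,a'). \<Sum>b<k. M $$ (a*k+b, a'*k+b))"

definition density :: "nat \<Rightarrow> nat \<Rightarrow> complex mat \<Rightarrow> bool" where
  "density d n \<rho> \<longleftrightarrow> \<rho> \<in> carrier_mat (d^n) (d^n) \<and> adj \<rho> = \<rho> \<and>
     (\<forall>v \<in> carrier_vec (d^n). 0 \<le> Re (conjugate v \<bullet> (\<rho> *\<^sub>v v))) \<and> mtrace \<rho> = 1"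

definition ent_term :: "real \<Rightarrow> real" where
  "ent_term x = (if x \<le> 0 then 0 else x * ln x)"

definition vn_entropy :: "complex mat \<Rightarrow> real" where
  "vn_entropy \<rho> = - (\<Sum>x\<in>#proots (char_poly \<rho>). ent_term (Re x))"

definition chi :: "nat \<Rightarrow> int \<Rightarrow> complex" where
  "chi d k = cis (2 * pi * of_int k / of_nat d)"

definition inv_mod :: "nat \<Rightarrow> int \<Rightarrow> int" where
  "inv_mod d a = (SOME b. 0 \<le> b \<and> b < int d \<and> [a * b = 1] (mod int d))"

text \<open>Single-qudit Weyl operator w(p,q); entry (r,k) of Z^p X^q is chi(p r) if r = k+q mod d.\<close>
definition weyl1 :: "nat \<Rightarrow> int \<Rightarrow> int \<Rightarrow> complex mat" where
  "weyl1 d p q =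
     (let p' = p mod int d; q' = q mod int d;
          ph = (if d = 2 then \<i> powi (- (p' * q')) else chi d (- inv_mod d 2 * p' * q'))
      in mat d d (\<lambda>(r,k). if int r mod int d = (int k + q') mod int d
                          then ph * chi d (p' * int r) else 0))"

text \<open>Basis index a of (C^d)^{\<otimes>n} has digit k equal to the state of qudit k.\<close>
definition digit :: "nat \<Rightarrow> nat \<Rightarrow> nat \<Rightarrow> nat" where
  "digit d a k = (a div d ^ k) mod d"

definition enc :: "nat \<Rightarrow> nat \<Rightarrow> (nat \<Rightarrow> int) \<Rightarrow> nat" where
  "enc d n f = (\<Sum>k<n. nat (f k mod int d) * d ^ k)"

definition weyl :: "nat \<Rightarrow> nat \<Rightarrow> (nat \<Rightarrow> int) \<Rightarrow> (nat \<Rightarrow> int) \<Rightarrow> complex mat" where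
  "weyl d n p q = mat (d^n) (d^n)
     (\<lambda>(a,b). \<Prod>k<n. weyl1 d (p k) (q k) $$ (digit d a k, digit d b k))"

definition zvecs :: "nat \<Rightarrow> nat \<Rightarrow> (nat \<Rightarrow> int) set" where
  "zvecs d n = {v. \<forall>k. (k < n \<longrightarrow> 0 \<le> v k \<and> v k < int d) \<and> (n \<le> k \<longrightarrow> v k = 0)}"

definition char_fn :: "nat \<Rightarrow> nat \<Rightarrow> complex mat \<Rightarrow> (nat \<Rightarrow> int) \<Rightarrow> (nat \<Rightarrow> int) \<Rightarrow> complex" where
  "char_fn d n \<rho> p q = mtrace (\<rho> * weyl d n (\<lambda>k. - p k) (\<lambda>k. - q k))"

definition mean_state :: "nat \<Rightarrow> nat \<Rightarrow> complex mat \<Rightarrow> complex mat" where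
  "mean_state d n \<rho> = (THE \<tau>. \<tau> \<in> carrier_mat (d^n) (d^n) \<and>
     (\<forall>p \<in> zvecs d n. \<forall>q \<in> zvecs d n.
        char_fn d n \<tau> p q = (if cmod (char_fn d n \<rho> p q) = 1 then char_fn d n \<rho> p q else 0)))"

inductive_set gen_alg :: "complex mat set \<Rightarrow> complex mat set" for S where
  base: "A \<in> S \<Longrightarrow> A \<in> gen_alg S"
| add: "A \<in> gen_alg S \<Longrightarrow> B \<in> gen_alg S \<Longrightarrow> A + B \<in> gen_alg S"
| smult: "A \<in> gen_alg S \<Longrightarrow> c \<cdot>\<^sub>m A \<in> gen_alg S"
| mult: "A \<in> gen_alg S \<Longrightarrow> B \<in> gen_alg S \<Longrightarrow> A * B \<in> gen_alg S"
| adjoint: "A \<in> gen_alg S \<Longrightarrow> adj A \<in> gen_alg S"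

definition is_proj :: "complex mat \<Rightarrow> bool" where
  "is_proj P \<longleftrightarrow> adj P = P \<and> P * P = P"

definition minimal_proj :: "nat \<Rightarrow> complex mat set \<Rightarrow> complex mat \<Rightarrow> bool" where
  "minimal_proj N Alg P \<longleftrightarrow> P \<in> Alg \<and> is_proj P \<and> P \<noteq> 0\<^sub>m N N \<and>
     (\<forall>Q \<in> Alg. is_proj Q \<and> Q * P = Q \<longrightarrow> Q = 0\<^sub>m N N \<or> Q = P)"

text \<open>An abelian group of Weyl operators, given by its label set S \<subseteq> Z_d^{2n}:
  a subgroup of Z_d^n x Z_d^n whose Weyl operators pairwise commute.\<close>
definition weyl_abelian_group :: "nat \<Rightarrow> nat \<Rightarrow> ((nat \<Rightarrow> int) \<times> (nat \<Rightarrow> int)) set \<Rightarrow> bool" where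
  "weyl_abelian_group d n S \<longleftrightarrow> S \<subseteq> zvecs d n \<times> zvecs d n \<and> ((\<lambda>_. 0), (\<lambda>_. 0)) \<in> S \<and>
     (\<forall>(p,q) \<in> S. \<forall>(p',q') \<in> S.
        ((\<lambda>k. (p k + p' k) mod int d), (\<lambda>k. (q k + q' k) mod int d)) \<in> S \<and>
        weyl d n p q * weyl d n p' q' = weyl d n p' q' * weyl d n p q)"

definition MSPS :: "nat \<Rightarrow> nat \<Rightarrow> complex mat \<Rightarrow> bool" where
  "MSPS d n \<sigma> \<longleftrightarrow> (\<exists>S P. weyl_abelian_group d n S \<and>
      minimal_proj (d^n) (gen_alg ((\<lambda>(p,q). weyl d n p q) ` S)) P \<and>
      \<sigma> = (1 / of_nat (vec_space.rank (d^n) P)) \<cdot>\<^sub>m P)"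

definition detG :: "(nat \<Rightarrow> nat \<Rightarrow> int) \<Rightarrow> int" where
  "detG g = g 0 0 * g 1 1 - g 0 1 * g 1 0"

definition key_U :: "nat \<Rightarrow> nat \<Rightarrow> (nat \<Rightarrow> nat \<Rightarrow> int) \<Rightarrow> complex mat" where
  "key_U d n g =
     (let D = d^n; N = inv_mod d (detG g) in
      mat (D*D) (D*D) (\<lambda>(r,c).
        let i = (\<lambda>k. int (digit d (c div D) k)); j = (\<lambda>k. int (digit d (c mod D) k));
            x = enc d n (\<lambda>k. N * g 1 1 * i k - N * g 1 0 * j k);
            y = enc d n (\<lambda>k. - N * g 0 1 * i k + N * g 0 0 * j k)
        in if r = x * D + y then 1 else 0))"

definition conv :: "nat \<Rightarrow> nat \<Rightarrow> (nat \<Rightarrow> nat \<Rightarrow> int) \<Rightarrow> complex mat \<Rightarrow> complex mat \<Rightarrow> complex mat" where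
  "conv d n g \<rho> \<sigma> = ptrace2 (d^n) (d^n) (key_U d n g * kron \<rho> \<sigma> * adj (key_U d n g))"

definition mix :: "nat \<Rightarrow> nat \<Rightarrow> (nat \<Rightarrow> real) \<Rightarrow> (nat \<Rightarrow> complex mat) \<Rightarrow> complex mat" where
  "mix D m p A = mat D D (\<lambda>ij. \<Sum>i<m. of_real (p i) * A i $$ ij)"

definition holevo_cap :: "nat \<Rightarrow> nat \<Rightarrow> (complex mat \<Rightarrow> complex mat) \<Rightarrow> real" where
  "holevo_cap d n E = Sup {vn_entropy (mix (d^n) m p (\<lambda>i. E (\<rho>s i)))
        - (\<Sum>i<m. p i * vn_entropy (E (\<rho>s i))) | m p \<rho>s.
        (\<forall>i<m. 0 \<le> p i \<and> density d n (\<rho>s i)) \<and> (\<Sum>i<m. p i) = 1}"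

end

theory Submission
  imports Defs "Jordan_Normal_Form.Schur_Decomposition"
begin

text \<open>
  A positive invertible \<open>G\<close> forces \<open>d\<close> to be odd, since for \<open>d = 2\<close> all entries are odd and the
  determinant is even. Hence commuting Weyl operators multiply without phases.

  Upper bound: the map \<open>\<sigma> \<mapsto> \<rho> \<boxtimes> \<sigma>\<close> is positive, trace preserving and unital, so the spectrum
  of \<open>\<rho> \<boxtimes> \<sigma>\<close> is a doubly stochastic image of that of \<open>\<sigma>\<close> and \<open>H(\<rho> \<boxtimes> \<sigma>) \<ge> H(\<sigma>)\<close>.

  Lower bound: convolution with \<open>\<sigma>\<close> maps the Weyl operator \<open>w(g11 p, g00 q)\<close> to
  \<open>Tr[\<sigma> w(g10 p, -g01 q)] w(det G p, q)\<close>. Let \<open>S\<close> be the set of \<open>(p, q)\<close> for which this trace has modulus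
  one; there \<open>\<sigma>\<close> is an eigenoperator, so \<open>S\<close> is an isotropic subgroup and the trace is a character
  of it. Averaging \<open>w(g11 p, g00 q)\<close> over \<open>S\<close>, twisted by an arbitrary symplectic character, gives an
  input state whose output, like the mean state of \<open>\<sigma>\<close>, is a multiple of a projection with all non-zero
  eigenvalues equal to \<open>|S| / d^n\<close>. The uniform mixture over all twists has a maximally mixed output.

  An MSPS is itself such a twisted average, so it equals its mean state.
\<close>

section \<open>Unitary diagonalisation of Hermitian matrices\<close>

text \<open>The Weyl identity is the Fourier picture of the convolution: the characteristic function
  of the output at (p, q) is that of the input at (N g11 p, g00 q) times that of \<sigma> at (-N g10
  p, g01 q). Replacing p by det G p removes N and produces the label pairs (g11, g00), (g10, -g01)
  and (det G, 1). Each pair multiplies the symplectic form by a constant, so isotropy survives, and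
  it relabels injectively because the constants are units; this is one place where positivity of G
  enters. A single isotropic set S can therefore index the input, the output and the mean state at
  once. As the entropy of such a state depends only on the number of its labels, comparing output
  and mean state is mere counting, and no unitary between them has to be found. The twists are there
  because the first entropy in the Holevo quantity must reach its maximum while the single outputs
  keep theirs: mixing over all twists leaves only the identity Weyl operator.\<close>

lemma mult_entry:
  assumes "A \<in> carrier_mat n m" "B \<in> carrier_mat m k" "i < n" "j < k"
  shows "(A * B) $$ (i,j) = (\<Sum>l<m. A $$ (i,l) * B $$ (l,j))"
  using assms by (auto simp: scalar_prod_def atLeast0LessThan)

lemma mult_vec_entry:
  assumes "A \<in> carrier_mat n m" "v \<in> carrier_vec m" "i < n"
  shows "(A *\<^sub>v v) $ i = (\<Sum>l<m. A $$ (i,l) * v $ l)"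
  using assms by (auto simp: scalar_prod_def atLeast0LessThan)

lemma square_mult_carrier [simp]:
  "A \<in> carrier_mat n n \<Longrightarrow> B \<in> carrier_mat n n \<Longrightarrow> A * B \<in> carrier_mat n n"
  by (rule mult_carrier_mat)

lemma adj_carrier [simp]: "A \<in> carrier_mat n m \<Longrightarrow> adj A \<in> carrier_mat m n"
  by (auto simp: adj_def)

lemma adj_entry: "A \<in> carrier_mat n m \<Longrightarrow> i < m \<Longrightarrow> j < n \<Longrightarrow> adj A $$ (i,j) = cnj (A $$ (j,i))"
  by (auto simp: adj_def)

lemma adj_adj [simp]: "adj (adj A) = A"
  by (rule eq_matI) (auto simp: adj_def)

lemma adj_mult:
  assumes "A \<in> carrier_mat n m" "B \<in> carrier_mat m k"
  shows "adj (A * B) = adj B * adj A"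
proof (rule eq_matI)
  fix i j assume "i < dim_row (adj B * adj A)" "j < dim_col (adj B * adj A)"
  hence ij: "i < k" "j < n" using assms by (auto simp: adj_def)
  show "adj (A * B) $$ (i, j) = (adj B * adj A) $$ (i, j)"
    using assms ij
    by (simp add: adj_entry[of _ n k] mult_entry[of A n m B k] mult_entry[of "adj B" k m "adj A" n]
        adj_entry[of _ m k] adj_entry[of _ n m] mult.commute
        del: index_mult_mat)
qed (use assms in \<open>auto simp: adj_def\<close>)

definition real_diag :: "nat \<Rightarrow> (nat \<Rightarrow> real) \<Rightarrow> complex mat" where
  "real_diag N l = mat N N (\<lambda>(i,j). if i = j then of_real (l i) else 0)"

lemma real_diag_carrier [simp]: "real_diag N l \<in> carrier_mat N N"
  by (simp add: real_diag_def)

text \<open>Gram-Schmidt does not move the first vector of its input, so running it on a completion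
  of \<open>v\<close> and normalising yields an orthonormal basis that starts with a multiple of
  \<open>v\<close>. This is the change of basis for the deflation below.\<close>

lemma exists_unitary_first_column:
  assumes v: "v \<in> carrier_vec N" and v0: "v \<noteq> 0\<^sub>v N"
  shows "\<exists>W c. W \<in> carrier_mat N N \<and> adj W * W = 1\<^sub>m N \<and> col W 0 = c \<cdot>\<^sub>v v"
proof -
  interpret cof_vec_space N "TYPE(complex)" .
  have N: "N \<noteq> 0"
  proof
    assume "N = 0"
    hence "v = 0\<^sub>v N" using v by (intro eq_vecI) auto
    thus False using v0 by simp
  qed
  define ws where "ws = gram_schmidt N (basis_completion v)"
  note bc = basis_completion[OF v v0]
  have ws: "set ws \<subseteq> carrier_vec N" "corthogonal ws" "length ws = N"
    using gram_schmidt_result[OF bc(2,4,5) ws_def] bc(6) by auto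
  have "hd ws = v"
    using gram_schmidt_hd[OF v, of "tl (basis_completion v)"] bc(6,7) N
    unfolding ws_def by (metis list.collapse list.size(3))
  hence ws0: "ws ! 0 = v" using ws(3) N by (cases ws) auto
  define r where "r j = sqrt (\<Sum>i<N. (cmod (ws ! j $ i))\<^sup>2)" for j
  have wsc: "ws ! j \<in> carrier_vec N" if "j < N" for j
    using that ws by auto
  have sp: "ws ! j \<bullet>c ws ! k = (\<Sum>i<N. ws ! j $ i * cnj (ws ! k $ i))" if "j < N" "k < N" for j k
    using wsc[OF that(1)] wsc[OF that(2)] by (auto simp: scalar_prod_def atLeast0LessThan)
  have diag: "(\<Sum>i<N. ws ! j $ i * cnj (ws ! j $ i)) = of_real ((r j)\<^sup>2)" for j
  proof -
    have "(r j)\<^sup>2 = (\<Sum>i<N. (cmod (ws ! j $ i))\<^sup>2)"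
      unfolding r_def by (rule real_sqrt_pow2) (auto intro: sum_nonneg)
    thus ?thesis by (simp add: complex_norm_square del: of_real_power)
  qed
  have r0: "r j \<noteq> 0" if "j < N" for j
    using corthogonalD[OF ws(2), of j j] that ws(3) sp[OF that that] diag[of j] by auto
  have off: "(\<Sum>i<N. ws ! j $ i * cnj (ws ! k $ i)) = 0" if "j < N" "k < N" "j \<noteq> k" for j k
    using corthogonalD[OF ws(2), of j k] that ws(3) sp[OF that(1,2)] by auto
  define W where "W = mat N N (\<lambda>(i,j). ws ! j $ i / of_real (r j))"
  have W: "W \<in> carrier_mat N N" by (simp add: W_def)
  have We: "W $$ (i,j) = ws ! j $ i / of_real (r j)" if "i < N" "j < N" for i j
    using that by (simp add: W_def)
  have "adj W * W = 1\<^sub>m N"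
  proof (rule eq_matI)
    fix i j assume "i < dim_row (1\<^sub>m N)" "j < dim_col (1\<^sub>m N)"
    hence ij: "i < N" "j < N" by auto
    have "(adj W * W) $$ (i,j) = (\<Sum>l<N. ws ! j $ l * cnj (ws ! i $ l)) / (of_real (r i) * of_real (r j))"
      using ij W by (simp add: mult_entry[of "adj W" N N W N] adj_entry[OF W] We
        sum_divide_distrib mult.commute del: index_mult_mat)
    also have "\<dots> = 1\<^sub>m N $$ (i,j)"
      using off[of j i] diag[of i] r0[of i] ij by (auto simp: power2_eq_square)
    finally show "(adj W * W) $$ (i,j) = 1\<^sub>m N $$ (i,j)" .
  qed (use W in \<open>auto simp: adj_def\<close>)
  moreover have "col W 0 = (1 / of_real (r 0)) \<cdot>\<^sub>v v"
    using N v ws0 by (intro eq_vecI) (auto simp: W_def)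
  ultimately show ?thesis using W by blast
qed

text \<open>Deflation: in a basis starting with an eigenvector the first column vanishes below the
  diagonal; hermiticity transfers this to the first row and makes the corner entry real, so a
  smaller Hermitian block remains.\<close>

theorem hermitian_diagonalization:
  assumes "A \<in> carrier_mat N N" "adj A = A"
  shows "\<exists>V l. V \<in> carrier_mat N N \<and> adj V * V = 1\<^sub>m N \<and> A * V = V * real_diag N l"
  using assms
proof (induction N arbitrary: A)
  case 0
  show ?case
    by (rule exI[of _ "1\<^sub>m 0"], rule exI[of _ "\<lambda>_. 0"]) (use 0 in \<open>auto simp: adj_def real_diag_def\<close>)
next
  case (Suc N)
  note A = Suc.prems(1)
  have "\<not> constant (poly (char_poly A))"
    using degree_monic_char_poly[OF A] by (simp add: constant_degree)
  then obtain e where "poly (char_poly A) e = 0"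
    using fundamental_theorem_of_algebra by blast
  then obtain v where "eigenvector A v e"
    using eigenvalue_root_char_poly[OF A] unfolding eigenvalue_def by blast
  hence v: "v \<in> carrier_vec (Suc N)" "v \<noteq> 0\<^sub>v (Suc N)" "A *\<^sub>v v = e \<cdot>\<^sub>v v"
    using A by (auto simp: eigenvector_def)
  obtain W c where W: "W \<in> carrier_mat (Suc N) (Suc N)" "adj W * W = 1\<^sub>m (Suc N)"
    "col W 0 = c \<cdot>\<^sub>v v"
    using exists_unitary_first_column[OF v(1,2)] by blast
  have W': "W * adj W = 1\<^sub>m (Suc N)"
    using mat_mult_left_right_inverse[OF _ W(1) W(2)] W(1) by simp
  define B where "B = adj W * A * W"
  have B: "B \<in> carrier_mat (Suc N) (Suc N)" using W A by (simp add: B_def)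
  have Bh: "adj B = B"
  proof -
    have "adj B = adj W * (adj (adj W * A))"
      unfolding B_def using A W by (subst adj_mult[of _ "Suc N" "Suc N"]) auto
    also have "adj (adj W * A) = adj A * W"
      using A W by (subst adj_mult[of _ "Suc N" "Suc N"]) auto
    finally show ?thesis unfolding B_def using A W Suc.prems(2)
      by (simp add: assoc_mult_mat[of _ "Suc N" "Suc N" _ "Suc N" _ "Suc N"])
  qed
  have col0: "B $$ (i, 0) = (if i = 0 then e else 0)" if i: "i < Suc N" for i
  proof -
    have AW: "(A * W) $$ (k, 0) = e * W $$ (k, 0)" if "k < Suc N" for k
    proof -
      have Wk: "W $$ (k', 0) = c * v $ k'" if "k' < Suc N" for k'
      proof -
        have "W $$ (k', 0) = col W 0 $ k'" using W(1) that by simp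
        thus ?thesis using W(3) v(1) that by simp
      qed
      have "(\<Sum>l<Suc N. A $$ (k, l) * v $ l) = e * v $ k"
        using mult_vec_entry[OF A v(1) that] v that by simp
      moreover have "(A * W) $$ (k, 0) = c * (\<Sum>l<Suc N. A $$ (k, l) * v $ l)"
        unfolding sum_distrib_left using that
        by (subst mult_entry[OF A W(1)]) (auto simp: Wk intro!: sum.cong)
      ultimately show ?thesis using Wk[OF that] by simp
    qed
    have "B $$ (i, 0) = (adj W * (A * W)) $$ (i, 0)"
      unfolding B_def using A W by (simp add: assoc_mult_mat[of _ "Suc N" "Suc N" _ "Suc N" _ "Suc N"])
    also have "\<dots> = e * (adj W * W) $$ (i, 0)"
      using A W(1) i
      by (subst mult_entry[of _ "Suc N" "Suc N" _ "Suc N"],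
          simp_all add: mult_entry[of "adj W" "Suc N" "Suc N" W "Suc N"] AW sum_distrib_left
          del: sum.lessThan_Suc index_mult_mat) (auto intro!: sum.cong)
    also have "\<dots> = (if i = 0 then e else 0)" using i unfolding W(2) by auto
    finally show ?thesis .
  qed
  have Bc: "B $$ (j, i) = cnj (B $$ (i, j))" if "i < Suc N" "j < Suc N" for i j
    using adj_entry[OF B that(2,1)] Bh by simp
  have row0: "B $$ (0, i) = (if i = 0 then e else 0)" if i: "i < Suc N" for i
    using Bc[of i 0] col0[OF i] col0[of 0] i Bc[of 0 0] by auto
  define e' where "e' = Re e"
  have e: "e = of_real e'"
    using Bc[of 0 0] col0[of 0] unfolding e'_def by (auto simp: complex_eq_iff)
  define A3 where "A3 = mat N N (\<lambda>(i,j). B $$ (Suc i, Suc j))"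
  have A3: "A3 \<in> carrier_mat N N" by (simp add: A3_def)
  moreover have "adj A3 = A3"
  proof (rule eq_matI)
    fix i j assume "i < dim_row A3" "j < dim_col A3"
    thus "adj A3 $$ (i, j) = A3 $$ (i, j)" using Bc[of "Suc j" "Suc i"] by (simp add: A3_def adj_def)
  qed (auto simp: A3_def adj_def)
  ultimately obtain V3 l3 where V3: "V3 \<in> carrier_mat N N" "adj V3 * V3 = 1\<^sub>m N"
    and A3V3: "A3 * V3 = V3 * real_diag N l3"
    using Suc.IH by blast
  define l where "l = case_nat e' l3"
  \<comment> \<open>The block matrix diag(1, V3): it diagonalises the remaining block and fixes the
    eigenvector already split off.\<close>
  define X where "X = mat (Suc N) (Suc N) (\<lambda>(i,j). case i of 0 \<Rightarrow> (if j = 0 then 1 else 0)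
    | Suc i' \<Rightarrow> (case j of 0 \<Rightarrow> 0 | Suc j' \<Rightarrow> V3 $$ (i', j')))"
  have X: "X \<in> carrier_mat (Suc N) (Suc N)" by (simp add: X_def)
  have X_entries: "X $$ (0, 0) = 1" "i < N \<Longrightarrow> X $$ (0, Suc i) = 0" "i < N \<Longrightarrow> X $$ (Suc i, 0) = 0"
    "i < N \<Longrightarrow> j < N \<Longrightarrow> X $$ (Suc i, Suc j) = V3 $$ (i, j)" for i j
    by (simp_all add: X_def)
  have X1: "adj X * X = 1\<^sub>m (Suc N)"
  proof (rule eq_matI)
    fix i j assume "i < dim_row (1\<^sub>m (Suc N))" "j < dim_col (1\<^sub>m (Suc N))"
    hence ij: "i < Suc N" "j < Suc N" by auto
    have "(\<Sum>k<N. cnj (V3 $$ (k, i')) * V3 $$ (k, j')) = (if i' = j' then 1 else 0)"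
      if "i' < N" "j' < N" for i' j'
      using arg_cong[OF V3(2), of "\<lambda>M. M $$ (i', j')"] that V3(1)
      by (subst (asm) mult_entry[of _ N N _ N]) (auto simp: adj_entry[of _ N N])
    thus "(adj X * X) $$ (i, j) = 1\<^sub>m (Suc N) $$ (i, j)"
      using ij X
      by (subst mult_entry[of _ "Suc N" "Suc N" _ "Suc N"]; cases i; cases j)
        (auto simp: adj_entry[OF X] X_entries sum.lessThan_Suc_shift simp del: sum.lessThan_Suc)
  qed (use X in \<open>auto simp: adj_def\<close>)
  have BX: "B * X = X * real_diag (Suc N) l"
  proof (rule eq_matI)
    fix i j assume "i < dim_row (X * real_diag (Suc N) l)" "j < dim_col (X * real_diag (Suc N) l)"
    hence ij: "i < Suc N" "j < Suc N" using X by (auto simp: real_diag_def)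
    have *: "(\<Sum>k<N. B $$ (Suc i', Suc k) * V3 $$ (k, j'))
        = (\<Sum>k<N. V3 $$ (i', k) * real_diag N l3 $$ (k, j'))"
      if "i' < N" "j' < N" for i' j'
      using arg_cong[OF A3V3, of "\<lambda>M. M $$ (i', j')"] that V3(1) A3
      by (subst (asm) (1 2) mult_entry[of _ N N _ N]) (auto simp: A3_def)
    show "(B * X) $$ (i, j) = (X * real_diag (Suc N) l) $$ (i, j)"
      using ij X B
      by (subst (1 2) mult_entry[of _ "Suc N" "Suc N" _ "Suc N"]; cases i; cases j)
        (auto simp: X_entries real_diag_def l_def sum.lessThan_Suc_shift col0 row0 e *
          simp del: sum.lessThan_Suc intro!: sum.cong)
  qed (use X B in \<open>auto simp: real_diag_def\<close>)
  note as = assoc_mult_mat[of _ "Suc N" "Suc N" _ "Suc N" _ "Suc N"]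
  define V where "V = W * X"
  have "adj V * V = adj X * (adj W * W) * X"
    unfolding V_def using W(1) X by (simp add: adj_mult[of _ "Suc N" "Suc N"] as)
  hence 1: "adj V * V = 1\<^sub>m (Suc N)" using W(2) X1 right_mult_one_mat[OF adj_carrier[OF X]] by simp
  have "V * real_diag (Suc N) l = W * (B * X)"
    unfolding V_def BX using W(1) X by (simp add: as)
  also have "\<dots> = (W * adj W) * A * W * X"
    unfolding B_def using W(1) X A by (simp add: as)
  also have "\<dots> = A * V" unfolding W' V_def using W(1) X A by (simp add: as)
  finally have 2: "A * V = V * real_diag (Suc N) l" by simp
  have "V \<in> carrier_mat (Suc N) (Suc N)" using W X by (simp add: V_def)
  thus ?case using 1 2 by blast
qed

section \<open>Von Neumann entropy\<close>

definition qform :: "nat \<Rightarrow> complex mat \<Rightarrow> (nat \<Rightarrow> complex) \<Rightarrow> complex" where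
  "qform N A v = (\<Sum>i<N. \<Sum>j<N. cnj (v i) * A $$ (i,j) * v j)"

definition psd :: "nat \<Rightarrow> complex mat \<Rightarrow> bool" where
  "psd N A \<longleftrightarrow> A \<in> carrier_mat N N \<and> adj A = A \<and> (\<forall>v. 0 \<le> Re (qform N A v))"

lemma qform_vec:
  assumes "A \<in> carrier_mat N N" "v \<in> carrier_vec N"
  shows "conjugate v \<bullet> (A *\<^sub>v v) = qform N A (\<lambda>i. v $ i)"
  using assms unfolding qform_def
  by (auto simp: scalar_prod_def atLeast0LessThan sum_distrib_left mult.assoc intro!: sum.cong)

lemma density_iff_psd: "density d n \<rho> \<longleftrightarrow> psd (d ^ n) \<rho> \<and> mtrace \<rho> = 1"
proof -
  have "0 \<le> Re (qform (d^n) \<rho> v)"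
    if *: "\<forall>v \<in> carrier_vec (d^n). 0 \<le> Re (conjugate v \<bullet> (\<rho> *\<^sub>v v))"
      and c: "\<rho> \<in> carrier_mat (d^n) (d^n)" for v
  proof -
    have "qform (d^n) \<rho> v = qform (d^n) \<rho> (\<lambda>i. vec (d^n) v $ i)"
      unfolding qform_def by (intro sum.cong) auto
    thus ?thesis using *[rule_format, of "vec (d^n) v"] qform_vec[OF c, of "vec (d^n) v"] by simp
  qed
  moreover have "0 \<le> Re (conjugate v \<bullet> (\<rho> *\<^sub>v v))"
    if "\<forall>v. 0 \<le> Re (qform (d^n) \<rho> v)" "\<rho> \<in> carrier_mat (d^n) (d^n)" "v \<in> carrier_vec (d^n)" for v
    using that qform_vec[OF that(2,3)] by simp
  ultimately show ?thesis unfolding density_def psd_def by blast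
qed

lemma proots_prod_linear:
  "proots (\<Prod>a\<leftarrow>as. [:- a, 1:]) = mset (as :: complex list)"
proof (induction as)
  case (Cons a as)
  have "(\<Prod>a\<leftarrow>as. [:- a, 1:]) \<noteq> 0" by (auto simp: prod_list_zero_iff)
  hence "proots ([:- a, 1:] * (\<Prod>a\<leftarrow>as. [:- a, 1:])) = proots [:- a, 1:] + proots (\<Prod>a\<leftarrow>as. [:- a, 1:])"
    by (intro proots_mult) auto
  thus ?case using Cons by (simp del: mult_pCons_left)
qed simp

text \<open>All that later arguments take from the spectral theorem, in index form. Orthonormality
  is recorded for columns (normalised eigenvectors) and for rows (completeness). The entropy clause
  counts eigenvalues with multiplicity, as the roots in \<open>vn_entropy\<close> do.\<close>

definition eigensystem :: "nat \<Rightarrow> complex mat \<Rightarrow> (nat \<Rightarrow> nat \<Rightarrow> complex) \<Rightarrow> (nat \<Rightarrow> real) \<Rightarrow> bool" where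
  "eigensystem N A V l \<longleftrightarrow>
    (\<forall>j<N. \<forall>k<N. (\<Sum>i<N. cnj (V i j) * V i k) = (if j = k then 1 else 0)) \<and>
    (\<forall>i<N. \<forall>j<N. (\<Sum>k<N. V i k * cnj (V j k)) = (if i = j then 1 else 0)) \<and>
    (\<forall>i<N. \<forall>j<N. A $$ (i,j) = (\<Sum>k<N. of_real (l k) * V i k * cnj (V j k))) \<and>
    (\<forall>i<N. \<forall>k<N. (\<Sum>j<N. A $$ (i,j) * V j k) = of_real (l k) * V i k) \<and>
    vn_entropy A = - (\<Sum>k<N. ent_term (l k)) \<and>
    of_real (\<Sum>k<N. l k) = mtrace A \<and>
    (\<forall>k<N. of_real (l k) = qform N A (\<lambda>i. V i k))"

lemma eigensystemD:
  assumes "eigensystem N A V l"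
  shows "\<And>j k. j < N \<Longrightarrow> k < N \<Longrightarrow> (\<Sum>i<N. cnj (V i j) * V i k) = (if j = k then 1 else 0)"
    "\<And>i j. i < N \<Longrightarrow> j < N \<Longrightarrow> (\<Sum>k<N. V i k * cnj (V j k)) = (if i = j then 1 else 0)"
    "\<And>i j. i < N \<Longrightarrow> j < N \<Longrightarrow> A $$ (i,j) = (\<Sum>k<N. of_real (l k) * V i k * cnj (V j k))"
    "\<And>i k. i < N \<Longrightarrow> k < N \<Longrightarrow> (\<Sum>j<N. A $$ (i,j) * V j k) = of_real (l k) * V i k"
    "vn_entropy A = - (\<Sum>k<N. ent_term (l k))"
    "of_real (\<Sum>k<N. l k) = mtrace A"
    "\<And>k. k < N \<Longrightarrow> of_real (l k) = qform N A (\<lambda>i. V i k)"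
  using assms unfolding eigensystem_def by blast+

lemma hermitian_eigensystem:
  assumes A: "A \<in> carrier_mat N N" "adj A = A"
  shows "\<exists>V l. eigensystem N A V l"
proof -
  obtain V l where V: "V \<in> carrier_mat N N" "adj V * V = 1\<^sub>m N" "A * V = V * real_diag N l"
    using hermitian_diagonalization[OF A] by blast
  have V': "V * adj V = 1\<^sub>m N"
    using mat_mult_left_right_inverse[OF _ V(1) V(2)] V(1) by simp
  have dec: "A = V * real_diag N l * adj V"
  proof -
    have "V * real_diag N l * adj V = A * (V * adj V)"
      unfolding V(3)[symmetric] using A V(1) by (simp add: assoc_mult_mat[of _ N N _ N _ N])
    thus ?thesis using A V' by simp
  qed
  define X where "X = (\<lambda>i j. V $$ (i,j))"
  have o1: "(\<Sum>i<N. cnj (X i j) * X i k) = (if j = k then 1 else 0)" if "j < N" "k < N" for j k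
    using arg_cong[OF V(2), of "\<lambda>M. M $$ (j,k)"] that V(1) unfolding X_def
    by (subst (asm) mult_entry[of _ N N _ N]) (auto simp: adj_entry[of _ N N])
  have o2: "(\<Sum>k<N. X i k * cnj (X j k)) = (if i = j then 1 else 0)" if "i < N" "j < N" for i j
    using arg_cong[OF V', of "\<lambda>M. M $$ (i,j)"] that V(1) unfolding X_def
    by (subst (asm) mult_entry[of _ N N _ N]) (auto simp: adj_entry[of _ N N])
  have VD: "(V * real_diag N l) $$ (i,k) = of_real (l k) * X i k" if "i < N" "k < N" for i k
  proof -
    have "(V * real_diag N l) $$ (i,k) = (\<Sum>j<N. V $$ (i,j) * real_diag N l $$ (j,k))"
      by (rule mult_entry[OF V(1) _ that]) simp
    also have "\<dots> = (\<Sum>j<N. if j = k then of_real (l k) * V $$ (i,k) else 0)"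
      by (rule sum.cong) (use that in \<open>auto simp: real_diag_def\<close>)
    finally show ?thesis using that by (simp add: X_def)
  qed
  have sp: "A $$ (i,j) = (\<Sum>k<N. of_real (l k) * X i k * cnj (X j k))" if "i < N" "j < N" for i j
    using that V(1)
    by (subst dec, subst mult_entry[of _ N N _ N])
      (auto simp: VD adj_entry[of _ N N] X_def simp del: index_mult_mat)
  have ev: "(\<Sum>j<N. A $$ (i,j) * X j k) = of_real (l k) * X i k" if "i < N" "k < N" for i k
    using mult_entry[OF A(1) V(1) that] V(3) VD[OF that] by (simp add: X_def)
  have lk: "of_real (l k) = qform N A (\<lambda>i. X i k)" if "k < N" for k
  proof -
    have "qform N A (\<lambda>i. X i k) = (\<Sum>i<N. cnj (X i k) * (\<Sum>j<N. A $$ (i,j) * X j k))"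
      by (simp add: qform_def sum_distrib_left mult.assoc)
    also have "\<dots> = (\<Sum>i<N. cnj (X i k) * (of_real (l k) * X i k))"
      by (rule sum.cong) (use ev that in auto)
    also have "\<dots> = of_real (l k) * (\<Sum>i<N. cnj (X i k) * X i k)"
      by (simp add: sum_distrib_left algebra_simps)
    finally show ?thesis using o1[OF that that] by simp
  qed
  have tr: "of_real (\<Sum>k<N. l k) = mtrace A"
  proof -
    have "mtrace A = (\<Sum>i<N. \<Sum>k<N. of_real (l k) * X i k * cnj (X i k))"
      unfolding mtrace_def using A(1) sp by (auto intro!: sum.cong)
    also have "\<dots> = (\<Sum>k<N. of_real (l k) * (\<Sum>i<N. cnj (X i k) * X i k))"
      by (subst sum.swap) (simp add: sum_distrib_left algebra_simps)
    also have "\<dots> = (\<Sum>k<N. of_real (l k))" by (rule sum.cong) (use o1 in auto)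
    finally show ?thesis by simp
  qed
  \<comment> \<open>Similarity to the diagonal matrix identifies the characteristic polynomials, so
    the multiset of roots read by \<open>vn_entropy\<close> is that of the
    \<open>l k\<close>.\<close>
  have "similar_mat_wit A (real_diag N l) V (adj V)"
    unfolding similar_mat_wit_def using V V' dec A by (auto simp: Let_def)
  hence "similar_mat A (real_diag N l)" unfolding similar_mat_def by blast
  hence "char_poly A = char_poly (real_diag N l)" by (rule char_poly_similar)
  also have "\<dots> = (\<Prod>a\<leftarrow>diag_mat (real_diag N l). [:- a, 1:])"
    by (rule char_poly_upper_triangular[of _ N]) (auto simp: real_diag_def)
  finally have "proots (char_poly A) = mset (diag_mat (real_diag N l))"
    by (simp add: proots_prod_linear)
  also have "diag_mat (real_diag N l) = map (\<lambda>k. of_real (l k)) [0..<N]"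
    by (auto simp: diag_mat_def real_diag_def)
  finally have "vn_entropy A = - (\<Sum>k\<leftarrow>[0..<N]. ent_term (l k))"
    unfolding vn_entropy_def by (simp add: multiset.map_comp o_def flip: sum_mset_sum_list)
  hence ent: "vn_entropy A = - (\<Sum>k<N. ent_term (l k))"
    by (simp add: interv_sum_list_conv_sum_set_nat atLeast0LessThan)
  have "eigensystem N A X l"
    unfolding eigensystem_def using o1 o2 sp ev ent tr lk by blast
  thus ?thesis by blast
qed

lemma psd_carrier: "psd N A \<Longrightarrow> A \<in> carrier_mat N N"
  and psd_adj: "psd N A \<Longrightarrow> adj A = A"
  and psd_qform: "psd N A \<Longrightarrow> 0 \<le> Re (qform N A v)"
  by (auto simp: psd_def)

lemma psd_eigenvalue_nonneg:
  assumes "psd N A" "eigensystem N A V l" "k < N"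
  shows "0 \<le> l k"
  using psd_qform[OF assms(1), of "\<lambda>i. V i k"] eigensystemD(7)[OF assms(2,3)]
  by (metis Re_complex_of_real)

text \<open>Scaling the k-th eigenvector by the square root of its eigenvalue gives
  \<open>A = R R*\<close>. Together with \<open>psd_of_gram\<close> this carries positivity through
  index formulas.\<close>

lemma psd_gram:
  assumes "psd N A"
  obtains R :: "nat \<Rightarrow> nat \<Rightarrow> complex" where
    "\<And>i j. i < N \<Longrightarrow> j < N \<Longrightarrow> A $$ (i,j) = (\<Sum>k<N. R i k * cnj (R j k))"
proof -
  obtain V l where es: "eigensystem N A V l"
    using hermitian_eigensystem[OF psd_carrier[OF assms] psd_adj[OF assms]] by blast
  note sp = eigensystemD(3)[OF es]
  have *: "of_real (l k) = of_real (sqrt (l k)) * (of_real (sqrt (l k)) :: complex)" if "k < N" for k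
    using that psd_eigenvalue_nonneg[OF assms es] by (simp flip: of_real_mult)
  have "A $$ (i,j) = (\<Sum>k<N. (of_real (sqrt (l k)) * V i k) * cnj (of_real (sqrt (l k)) * V j k))"
    if "i < N" "j < N" for i j
    unfolding sp[OF that]
    by (intro sum.cong refl, subst *) (auto simp: ac_simps)
  thus thesis using that[of "\<lambda>i k. of_real (sqrt (l k)) * V i k"] by blast
qed

text \<open>With \<open>A = R R*\<close> the quadratic form is the squared norm of
  \<open>u = R* v\<close>; if it vanishes then so do \<open>u\<close> and
  \<open>A v = R u\<close>.\<close>

lemma psd_kernel:
  assumes "psd N A" "Re (qform N A v) = 0" "i < N"
  shows "(\<Sum>j<N. A $$ (i,j) * v j) = 0"
proof -
  obtain R where R: "\<And>i j. i < N \<Longrightarrow> j < N \<Longrightarrow> A $$ (i,j) = (\<Sum>k<N. R i k * cnj (R j k))"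
    using psd_gram[OF assms(1)] by blast
  define u where "u k = (\<Sum>j<N. cnj (R j k) * v j)" for k
  have "qform N A v = (\<Sum>i<N. \<Sum>j<N. \<Sum>k<N. cnj (v i) * R i k * (cnj (R j k) * v j))"
    unfolding qform_def by (simp add: R sum_distrib_left sum_distrib_right mult.assoc)
  also have "\<dots> = (\<Sum>i<N. \<Sum>k<N. cnj (v i) * R i k * u k)"
    unfolding u_def by (subst sum.swap) (simp add: sum_distrib_left)
  also have "\<dots> = (\<Sum>k<N. (\<Sum>i<N. cnj (v i) * R i k) * u k)"
    by (subst sum.swap) (simp add: sum_distrib_right)
  also have "\<dots> = (\<Sum>k<N. of_real ((cmod (u k))\<^sup>2))"
    by (rule sum.cong) (auto simp: complex_norm_square u_def mult.commute simp del: of_real_power)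
  finally have "Re (of_real (\<Sum>k<N. (cmod (u k))\<^sup>2)) = 0"
    using assms(2) by simp
  hence "(\<Sum>k<N. (cmod (u k))\<^sup>2) = 0" by (simp only: Re_complex_of_real)
  hence u: "u k = 0" if "k < N" for k
    using that by (subst (asm) sum_nonneg_eq_0_iff) auto
  have "(\<Sum>j<N. A $$ (i,j) * v j) = (\<Sum>j<N. \<Sum>k<N. R i k * (cnj (R j k) * v j))"
    by (rule sum.cong) (use assms(3) in \<open>auto simp: R sum_distrib_right mult.assoc\<close>)
  also have "\<dots> = (\<Sum>k<N. R i k * u k)"
    unfolding u_def by (subst sum.swap) (simp add: sum_distrib_left)
  finally show ?thesis using u by simp
qed

section \<open>Convexity of x ln x and two entropy evaluations\<close>

lemma ent_term_tangent:
  assumes "0 < x" "0 \<le> y"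
  shows "ent_term x + (ln x + 1) * (y - x) \<le> ent_term y"
\<comment> \<open>At \<open>y = 0\<close> the logarithm is of no use; \<open>ent_term\<close> is 0
  there and the claim reduces to \<open>- x \<le> 0\<close>.\<close>
proof (cases "y = 0")
  case True
  thus ?thesis using assms by (simp add: ent_term_def algebra_simps)
next
  case False
  hence y: "0 < y" using assms by simp
  have "ln (x / y) \<le> x / y - 1" using assms y by (intro ln_le_minus_one) auto
  hence "y * (ln x - ln y) \<le> y * (x / y - 1)" using assms y by (simp add: ln_div)
  thus ?thesis using assms y by (simp add: ent_term_def algebra_simps)
qed

text \<open>The tangent at the barycentre is averaged with the weights. It exists only at a positive
  barycentre; at 0 every \<open>b j * m j\<close> vanishes and with it every term on the
  right.\<close>

lemma ent_term_jensen:
  assumes "finite J" "\<And>j. j \<in> J \<Longrightarrow> 0 \<le> b j" "(\<Sum>j\<in>J. b j) = 1" "\<And>j. j \<in> J \<Longrightarrow> 0 \<le> m j"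
  shows "ent_term (\<Sum>j\<in>J. b j * m j) \<le> (\<Sum>j\<in>J. b j * ent_term (m j))"
proof (cases "(\<Sum>j\<in>J. b j * m j) = 0")
  case True
  hence "\<forall>j\<in>J. b j * m j = 0" using assms by (subst (asm) sum_nonneg_eq_0_iff) auto
  hence "\<forall>j\<in>J. b j * ent_term (m j) = 0" by (auto simp: ent_term_def)
  thus ?thesis using True by (simp add: ent_term_def)
next
  case False
  define x where "x = (\<Sum>j\<in>J. b j * m j)"
  have "0 \<le> x" unfolding x_def using assms by (intro sum_nonneg) auto
  hence x: "0 < x" using False x_def by simp
  have "ent_term x = (\<Sum>j\<in>J. b j * (ent_term x + (ln x + 1) * (m j - x)))"
  proof -
    have "(\<Sum>j\<in>J. b j * (ent_term x + (ln x + 1) * (m j - x)))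
      = (\<Sum>j\<in>J. b j * (ent_term x - (ln x + 1) * x) + (ln x + 1) * (b j * m j))"
      by (rule sum.cong) (auto simp: algebra_simps)
    also have "\<dots> = ent_term x - (ln x + 1) * x + (ln x + 1) * x"
      unfolding sum.distrib sum_distrib_right[symmetric] sum_distrib_left[symmetric]
      by (simp add: assms(3) x_def)
    finally show ?thesis by simp
  qed
  also have "\<dots> \<le> (\<Sum>j\<in>J. b j * ent_term (m j))"
    using assms x by (intro sum_mono mult_left_mono ent_term_tangent) auto
  finally show ?thesis by (simp add: x_def)
qed

lemma vn_entropy_le_ln:
  assumes "psd N A" "mtrace A = 1"
  shows "vn_entropy A \<le> ln (real N)"
proof -
  obtain V l where es: "eigensystem N A V l"
    using hermitian_eigensystem[OF psd_carrier[OF assms(1)] psd_adj[OF assms(1)]] by blast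
  note ent = eigensystemD(5)[OF es] and tr = eigensystemD(6)[OF es]
  note l0 = psd_eigenvalue_nonneg[OF assms(1) es]
  have l1: "(\<Sum>k<N. l k) = 1" using tr assms(2) by (metis of_real_eq_1_iff)
  have N: "0 < N" using l1 by (cases N) auto
  \<comment> \<open>Jensen with uniform weights: the mean eigenvalue is \<open>1/N\<close> because
    the trace is 1.\<close>
  have "ent_term (\<Sum>k<N. (1/N) * l k) \<le> (\<Sum>k<N. (1/N) * ent_term (l k))"
    using l0 N by (intro ent_term_jensen) auto
  hence "ent_term (1/N) \<le> (1/N) * (\<Sum>k<N. ent_term (l k))"
    using l1 by (simp add: sum_distrib_left flip: sum_divide_distrib)
  hence "- ln N \<le> (\<Sum>k<N. ent_term (l k))"
    using N by (simp add: ent_term_def ln_div field_simps)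
  thus ?thesis using ent by simp
qed

text \<open>Every eigenvalue is 0 or \<open>c\<close>, so on the spectrum x ln x equals x ln c, and
  the trace sums this to ln c. The multiplicity of \<open>c\<close> never has to be computed.
  Stabiliser states and the maximally mixed state are both of this kind.\<close>

lemma vn_entropy_scaled_projection:
  assumes A: "A \<in> carrier_mat N N" "adj A = A" and sq: "A * A = of_real c \<cdot>\<^sub>m A"
    and c: "0 < c" and tr: "mtrace A = 1"
  shows "vn_entropy A = - ln c"
proof -
  obtain V l where es: "eigensystem N A V l"
    using hermitian_eigensystem[OF A] by blast
  note o1 = eigensystemD(1)[OF es] and ev = eigensystemD(4)[OF es]
    and ent = eigensystemD(5)[OF es] and lt = eigensystemD(6)[OF es]
  have *: "l k = 0 \<or> l k = c" if k: "k < N" for k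
  proof -
    have "\<exists>i<N. V i k \<noteq> 0"
    proof (rule ccontr)
      assume "\<not> ?thesis"
      hence "(\<Sum>i<N. cnj (V i k) * V i k) = 0" by (intro sum.neutral) auto
      thus False using o1[OF k k] by simp
    qed
    then obtain i where i: "i < N" "V i k \<noteq> 0" by blast
    have "of_real c * (of_real (l k) * V i k) = (\<Sum>j<N. (A * A) $$ (i,j) * V j k)"
      unfolding sq ev[OF i(1) k, symmetric] sum_distrib_left
      by (rule sum.cong) (use A i in auto)
    also have "\<dots> = (\<Sum>j<N. \<Sum>m<N. A $$ (i,m) * (A $$ (m,j) * V j k))"
      by (rule sum.cong) (use A i in \<open>auto simp: mult_entry[OF A(1) A(1)] sum_distrib_right mult.assoc
          simp del: index_mult_mat\<close>)
    also have "\<dots> = (\<Sum>m<N. A $$ (i,m) * (of_real (l k) * V m k))"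
      by (subst sum.swap) (auto simp: ev[OF _ k] simp flip: sum_distrib_left intro!: sum.cong)
    also have "\<dots> = of_real (l k) * (\<Sum>m<N. A $$ (i,m) * V m k)"
      by (simp add: sum_distrib_left mult.left_commute)
    also have "\<dots> = of_real (l k) * (of_real (l k) * V i k)" using ev[OF i(1) k] by simp
    finally have "(of_real (c * l k) :: complex) = of_real (l k * l k)" using i(2) by simp
    hence "c * l k = l k * l k" by (simp only: of_real_eq_iff)
    thus ?thesis by auto
  qed
  have "(\<Sum>k<N. ent_term (l k)) = (\<Sum>k<N. l k * ln c)"
  proof (rule sum.cong)
    fix k assume "k \<in> {..<N}"
    thus "ent_term (l k) = l k * ln c" using *[of k] c by (auto simp: ent_term_def)
  qed simp
  also have "\<dots> = ln c"
    using lt tr unfolding sum_distrib_right[symmetric] by (metis mult_1 of_real_eq_1_iff)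
  finally show ?thesis using ent by simp
qed

section \<open>Weyl operators in odd dimension\<close>

lemma digits_lt:
  fixes f :: "nat \<Rightarrow> nat"
  assumes "0 < d" "\<And>k. f k < d"
  shows "(\<Sum>k<n. f k * d ^ k) < d ^ n"
proof (induction n)
  case (Suc n)
  have "f n * d ^ n \<le> (d - 1) * d ^ n" using assms(2)[of n] by (intro mult_right_mono) auto
  hence "(\<Sum>k<Suc n. f k * d ^ k) < d ^ n + (d - 1) * d ^ n"
    using Suc add_less_le_mono[OF Suc] by (simp only: sum.lessThan_Suc)
  also have "\<dots> = d ^ Suc n" using assms(1) by (cases d) auto
  finally show ?case .
qed simp

lemma digit_of_sum:
  fixes f :: "nat \<Rightarrow> nat"
  assumes "0 < d" "\<And>k. f k < d" "k < n"
  shows "digit d (\<Sum>j<n. f j * d ^ j) k = f k"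
  using assms(3)
proof (induction n)
  case (Suc n)
  show ?case
  proof (cases "k = n")
    case True
    thus ?thesis using digits_lt[of d f n] assms(1,2) by (simp add: digit_def)
  next
    case False
    hence k: "k < n" using Suc by simp
    then obtain m where m: "n = k + Suc m" using less_iff_Suc_add by auto
    have e: "f n * d ^ n = d ^ k * (d * (f n * d ^ m))" by (simp add: m power_add)
    have "((\<Sum>j<n. f j * d ^ j) + f n * d ^ n) div d ^ k
        = d * (f n * d ^ m) + (\<Sum>j<n. f j * d ^ j) div d ^ k"
      unfolding e by (rule div_mult_self2) (use assms(1) in simp)
    thus ?thesis using Suc.IH[OF k] by (simp add: digit_def)
  qed
qed simp

lemma sum_of_digits: "(\<Sum>k<n. digit d a k * d ^ k) = a mod d ^ n"
proof (induction n)
  case (Suc n)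
  have "a mod d ^ Suc n = d ^ n * (a div d ^ n mod d) + a mod d ^ n"
    by (simp add: mod_mult2_eq mult.commute[of d])
  thus ?case using Suc by (simp add: digit_def)
qed simp

lemma prod_if_zero:
  fixes f :: "'a \<Rightarrow> complex"
  assumes "finite A"
  shows "(\<Prod>k\<in>A. if P k then f k else 0) = (if \<forall>k\<in>A. P k then \<Prod>k\<in>A. f k else 0)"
  using assms by (induction A rule: finite_induct) auto

lemma chi_add: "chi d (a + b) = chi d a * chi d b"
  by (simp add: chi_def cis_mult add_divide_distrib ring_distribs)

lemma chi_0 [simp]: "chi d 0 = 1"
  by (simp add: chi_def)

lemma cnj_chi: "cnj (chi d k) = chi d (- k)"
  by (simp add: chi_def cis_cnj)

lemma norm_chi [simp]: "cmod (chi d k) = 1"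
  by (simp add: chi_def)

lemma chi_nonzero [simp]: "chi d k \<noteq> 0"
  by (simp add: chi_def)

lemma chi_sum: "chi d (\<Sum>k\<in>A. f k) = (\<Prod>k\<in>A. chi d (f k))"
  by (induction A rule: infinite_finite_induct) (auto simp: chi_add)

lemma chi_eqI:
  assumes "0 < d" "a = b + int d * m"
  shows "chi d a = chi d b"
proof -
  have "2 * pi * of_int (int d * m) / of_nat d = 2 * pi * of_int m"
    using assms(1) by simp
  hence "chi d (int d * m) = cis (2 * pi * of_int m)"
    unfolding chi_def by (rule arg_cong)
  also have "\<dots> = 1" by (rule cis_multiple_2pi) simp
  finally show ?thesis using assms(2) by (simp add: chi_add)
qed

lemma chi_cong:
  assumes "0 < d" "[a = b] (mod int d)"
  shows "chi d a = chi d b"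
proof -
  obtain m where "a = b + int d * m"
    using assms(2) by (metis cong_iff_lin cong_sym)
  thus ?thesis using chi_eqI[OF assms(1)] by blast
qed

lemma chi_eq_1_imp_dvd:
  assumes "0 < d" "chi d k = 1"
  shows "int d dvd k"
proof -
  have "cos (2 * pi * of_int k / of_nat d) = 1"
    using assms(2) by (simp add: chi_def complex_eq_iff)
  then obtain m :: int where "2 * pi * of_int k / of_nat d = of_int m * 2 * pi"
    using cos_one_2pi_int by blast
  hence "(of_int k :: real) = of_int (m * int d)" using assms(1) by (simp add: field_simps)
  hence "k = m * int d" by (simp only: of_int_eq_iff)
  thus ?thesis by simp
qed

text \<open>Units modulo \<open>d\<close> take the place of nonzero residues, and oddness provides
  the inverse of 2 in the Weyl phases.\<close>

locale odd_qudits =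
  fixes d n :: nat
  assumes d_gt_1: "1 < d" and d_odd: "odd d"
begin

abbreviation "Z \<equiv> zvecs d n"
abbreviation "D \<equiv> d ^ n"
abbreviation "E \<equiv> enc d n"
abbreviation "W \<equiv> weyl d n"

text \<open>
  Vectors over \<open>\<int>/d\<close> are represented by arbitrary integer functions up to \<open>vcong\<close>, with normal forms
  in \<open>Z\<close>. Since \<open>E\<close> is compatible with \<open>vcong\<close>, matrix entries can be addressed as \<open>A $$ (E a, E b)\<close>.
\<close>

definition vcong :: "(nat \<Rightarrow> int) \<Rightarrow> (nat \<Rightarrow> int) \<Rightarrow> bool" where
  "vcong u v \<longleftrightarrow> (\<forall>k<n. [u k = v k] (mod int d))"

definition red :: "(nat \<Rightarrow> int) \<Rightarrow> (nat \<Rightarrow> int)" where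
  "red v = (\<lambda>k. if k < n then v k mod int d else 0)"

definition dotp :: "(nat \<Rightarrow> int) \<Rightarrow> (nat \<Rightarrow> int) \<Rightarrow> int" where
  "dotp p q = (\<Sum>k<n. p k * q k)"

definition half :: int where "half = inv_mod d 2"

lemma d_pos [simp]: "0 < d" using d_gt_1 by simp

lemma d_nonzero [simp]: "d \<noteq> 0" using d_gt_1 by simp

lemma half_cong: "[2 * half = 1] (mod int d)"
proof -
  have "coprime 2 (int d)" using d_odd by simp
  then obtain b where b: "[2 * b = 1] (mod int d)" using cong_solve_coprime_int by blast
  have "[2 * (b mod int d) = 1] (mod int d)"
    using b unfolding cong_def by (simp add: mod_mult_right_eq)
  hence "\<exists>b. 0 \<le> b \<and> b < int d \<and> [2 * b = 1] (mod int d)"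
    using d_pos by (intro exI[of _ "b mod int d"]) auto
  thus ?thesis unfolding half_def inv_mod_def by (rule someI2_ex) auto
qed

section \<open>Residue vectors and their encoding as basis indices\<close>

lemma vcong_refl [simp]: "vcong v v"
  and vcong_sym: "vcong u v \<Longrightarrow> vcong v u"
  and vcong_trans: "vcong u v \<Longrightarrow> vcong v w \<Longrightarrow> vcong u w"
  by (auto simp: vcong_def intro: cong_sym cong_trans)

lemma red_in_Z [simp]: "red v \<in> Z"
  by (auto simp: red_def zvecs_def)

lemma vcong_red [simp]: "vcong (red v) v" "vcong v (red v)"
  by (auto simp: red_def vcong_def cong_def)

lemma Z_eqI: "u \<in> Z \<Longrightarrow> v \<in> Z \<Longrightarrow> vcong u v \<Longrightarrow> u = v"
proof (rule ext)
  fix k assume *: "u \<in> Z" "v \<in> Z" "vcong u v"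
  show "u k = v k"
  proof (cases "k < n")
    case True
    hence "[u k = v k] (mod int d)" using * by (simp add: vcong_def)
    thus ?thesis using * True by (auto simp: zvecs_def cong_def)
  qed (use * in \<open>auto simp: zvecs_def\<close>)
qed

lemma red_eq [simp]: "v \<in> Z \<Longrightarrow> red v = v"
  by (rule Z_eqI) auto

lemma red_eq_iff: "red u = red v \<longleftrightarrow> vcong u v"
  by (metis Z_eqI red_in_Z vcong_red vcong_sym vcong_trans)

lemma zero_in_Z [simp]: "(\<lambda>_. 0) \<in> Z"
  by (simp add: zvecs_def)

lemma enc_lt [simp]: "E v < D"
  unfolding enc_def by (rule digits_lt) (auto simp: nat_less_iff)

lemma digit_enc: "k < n \<Longrightarrow> digit d (E v) k = nat (v k mod int d)"
  unfolding enc_def by (rule digit_of_sum) (auto simp: nat_less_iff)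

lemma enc_eq_iff: "E u = E v \<longleftrightarrow> vcong u v"
proof
  assume "E u = E v"
  hence "nat (u k mod int d) = nat (v k mod int d)" if "k < n" for k
    using digit_enc[OF that] by metis
  hence "u k mod int d = v k mod int d" if "k < n" for k
    using that d_pos by (metis eq_nat_nat_iff of_nat_0_less_iff pos_mod_sign)
  thus "vcong u v" by (auto simp: vcong_def cong_def)
next
  assume "vcong u v"
  thus "E u = E v" unfolding enc_def vcong_def cong_def by (intro sum.cong) auto
qed

lemma ex_enc:
  assumes "a < D"
  shows "\<exists>v\<in>Z. a = E v"
proof
  define v where "v = (\<lambda>k. if k < n then int (digit d a k) else 0)"
  show "v \<in> Z" using d_pos by (auto simp: v_def zvecs_def digit_def)
  have "E v = (\<Sum>k<n. digit d a k * d ^ k)"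
    unfolding enc_def v_def by (intro sum.cong) (auto simp: digit_def nat_mod_distrib)
  thus "a = E v" using sum_of_digits[where n = n and d = d and a = a] assms by simp
qed

lemma bij_enc: "bij_betw E Z {..<D}"
  unfolding bij_betw_def
proof
  show "inj_on E Z" by (rule inj_onI) (auto simp: enc_eq_iff intro: Z_eqI)
  show "E ` Z = {..<D}" using ex_enc by auto
qed

lemma finite_Z [simp]: "finite Z"
  using bij_enc bij_betw_finite by blast

lemma card_Z: "card Z = D"
  using bij_betw_same_card[OF bij_enc] by simp

lemma sum_enc: "(\<Sum>a<D. F a) = (\<Sum>v\<in>Z. F (E v))"
  by (rule sum.reindex_bij_betw[OF bij_enc, symmetric])

lemma bij_affine:
  assumes "coprime a (int d)"
  shows "bij_betw (\<lambda>v. red (\<lambda>k. a * v k + b k)) Z Z"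
proof -
  have "inj_on (\<lambda>v. red (\<lambda>k. a * v k + b k)) Z"
  proof (rule inj_onI)
    fix u v assume *: "u \<in> Z" "v \<in> Z" "red (\<lambda>k. a * u k + b k) = red (\<lambda>k. a * v k + b k)"
    hence "\<forall>k<n. [a * u k + b k = a * v k + b k] (mod int d)" by (simp add: red_eq_iff vcong_def)
    hence "vcong u v"
      unfolding vcong_def using assms by (simp add: cong_add_rcancel cong_mult_lcancel)
    thus "u = v" using * Z_eqI by blast
  qed
  moreover have "(\<lambda>v. red (\<lambda>k. a * v k + b k)) ` Z \<subseteq> Z" by auto
  ultimately show ?thesis
    by (simp add: bij_betw_def endo_inj_surj)
qed

text \<open>Substitution rule over \<int>/d. The affine image of a vector need not lie in
  \<open>Z\<close>, so \<open>F\<close> has to ignore the choice of representative.\<close>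

lemma sum_affine:
  assumes "coprime a (int d)" "\<And>u v. vcong u v \<Longrightarrow> F u = F v"
  shows "(\<Sum>v\<in>Z. F (\<lambda>k. a * v k + b k)) = (\<Sum>v\<in>Z. F v)"
proof -
  have "(\<Sum>v\<in>Z. F (\<lambda>k. a * v k + b k)) = (\<Sum>v\<in>Z. F (red (\<lambda>k. a * v k + b k)))"
    by (rule sum.cong[OF refl], rule assms(2)) simp
  also have "\<dots> = (\<Sum>v\<in>Z. F v)" by (rule sum.reindex_bij_betw[OF bij_affine[OF assms(1)]])
  finally show ?thesis .
qed

lemma sum_delta:
  assumes "\<And>u v. vcong u v \<Longrightarrow> F u = (F v :: complex)"
  shows "(\<Sum>v\<in>Z. if vcong v u then F v else 0) = F u"
proof -
  have "(\<Sum>v\<in>Z. if vcong v u then F v else 0) = (\<Sum>v\<in>Z. if v = red u then F v else 0)"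
    by (rule sum.cong) (auto, metis red_eq red_eq_iff)
  also have "\<dots> = F (red u)" by simp
  also have "\<dots> = F u" by (rule assms) simp
  finally show ?thesis .
qed

lemma dotp_add_left: "dotp (\<lambda>k. p k + p' k) q = dotp p q + dotp p' q"
  and dotp_add_right: "dotp p (\<lambda>k. q k + q' k) = dotp p q + dotp p q'"
  and dotp_diff_left: "dotp (\<lambda>k. p k - p' k) q = dotp p q - dotp p' q"
  and dotp_diff_right: "dotp p (\<lambda>k. q k - q' k) = dotp p q - dotp p q'"
  and dotp_mult_left: "dotp (\<lambda>k. c * p k) q = c * dotp p q"
  and dotp_mult_right: "dotp p (\<lambda>k. c * q k) = c * dotp p q"
  and dotp_uminus_left: "dotp (\<lambda>k. - p k) q = - dotp p q"
  and dotp_uminus_right: "dotp p (\<lambda>k. - q k) = - dotp p q"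
  and dotp_zero_left: "dotp (\<lambda>k. 0) q = 0"
  and dotp_zero_right: "dotp p (\<lambda>k. 0) = 0"
  by (simp_all add: dotp_def sum.distrib sum_subtractf sum_negf sum_distrib_left algebra_simps)

lemmas dotp_simps = dotp_add_left dotp_add_right dotp_diff_left dotp_diff_right dotp_mult_left
  dotp_mult_right dotp_uminus_left dotp_uminus_right dotp_zero_left dotp_zero_right

lemma dotp_commute: "dotp p q = dotp q p"
  by (simp add: dotp_def mult.commute)

lemma dotp_cong: "vcong p p' \<Longrightarrow> vcong q q' \<Longrightarrow> [dotp p q = dotp p' q'] (mod int d)"
  unfolding dotp_def vcong_def by (intro cong_sum cong_mult) auto

lemma chi_dotp_cong: "vcong p p' \<Longrightarrow> vcong q q' \<Longrightarrow> chi d (c * dotp p q) = chi d (c * dotp p' q')"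
  by (intro chi_cong cong_mult dotp_cong) auto

text \<open>If some \<open>u j\<close> is nonzero, translating the summation variable by the unit
  vector \<open>e\<close> multiplies the sum by \<open>chi d (u j) \<noteq> 1\<close>, so the sum
  vanishes.\<close>

lemma sum_chi: "(\<Sum>v\<in>Z. chi d (dotp v u)) = (if vcong u (\<lambda>_. 0) then of_nat D else 0)"
proof (cases "vcong u (\<lambda>_. 0)")
  case True
  have "chi d (dotp v u) = 1" for v
    using chi_dotp_cong[OF vcong_refl[of v] True, of 1] by (simp add: dotp_simps)
  thus ?thesis using True by (simp add: card_Z)
next
  case False
  then obtain j where j: "j < n" "\<not> [u j = 0] (mod int d)" by (auto simp: vcong_def)
  define e :: "nat \<Rightarrow> int" where "e = (\<lambda>k. if k = j then 1 else 0)"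
  define s where "s = (\<Sum>v\<in>Z. chi d (dotp v u))"
  have e: "dotp e u = u j"
  proof -
    have "dotp e u = (\<Sum>k<n. if k = j then u j else 0)"
      unfolding dotp_def e_def by (rule sum.cong) auto
    thus ?thesis using j by simp
  qed
  have "s = (\<Sum>v\<in>Z. chi d (dotp (\<lambda>k. 1 * v k + e k) u))"
    unfolding s_def by (rule sum_affine[symmetric]) (auto intro!: chi_cong dotp_cong)
  also have "\<dots> = s * chi d (u j)"
    by (simp add: s_def dotp_simps e chi_add sum_distrib_right)
  finally have "s * (chi d (u j) - 1) = 0" by (simp add: algebra_simps)
  moreover have "chi d (u j) \<noteq> 1"
    using chi_eq_1_imp_dvd[OF d_pos] j by (auto simp: cong_0_iff)
  ultimately show ?thesis using False s_def by simp
qed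

lemma mat_eqI:
  assumes "A \<in> carrier_mat D D" "B \<in> carrier_mat D D"
    and "\<And>a b. A $$ (E a, E b) = B $$ (E a, E b)"
  shows "A = B"
proof (rule eq_matI)
  fix i j assume "i < dim_row B" "j < dim_col B"
  hence "i < D" "j < D" using assms by auto
  thus "A $$ (i,j) = B $$ (i,j)" using assms(3) ex_enc by metis
qed (use assms in auto)

lemma mult_entry_enc:
  assumes "A \<in> carrier_mat D D" "B \<in> carrier_mat D D"
  shows "(A * B) $$ (E a, E b) = (\<Sum>v\<in>Z. A $$ (E a, E v) * B $$ (E v, E b))"
  using mult_entry[OF assms enc_lt enc_lt] by (simp add: sum_enc)

lemma mtrace_enc: "A \<in> carrier_mat D D \<Longrightarrow> mtrace A = (\<Sum>v\<in>Z. A $$ (E v, E v))"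
  by (auto simp: mtrace_def sum_enc)

section \<open>Entries, products, adjoints and traces of Weyl operators\<close>

lemma weyl_carrier [simp]: "W p q \<in> carrier_mat D D"
  by (simp add: weyl_def)

lemma weyl1_entry:
  "weyl1 d p q $$ (nat (a mod int d), nat (b mod int d))
    = (if [a = b + q] (mod int d) then chi d (- half * (p * q) + p * a) else 0)"
proof -
  have d2: "d \<noteq> 2" using d_odd by auto
  have *: "chi d (- inv_mod d 2 * (p mod int d) * (q mod int d)) * chi d (p mod int d * (a mod int d))
      = chi d (- half * (p * q) + p * a)"
    unfolding chi_add[symmetric] half_def
    by (rule chi_cong[OF d_pos], unfold mult.assoc, rule cong_add; (rule cong_mult, (simp; fail))+) (auto intro: cong_mult)
  have lt: "nat (a mod int d) < d" "nat (b mod int d) < d" by (auto simp: nat_less_iff)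
  have "int (nat (a mod int d)) mod int d = (int (nat (b mod int d)) + q mod int d) mod int d
      \<longleftrightarrow> [a = b + q] (mod int d)"
    by (simp add: cong_def mod_add_eq)
  thus ?thesis
    using lt d2 * unfolding weyl1_def Let_def by (simp add: mult.assoc)
qed

lemma weyl_entry:
  "W p q $$ (E a, E b) = (if vcong a (\<lambda>k. b k + q k) then chi d (- half * dotp p q + dotp p a) else 0)"
proof -
  have "W p q $$ (E a, E b)
      = (\<Prod>k<n. if [a k = b k + q k] (mod int d) then chi d (- half * (p k * q k) + p k * a k) else 0)"
    unfolding weyl_def by (simp add: digit_enc weyl1_entry)
  also have "\<dots> = (if vcong a (\<lambda>k. b k + q k)
      then (\<Prod>k<n. chi d (- half * (p k * q k) + p k * a k)) else 0)"
    by (subst prod_if_zero) (auto simp: vcong_def)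
  also have "(\<Prod>k<n. chi d (- half * (p k * q k) + p k * a k)) = chi d (- half * dotp p q + dotp p a)"
    unfolding chi_sum[symmetric] dotp_def sum.distrib sum_distrib_left by simp
  finally show ?thesis .
qed

lemma weyl_cong: "vcong p p' \<Longrightarrow> vcong q q' \<Longrightarrow> W p q = W p' q'"
proof (rule mat_eqI)
  fix a b assume *: "vcong p p'" "vcong q q'"
  have "vcong a (\<lambda>k. b k + q k) \<longleftrightarrow> vcong a (\<lambda>k. b k + q' k)"
    using *(2) unfolding vcong_def by (meson cong_add cong_refl cong_sym cong_trans)
  moreover have "chi d (- half * dotp p q + dotp p a) = chi d (- half * dotp p' q' + dotp p' a)"
    using * by (intro chi_cong cong_add cong_mult dotp_cong) auto
  ultimately show "W p q $$ (E a, E b) = W p' q' $$ (E a, E b)" by (simp add: weyl_entry)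
qed auto

lemma weyl_zero: "W (\<lambda>_. 0) (\<lambda>_. 0) = 1\<^sub>m D"
  by (rule mat_eqI) (auto simp: weyl_entry dotp_simps enc_eq_iff)

text \<open>Moving the shift of the first factor past the phase of the second costs a full character
  of \<open>dotp p' q\<close>; the symmetric prefactors of the Weyl operators turn this into half of
  the symplectic form.\<close>

lemma weyl_mult:
  "W p q * W p' q' = chi d (half * (dotp p q' - dotp q p')) \<cdot>\<^sub>m W (\<lambda>k. p k + p' k) (\<lambda>k. q k + q' k)"
proof (rule mat_eqI)
  fix a b
  define F where "F v = (if vcong a (\<lambda>k. v k + q k) then chi d (- half * dotp p q + dotp p a) else 0)
     * chi d (- half * dotp p' q' + dotp p' v)" for v
  have Fc: "F u = F v" if "vcong u v" for u v
  proof -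
    have "vcong a (\<lambda>k. u k + q k) \<longleftrightarrow> vcong a (\<lambda>k. v k + q k)"
      using that unfolding vcong_def by (meson cong_add cong_refl cong_sym cong_trans)
    moreover have "chi d (- half * dotp p' q' + dotp p' u) = chi d (- half * dotp p' q' + dotp p' v)"
      using that by (intro chi_cong cong_add cong_mult dotp_cong) auto
    ultimately show ?thesis by (simp add: F_def)
  qed
  have "(W p q * W p' q') $$ (E a, E b) = (\<Sum>v\<in>Z. if vcong v (\<lambda>k. b k + q' k) then F v else 0)"
    by (auto simp: mult_entry_enc weyl_entry F_def intro!: sum.cong)
  also have "\<dots> = F (\<lambda>k. b k + q' k)" by (rule sum_delta[OF Fc])
  also have "\<dots> = chi d (half * (dotp p q' - dotp q p')) * W (\<lambda>k. p k + p' k) (\<lambda>k. q k + q' k) $$ (E a, E b)"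
  proof (cases "vcong a (\<lambda>k. b k + q' k + q k)")
    case True
    hence 1: "vcong a (\<lambda>k. b k + (q k + q' k))" by (simp add: algebra_simps)
    have "[dotp p' a = dotp p' (\<lambda>k. b k + q' k + q k)] (mod int d)"
      using True by (intro dotp_cong) auto
    then obtain s where s: "dotp p' b + dotp p' q' + dotp p' q = dotp p' a + int d * s"
      by (auto simp: cong_iff_lin dotp_simps)
    \<comment> \<open>One copy of \<open>dotp p' q\<close> becomes two halves modulo
      \<open>d\<close>: one goes into the symplectic phase, the other into the prefactor of the
      product operator.\<close>
    obtain t where t: "1 = 2 * half + int d * t"
      using half_cong by (auto simp: cong_iff_lin)
    have "- half * dotp p q + dotp p a + (- half * dotp p' q' + dotp p' (\<lambda>k. b k + q' k))
      = - half * dotp p q + dotp p a - half * dotp p' q' + (dotp p' a + int d * s) - 1 * dotp p' q"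
      unfolding s[symmetric] by (simp add: dotp_simps)
    also have "\<dots> = half * (dotp p q' - dotp q p') + (- half * dotp (\<lambda>k. p k + p' k) (\<lambda>k. q k + q' k)
        + dotp (\<lambda>k. p k + p' k) a) + int d * (s - t * dotp p' q)"
      by (subst t) (simp add: dotp_simps dotp_commute[of q p'] algebra_simps)
    finally have "chi d (- half * dotp p q + dotp p a + (- half * dotp p' q' + dotp p' (\<lambda>k. b k + q' k)))
      = chi d (half * (dotp p q' - dotp q p') + (- half * dotp (\<lambda>k. p k + p' k) (\<lambda>k. q k + q' k)
        + dotp (\<lambda>k. p k + p' k) a))"
      by (rule chi_eqI[OF d_pos])
    thus ?thesis using 1 True by (simp add: F_def weyl_entry chi_add[symmetric])
  next
    case False
    moreover hence "\<not> vcong a (\<lambda>k. b k + (q k + q' k))" by (simp add: algebra_simps)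
    ultimately show ?thesis by (simp add: F_def weyl_entry)
  qed
  finally show "(W p q * W p' q') $$ (E a, E b) = (chi d (half * (dotp p q' - dotp q p'))
      \<cdot>\<^sub>m W (\<lambda>k. p k + p' k) (\<lambda>k. q k + q' k)) $$ (E a, E b)"
    using weyl_carrier[of "\<lambda>k. p k + p' k" "\<lambda>k. q k + q' k"] by (simp del: weyl_carrier)
qed auto

lemma weyl_adj: "adj (W p q) = W (\<lambda>k. - p k) (\<lambda>k. - q k)"
proof (rule mat_eqI)
  fix a b
  have iff: "vcong b (\<lambda>k. a k + q k) \<longleftrightarrow> vcong a (\<lambda>k. b k + - q k)"
    unfolding vcong_def cong_iff_dvd_diff
    by (metis (no_types, opaque_lifting) add_uminus_conv_diff diff_diff_eq2 dvd_diff_commute)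
  have "cnj (chi d (- half * dotp p q + dotp p b)) = chi d (- half * dotp p q - dotp p a)"
    if "vcong b (\<lambda>k. a k + q k)"
  proof -
    have "[dotp p (\<lambda>k. a k + q k) = dotp p b] (mod int d)"
      using that by (intro dotp_cong) (auto intro: vcong_sym)
    then obtain s where s: "dotp p b = dotp p a + dotp p q + int d * s"
      by (auto simp: cong_iff_lin dotp_simps)
    obtain t where t: "1 = 2 * half + int d * t"
      using half_cong by (auto simp: cong_iff_lin)
    have "- (- half * dotp p q + dotp p b) = half * dotp p q - dotp p a - 1 * dotp p q - int d * s"
      by (simp add: s)
    also have "\<dots> = - half * dotp p q - dotp p a + int d * (- s - t * dotp p q)"
      by (subst t) (simp add: algebra_simps)
    finally show ?thesis unfolding cnj_chi by (rule chi_eqI[OF d_pos])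
  qed
  thus "adj (W p q) $$ (E a, E b) = W (\<lambda>k. - p k) (\<lambda>k. - q k) $$ (E a, E b)"
    by (simp add: adj_entry[of _ D D] weyl_entry iff dotp_simps)
qed auto

text \<open>A shift by nonzero \<open>q\<close> has no diagonal entries; for \<open>q = 0\<close>
  the diagonal sums a character that is trivial only for \<open>p = 0\<close>.\<close>

lemma mtrace_weyl:
  "mtrace (W p q) = (if vcong p (\<lambda>_. 0) \<and> vcong q (\<lambda>_. 0) then of_nat D else 0)"
proof -
  have 1: "vcong v (\<lambda>k. v k + q k) \<longleftrightarrow> vcong q (\<lambda>_. 0)" for v
    by (auto simp: vcong_def cong_iff_dvd_diff)
  have "mtrace (W p q) = (\<Sum>v\<in>Z. if vcong q (\<lambda>_. 0) then chi d (- half * dotp p q) * chi d (dotp v p) else 0)"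
    unfolding mtrace_enc[OF weyl_carrier] weyl_entry 1 chi_add by (simp add: dotp_commute cong: if_cong)
  also have "\<dots> = (if vcong q (\<lambda>_. 0) then chi d (- half * dotp p q) * (\<Sum>v\<in>Z. chi d (dotp v p)) else 0)"
    by (simp add: sum_distrib_left)
  also have "\<dots> = (if vcong p (\<lambda>_. 0) \<and> vcong q (\<lambda>_. 0) then of_nat D else 0)"
    using chi_dotp_cong[of p "\<lambda>_. 0" q q "- half"] by (auto simp: sum_chi dotp_simps)
  finally show ?thesis .
qed

end

section \<open>The convolution\<close>

lemma sum_lessThan_mult:
  fixes F :: "nat \<Rightarrow> complex"
  shows "(\<Sum>c<m * k. F c) = (\<Sum>a<m. \<Sum>b<k. F (a * k + b))"
proof -
  have "(\<Sum>c<m * k. F c) = (\<Sum>a<m. sum F {a * k..<a * k + k})"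
    by (rule sum.nat_group[symmetric])
  also have "\<dots> = (\<Sum>a<m. \<Sum>b<k. F (a * k + b))"
  proof (rule sum.cong)
    fix a
    show "sum F {a * k..<a * k + k} = (\<Sum>b<k. F (a * k + b))"
      using sum.shift_bounds_nat_ivl[of F 0 "a * k" k] by (simp add: atLeast0LessThan add.commute)
  qed simp
  finally show ?thesis .
qed

lemma mult_add_lt: "(a::nat) < m \<Longrightarrow> b < k \<Longrightarrow> a * k + b < m * k"
proof -
  assume "a < m" "b < k"
  hence "a * k + b < Suc a * k" by simp
  also have "\<dots> \<le> m * k" using \<open>a < m\<close> by (intro mult_right_mono) auto
  finally show ?thesis .
qed

lemma kron_entry:
  assumes "A \<in> carrier_mat m m" "B \<in> carrier_mat k k" "a < m" "b < k" "a' < m" "b' < k"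
  shows "kron A B $$ (a * k + b, a' * k + b') = A $$ (a, a') * B $$ (b, b')"
  using assms mult_add_lt[of a m b k] mult_add_lt[of a' m b' k] unfolding kron_def by simp

lemma kron_carrier: "A \<in> carrier_mat m m \<Longrightarrow> B \<in> carrier_mat k k \<Longrightarrow> kron A B \<in> carrier_mat (m*k) (m*k)"
  unfolding kron_def by auto

lemma sum_rotate:
  "(\<Sum>a\<in>A. \<Sum>b\<in>B. \<Sum>i\<in>I. f a b i) = (\<Sum>i\<in>I. \<Sum>a\<in>A. \<Sum>b\<in>B. f a b i)"
proof -
  have "(\<Sum>a\<in>A. \<Sum>b\<in>B. \<Sum>i\<in>I. f a b i) = (\<Sum>a\<in>A. \<Sum>i\<in>I. \<Sum>b\<in>B. f a b i)"
    by (intro sum.cong refl sum.swap)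
  also have "\<dots> = (\<Sum>i\<in>I. \<Sum>a\<in>A. \<Sum>b\<in>B. f a b i)" by (rule sum.swap)
  finally show ?thesis .
qed

text \<open>The trace in an orthonormal basis; the first hypothesis is the completeness relation of
  the vectors \<open>\<lambda>i. V i k\<close>.\<close>

lemma sum_qform_basis:
  assumes "\<And>i j. i < N \<Longrightarrow> j < N \<Longrightarrow> (\<Sum>k<N. V i k * cnj (V j k)) = (if i = j then 1 else 0)"
    and "A \<in> carrier_mat N N"
  shows "(\<Sum>k<N. qform N A (\<lambda>i. V i k)) = mtrace A"
proof -
  have "(\<Sum>k<N. qform N A (\<lambda>i. V i k)) = (\<Sum>i<N. \<Sum>j<N. \<Sum>k<N. cnj (V i k) * A $$ (i,j) * V j k)"
    unfolding qform_def by (rule sum_rotate[symmetric])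
  also have "\<dots> = (\<Sum>i<N. \<Sum>j<N. A $$ (i,j) * (\<Sum>k<N. V j k * cnj (V i k)))"
    by (simp add: sum_distrib_left algebra_simps)
  also have "\<dots> = (\<Sum>i<N. \<Sum>j<N. if j = i then A $$ (i,i) else 0)"
    by (intro sum.cong refl) (auto simp: assms(1))
  also have "\<dots> = mtrace A" using assms(2) by (simp add: mtrace_def)
  finally show ?thesis .
qed

context odd_qudits
begin

lemma qform_enc: "qform D A v = (\<Sum>a\<in>Z. \<Sum>b\<in>Z. cnj (v (E a)) * A $$ (E a, E b) * v (E b))"
  by (simp add: qform_def sum_enc)

text \<open>Converse of \<open>psd_gram\<close>. The index set is arbitrary because the Gram factor
  of a convolution carries a triple index while a rank-one matrix needs a single one.\<close>

lemma psd_of_gram: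
  assumes "A \<in> carrier_mat D D" and e: "\<And>x x'. A $$ (E x, E x') = (\<Sum>i\<in>I. T x i * cnj (T x' i))"
  shows "psd D A"
proof -
  have "adj A = A"
    by (rule mat_eqI) (use assms in \<open>auto simp: adj_entry[of _ D D] e mult.commute\<close>)
  moreover have "0 \<le> Re (qform D A v)" for v
  proof -
    have "qform D A v = (\<Sum>a\<in>Z. \<Sum>b\<in>Z. \<Sum>i\<in>I. (cnj (v (E a)) * T a i) * cnj (cnj (v (E b)) * T b i))"
      unfolding qform_enc e sum_distrib_left sum_distrib_right by (simp add: mult_ac)
    also have "\<dots> = (\<Sum>i\<in>I. \<Sum>a\<in>Z. \<Sum>b\<in>Z. (cnj (v (E a)) * T a i) * cnj (cnj (v (E b)) * T b i))"
      by (rule sum_rotate)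
    also have "\<dots> = (\<Sum>i\<in>I. of_real ((cmod (\<Sum>a\<in>Z. cnj (v (E a)) * T a i))\<^sup>2))"
      unfolding complex_norm_square cnj_sum sum_product ..
    finally show ?thesis by (simp only: Re_sum Re_complex_of_real) (intro sum_nonneg, simp)
  qed
  ultimately show ?thesis using assms by (simp add: psd_def)
qed

lemma psd_rank_one: "psd D (mat D D (\<lambda>(a,b). u a * cnj (u b)))"
  by (rule psd_of_gram[where I = "{()}" and T = "\<lambda>x _. u (E x)"]) auto

lemma density_mix:
  assumes "\<And>i. i < m \<Longrightarrow> 0 \<le> p i \<and> density d n (A i)" "(\<Sum>i<m. p i) = (1::real)"
  shows "density d n (mix D m p A)"
proof -
  have c: "mix D m p A \<in> carrier_mat D D" by (simp add: mix_def)
  have psd: "psd D (A i)" "mtrace (A i) = 1" if "i < m" for i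
    using assms(1)[OF that] by (auto simp: density_iff_psd)
  note cA = psd_carrier[OF psd(1)]
  have e: "mix D m p A $$ (a,b) = (\<Sum>i<m. of_real (p i) * A i $$ (a,b))" if "a < D" "b < D" for a b
    using that by (simp add: mix_def)
  have "adj (mix D m p A) = mix D m p A"
  proof (rule eq_matI)
    fix a b assume "a < dim_row (mix D m p A)" "b < dim_col (mix D m p A)"
    hence ab: "a < D" "b < D" by (auto simp: mix_def)
    have "cnj (A i $$ (b,a)) = A i $$ (a,b)" if "i < m" for i
      using adj_entry[OF cA[OF that] ab] psd_adj[OF psd(1)[OF that]] by simp
    thus "adj (mix D m p A) $$ (a,b) = mix D m p A $$ (a,b)"
      using ab by (simp add: adj_entry[OF c] e)
  qed (auto simp: mix_def adj_def)
  moreover have "0 \<le> Re (qform D (mix D m p A) v)" for v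
  proof -
    have "qform D (mix D m p A) v = (\<Sum>a<D. \<Sum>b<D. \<Sum>i<m. of_real (p i) * (cnj (v a) * A i $$ (a,b) * v b))"
      unfolding qform_def by (intro sum.cong refl) (auto simp: e sum_distrib_left sum_distrib_right mult_ac)
    also have "\<dots> = (\<Sum>i<m. of_real (p i) * qform D (A i) v)"
      unfolding qform_def sum_distrib_left by (rule sum_rotate)
    finally have "Re (qform D (mix D m p A) v) = (\<Sum>i<m. p i * Re (qform D (A i) v))" by simp
    also have "\<dots> \<ge> 0" using assms(1) psd_qform[OF psd(1)] by (intro sum_nonneg) auto
    finally show ?thesis .
  qed
  moreover have "mtrace (mix D m p A) = 1"
  proof -
    have "mtrace (mix D m p A) = (\<Sum>a<D. \<Sum>i<m. of_real (p i) * A i $$ (a,a))"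
      by (simp add: mtrace_def mix_def)
    also have "\<dots> = (\<Sum>i<m. \<Sum>a<D. of_real (p i) * A i $$ (a,a))" by (rule sum.swap)
    also have "\<dots> = (\<Sum>i<m. of_real (p i) * mtrace (A i))"
      by (intro sum.cong refl) (use carrier_matD[OF cA] in \<open>auto simp: mtrace_def sum_distrib_left\<close>)
    also have "\<dots> = of_real (\<Sum>i<m. p i)" using psd(2) by simp
    finally show ?thesis using assms(2) by simp
  qed
  ultimately show ?thesis using c by (simp add: density_iff_psd psd_def)
qed

end

locale qudit_convolution = odd_qudits +
  fixes g :: "nat \<Rightarrow> nat \<Rightarrow> int"
  assumes g_coprime: "\<And>a b. a < 2 \<Longrightarrow> b < 2 \<Longrightarrow> coprime (g a b) (int d)"
    and det_coprime: "coprime (detG g) (int d)"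
begin

definition "g00 = g 0 0"
definition "g01 = g 0 1"
definition "g10 = g 1 0"
definition "g11 = g 1 1"
definition "dt = g00 * g11 - g01 * g10"

lemma units [simp]: "coprime g00 (int d)" "coprime g01 (int d)" "coprime g10 (int d)"
  "coprime g11 (int d)" "coprime dt (int d)"
  using g_coprime[of 0 0] g_coprime[of 0 1] g_coprime[of 1 0] g_coprime[of 1 1] det_coprime
  by (auto simp: g00_def g01_def g10_def g11_def dt_def detG_def)

abbreviation "cv \<equiv> conv d n g"

section \<open>The key unitary and the entries of the convolution\<close>

definition Ninv :: int where "Ninv = inv_mod d (detG g)"

lemma Ninv_cong: "[dt * Ninv = 1] (mod int d)"
proof -
  obtain b where b: "[detG g * b = 1] (mod int d)" using det_coprime cong_solve_coprime_int by blast
  have "[detG g * (b mod int d) = 1] (mod int d)"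
    using b unfolding cong_def by (simp add: mod_mult_right_eq)
  hence "\<exists>b. 0 \<le> b \<and> b < int d \<and> [detG g * b = 1] (mod int d)"
    using d_pos by (intro exI[of _ "b mod int d"]) auto
  hence "[detG g * Ninv = 1] (mod int d)" unfolding Ninv_def inv_mod_def by (rule someI2_ex) auto
  thus ?thesis by (simp add: dt_def detG_def g00_def g01_def g10_def g11_def)
qed

text \<open>The pair \<open>(i, j)\<close> is the row vector \<open>(x, y)\<close> times
  \<open>G\<close>. Read backwards like this, the permutation performed by \<open>key_U\<close> has
  the entries of \<open>G\<close> as coefficients, and \<open>Ninv\<close> leaves the formulas for
  the matrix entries.\<close>

lemma key_coordinates:
  "[x = Ninv * g11 * i - Ninv * g10 * j] (mod int d) \<and> [y = - Ninv * g01 * i + Ninv * g00 * j] (mod int d)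
    \<longleftrightarrow> [i = g00 * x + g10 * y] (mod int d) \<and> [j = g01 * x + g11 * y] (mod int d)"
  (is "?L \<longleftrightarrow> ?R")
proof -
  obtain t where t: "1 = dt * Ninv + int d * t" using Ninv_cong by (auto simp: cong_iff_lin)
  show ?thesis
  proof
    assume ?L
    then obtain s r where x: "Ninv * g11 * i - Ninv * g10 * j = x + int d * s"
      and y: "- Ninv * g01 * i + Ninv * g00 * j = y + int d * r" by (auto simp: cong_iff_lin)
    have "1 * i = g00 * (Ninv * g11 * i - Ninv * g10 * j) + g10 * (- Ninv * g01 * i + Ninv * g00 * j) + int d * (t * i)"
      by (subst t) (simp add: dt_def algebra_simps)
    hence "i = g00 * x + g10 * y + int d * (g00 * s + g10 * r + t * i)"
      unfolding x y by (simp add: algebra_simps)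
    moreover have "1 * j = g01 * (Ninv * g11 * i - Ninv * g10 * j) + g11 * (- Ninv * g01 * i + Ninv * g00 * j) + int d * (t * j)"
      by (subst t) (simp add: dt_def algebra_simps)
    hence "j = g01 * x + g11 * y + int d * (g01 * s + g11 * r + t * j)"
      unfolding x y by (simp add: algebra_simps)
    ultimately show ?R by (metis cong_iff_lin cong_sym)
  next
    assume ?R
    then obtain s r where i: "g00 * x + g10 * y = i + int d * s"
      and j: "g01 * x + g11 * y = j + int d * r" by (auto simp: cong_iff_lin)
    have "1 * x = Ninv * g11 * (g00 * x + g10 * y) - Ninv * g10 * (g01 * x + g11 * y) + int d * (t * x)"
      by (subst t) (simp add: dt_def algebra_simps)
    hence "x = Ninv * g11 * i - Ninv * g10 * j + int d * (Ninv * g11 * s - Ninv * g10 * r + t * x)"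
      unfolding i j by (simp add: algebra_simps)
    moreover have "1 * y = - Ninv * g01 * (g00 * x + g10 * y) + Ninv * g00 * (g01 * x + g11 * y) + int d * (t * y)"
      by (subst t) (simp add: dt_def algebra_simps)
    hence "y = - Ninv * g01 * i + Ninv * g00 * j + int d * (- Ninv * g01 * s + Ninv * g00 * r + t * y)"
      unfolding i j by (simp add: algebra_simps)
    ultimately show ?L by (metis cong_iff_lin cong_sym)
  qed
qed

lemma key_U_carrier [simp]: "key_U d n g \<in> carrier_mat (D * D) (D * D)"
  by (simp add: key_U_def Let_def)

lemma enc_pair_eq_iff: "E x * D + E y = E x' * D + E y' \<longleftrightarrow> vcong x x' \<and> vcong y y'"
proof -
  have "E x * D + E y = E x' * D + E y' \<longleftrightarrow> E x = E x' \<and> E y = E y'"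
  proof
    assume *: "E x * D + E y = E x' * D + E y'"
    have "E u = (E u * D + E v) div D" "E v = (E u * D + E v) mod D" for u v by auto
    thus "E x = E x' \<and> E y = E y'" using * by metis
  qed simp
  thus ?thesis by (simp add: enc_eq_iff)
qed

lemma key_U_entry:
  "key_U d n g $$ (E x * D + E y, E i * D + E j)
    = (if vcong i (\<lambda>k. g00 * x k + g10 * y k) \<and> vcong j (\<lambda>k. g01 * x k + g11 * y k) then 1 else 0)"
proof -
  have lt: "E u * D + E v < D * D" for u v by (rule mult_add_lt) auto
  have e1: "E (\<lambda>k. Ninv * g 1 1 * int (digit d (E i) k) - Ninv * g 1 0 * int (digit d (E j) k))
     = E (\<lambda>k. Ninv * g11 * i k - Ninv * g10 * j k)"
    unfolding enc_eq_iff vcong_def g11_def g10_def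
    by (auto simp: digit_enc intro!: cong_diff cong_mult)
  have e2: "E (\<lambda>k. - Ninv * g 0 1 * int (digit d (E i) k) + Ninv * g 0 0 * int (digit d (E j) k))
     = E (\<lambda>k. - Ninv * g01 * i k + Ninv * g00 * j k)"
    unfolding enc_eq_iff vcong_def g01_def g00_def
    by (rule allI, rule impI, rule cong_add; rule cong_mult) (auto simp: digit_enc)
  have "key_U d n g $$ (E x * D + E y, E i * D + E j) =
    (if E x * D + E y = E (\<lambda>k. Ninv * g11 * i k - Ninv * g10 * j k) * D
        + E (\<lambda>k. - Ninv * g01 * i k + Ninv * g00 * j k) then 1 else 0)"
    unfolding key_U_def Let_def Ninv_def[symmetric] using lt e1 e2 by simp
  also have "E x * D + E y = E (\<lambda>k. Ninv * g11 * i k - Ninv * g10 * j k) * D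
        + E (\<lambda>k. - Ninv * g01 * i k + Ninv * g00 * j k) \<longleftrightarrow>
     vcong i (\<lambda>k. g00 * x k + g10 * y k) \<and> vcong j (\<lambda>k. g01 * x k + g11 * y k)"
    unfolding enc_pair_eq_iff unfolding vcong_def using key_coordinates by blast
  finally show ?thesis .
qed

lemma sum_pair_enc: "(\<Sum>c<D * D. F c) = (\<Sum>i\<in>Z. \<Sum>j\<in>Z. F (E i * D + E j) :: complex)"
  by (simp add: sum_lessThan_mult sum_enc)

lemma sum_pair_delta:
  assumes "\<And>i j. G (E i * D + E j) = (if vcong i i0 \<and> vcong j j0 then 1 else 0 :: complex)"
  shows "(\<Sum>c<D * D. G c * F c) = F (E i0 * D + E j0)"
proof -
  have "(\<Sum>c<D * D. G c * F c) = (\<Sum>i\<in>Z. if vcong i i0 then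
      (\<Sum>j\<in>Z. if vcong j j0 then F (E i * D + E j) else 0) else 0)"
    unfolding sum_pair_enc assms by (intro sum.cong refl) (auto intro: sum.cong)
  also have "\<dots> = (\<Sum>i\<in>Z. if vcong i i0 then F (E i * D + E j0) else 0)"
  proof -
    have "(\<Sum>j\<in>Z. if vcong j j0 then F (E i * D + E j) else 0) = F (E i * D + E j0)" for i
      by (rule sum_delta[of "\<lambda>j. F (E i * D + E j)"]) (simp add: enc_eq_iff[THEN iffD2])
    thus ?thesis by (simp cong: if_cong)
  qed
  also have "\<dots> = F (E i0 * D + E j0)"
    by (rule sum_delta[of "\<lambda>i. F (E i * D + E j0)"]) (simp add: enc_eq_iff[THEN iffD2])
  finally show ?thesis .
qed

lemma conv_carrier [simp]: "cv \<rho> \<sigma> \<in> carrier_mat D D"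
  by (simp add: conv_def ptrace2_def)

text \<open>\<open>key_U\<close> is a permutation matrix, so the conjugation only relabels entries
  of the Kronecker product, and the partial trace sums over the common second output coordinate
  \<open>y\<close>.\<close>

lemma conv_entry:
  assumes "\<rho> \<in> carrier_mat D D" "\<sigma> \<in> carrier_mat D D"
  shows "cv \<rho> \<sigma> $$ (E x, E x') = (\<Sum>y\<in>Z.
      \<rho> $$ (E (\<lambda>k. g00 * x k + g10 * y k), E (\<lambda>k. g00 * x' k + g10 * y k)) *
      \<sigma> $$ (E (\<lambda>k. g01 * x k + g11 * y k), E (\<lambda>k. g01 * x' k + g11 * y k)))"
proof -
  define U where "U = key_U d n g"
  define K where "K = kron \<rho> \<sigma>"
  have U: "U \<in> carrier_mat (D * D) (D * D)" by (simp add: U_def)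
  have K: "K \<in> carrier_mat (D * D) (D * D)" using assms by (simp add: K_def kron_carrier)
  have lt: "E u * D + E v < D * D" for u v by (rule mult_add_lt) auto
  have UK: "(U * K) $$ (E x * D + E y, c) = K $$ (E (\<lambda>k. g00 * x k + g10 * y k) * D + E (\<lambda>k. g01 * x k + g11 * y k), c)"
    if "c < D * D" for x y c
    unfolding mult_entry[OF U K lt that]
    by (rule sum_pair_delta) (simp add: U_def key_U_entry)
  have UKU: "(U * K * adj U) $$ (E x * D + E y, E x' * D + E y) =
     K $$ (E (\<lambda>k. g00 * x k + g10 * y k) * D + E (\<lambda>k. g01 * x k + g11 * y k),
       E (\<lambda>k. g00 * x' k + g10 * y k) * D + E (\<lambda>k. g01 * x' k + g11 * y k))" for y
  proof -
    have "(U * K * adj U) $$ (E x * D + E y, E x' * D + E y)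
      = (\<Sum>c<D * D. adj U $$ (c, E x' * D + E y) * (U * K) $$ (E x * D + E y, c))"
      using U K by (subst mult_entry[of _ "D * D" "D * D" _ "D * D"])
        (simp_all add: lt mult.commute[of "(U * K) $$ _"] del: index_mult_mat)
    also have "\<dots> = (U * K) $$ (E x * D + E y, E (\<lambda>k. g00 * x' k + g10 * y k) * D + E (\<lambda>k. g01 * x' k + g11 * y k))"
      by (rule sum_pair_delta, subst adj_entry[OF U lt lt]) (simp add: U_def key_U_entry)
    finally show ?thesis by (simp add: UK lt del: index_mult_mat)
  qed
  have "cv \<rho> \<sigma> $$ (E x, E x') = (\<Sum>y\<in>Z. (U * K * adj U) $$ (E x * D + E y, E x' * D + E y))"
    unfolding conv_def ptrace2_def U_def K_def by (simp add: sum_enc)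
  thus ?thesis unfolding UKU unfolding K_def using assms by (simp add: kron_entry)
qed

text \<open>
  Substituting \<open>g10 x\<close> for \<open>x\<close> and then \<open>y - g00 x\<close> for \<open>y\<close> reduces the change of variables to
  one-variable affine ones without dividing in \<open>\<int>/d\<close>.
\<close>

lemma sum_key_reindex:
  assumes F: "\<And>u u' v v'. vcong u u' \<Longrightarrow> vcong v v' \<Longrightarrow> F u v = (F u' v' :: complex)"
  shows "(\<Sum>x\<in>Z. \<Sum>y\<in>Z. F (\<lambda>k. g00 * x k + g10 * y k) (\<lambda>k. g01 * x k + g11 * y k))
    = (\<Sum>x\<in>Z. \<Sum>y\<in>Z. F x y)"
proof -
  have lin: "vcong (\<lambda>k. a * u k + b * v k) (\<lambda>k. a * u' k + b * v' k)"
    if "vcong u u'" "vcong v v'" for a b u u' v v'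
    using that by (auto simp: vcong_def intro!: cong_add cong_mult)
  define H where "H x y = F (\<lambda>k. g00 * x k + g10 * y k) (\<lambda>k. g01 * x k + g11 * y k)" for x y
  have H: "H u v = H u' v'" if "vcong u u'" "vcong v v'" for u u' v v'
    unfolding H_def using that by (intro F lin)
  have "(\<Sum>x\<in>Z. \<Sum>y\<in>Z. H x y) = (\<Sum>x\<in>Z. \<Sum>y\<in>Z. H (\<lambda>k. g10 * x k + 0) y)"
    by (rule sum_affine[symmetric, of g10 "\<lambda>x. \<Sum>y\<in>Z. H x y" "\<lambda>_. 0"]) (auto intro!: sum.cong H)
  also have "\<dots> = (\<Sum>x\<in>Z. \<Sum>y\<in>Z. H (\<lambda>k. g10 * x k + 0) (\<lambda>k. 1 * y k + (- g00) * x k))"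
    by (intro sum.cong refl sum_affine[symmetric]) (auto intro!: H)
  also have "\<dots> = (\<Sum>y\<in>Z. \<Sum>x\<in>Z. F (\<lambda>k. g10 * y k) (\<lambda>k. (- dt) * x k + g11 * y k))"
    unfolding H_def dt_def by (subst sum.swap) (simp add: algebra_simps)
  also have "\<dots> = (\<Sum>y\<in>Z. \<Sum>x\<in>Z. F (\<lambda>k. g10 * y k) x)"
    by (intro sum.cong refl sum_affine) (auto intro!: F)
  also have "\<dots> = (\<Sum>y\<in>Z. \<Sum>x\<in>Z. F y x)"
  proof -
    have "(\<Sum>x\<in>Z. F u x) = (\<Sum>x\<in>Z. F v x)" if "vcong u v" for u v
      using that by (intro sum.cong F) auto
    thus ?thesis using sum_affine[of g10 "\<lambda>y. \<Sum>x\<in>Z. F y x" "\<lambda>_. 0"] by simp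
  qed
  finally show ?thesis unfolding H_def .
qed

section \<open>Trace preservation, unitality, positivity and entropy growth\<close>

lemma mtrace_conv:
  assumes "\<rho> \<in> carrier_mat D D" "\<sigma> \<in> carrier_mat D D"
  shows "mtrace (cv \<rho> \<sigma>) = mtrace \<rho> * mtrace \<sigma>"
proof -
  have "mtrace (cv \<rho> \<sigma>) = (\<Sum>x\<in>Z. \<Sum>y\<in>Z. \<rho> $$ (E x, E x) * \<sigma> $$ (E y, E y))"
    unfolding mtrace_enc[OF conv_carrier] conv_entry[OF assms]
    by (rule sum_key_reindex[of "\<lambda>u v. \<rho> $$ (E u, E u) * \<sigma> $$ (E v, E v)"])
      (simp add: enc_eq_iff[THEN iffD2])
  thus ?thesis by (simp add: mtrace_enc[OF assms(1)] mtrace_enc[OF assms(2)] sum_product)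
qed

text \<open>Two entries of \<open>G\<close> are used: as \<open>g01\<close> is a unit, the Kronecker
  delta of the identity forces \<open>x\<close> and \<open>x'\<close> to agree modulo
  \<open>d\<close>; as \<open>g10\<close> is a unit, the remaining sum over \<open>y\<close> runs
  over the whole diagonal of \<open>\<rho>\<close>.\<close>

lemma conv_one:
  assumes "\<rho> \<in> carrier_mat D D"
  shows "cv \<rho> (1\<^sub>m D) = mtrace \<rho> \<cdot>\<^sub>m 1\<^sub>m D"
proof (rule mat_eqI)
  fix x x'
  have 1: "E (\<lambda>k. g01 * x k + g11 * y k) = E (\<lambda>k. g01 * x' k + g11 * y k) \<longleftrightarrow> vcong x x'" for y
    unfolding enc_eq_iff vcong_def by (simp add: cong_add_rcancel cong_mult_lcancel)
  have 2: "E (\<lambda>k. g00 * x' k + g10 * y k) = E (\<lambda>k. g00 * x k + g10 * y k)" if "vcong x x'" for y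
    using vcong_sym[OF that] by (auto simp: enc_eq_iff vcong_def intro!: cong_add cong_mult)
  have "cv \<rho> (1\<^sub>m D) $$ (E x, E x') = (if vcong x x' then
     (\<Sum>y\<in>Z. \<rho> $$ (E (\<lambda>k. g00 * x k + g10 * y k), E (\<lambda>k. g00 * x k + g10 * y k))) else 0)"
    by (simp add: conv_entry[OF assms] 1 2)
  also have "(\<Sum>y\<in>Z. \<rho> $$ (E (\<lambda>k. g00 * x k + g10 * y k), E (\<lambda>k. g00 * x k + g10 * y k))) = mtrace \<rho>"
    unfolding mtrace_enc[OF assms] add.commute[of "g00 * _"] by (rule sum_affine) (auto simp: enc_eq_iff[THEN iffD2])
  finally show "cv \<rho> (1\<^sub>m D) $$ (E x, E x') = (mtrace \<rho> \<cdot>\<^sub>m 1\<^sub>m D) $$ (E x, E x')"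
    by (simp add: enc_eq_iff)
qed auto

text \<open>For each value of the traced-out coordinate \<open>y\<close> the Gram factors of the two
  matrices multiply, so the triples \<open>(y, k, l)\<close> index a Gram factor of the
  output.\<close>

lemma psd_conv:
  assumes "psd D \<rho>" "psd D \<sigma>"
  shows "psd D (cv \<rho> \<sigma>)"
proof -
  note c = psd_carrier[OF assms(1)] psd_carrier[OF assms(2)]
  obtain R where R: "\<And>i j. i < D \<Longrightarrow> j < D \<Longrightarrow> \<rho> $$ (i,j) = (\<Sum>k<D. R i k * cnj (R j k))"
    using psd_gram[OF assms(1)] by blast
  obtain S where S: "\<And>i j. i < D \<Longrightarrow> j < D \<Longrightarrow> \<sigma> $$ (i,j) = (\<Sum>k<D. S i k * cnj (S j k))"
    using psd_gram[OF assms(2)] by blast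
  define T where "T x = (\<lambda>(y,k,l). R (E (\<lambda>m. g00 * x m + g10 * y m)) k * S (E (\<lambda>m. g01 * x m + g11 * y m)) l)" for x
  have "cv \<rho> \<sigma> $$ (E x, E x') = (\<Sum>i\<in>Z \<times> {..<D} \<times> {..<D}. T x i * cnj (T x' i))" for x x'
  proof -
    have "(\<Sum>i\<in>Z \<times> {..<D} \<times> {..<D}. T x i * cnj (T x' i))
        = (\<Sum>y\<in>Z. \<Sum>k<D. \<Sum>l<D. T x (y,k,l) * cnj (T x' (y,k,l)))"
      by (simp add: sum.cartesian_product split_def)
    thus ?thesis unfolding conv_entry[OF c] by (simp add: T_def R S sum_product mult_ac)
  qed
  thus ?thesis by (rule psd_of_gram[OF conv_carrier])
qed

lemma density_conv: "density d n \<rho> \<Longrightarrow> density d n \<sigma> \<Longrightarrow> density d n (cv \<rho> \<sigma>)"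
  by (simp add: density_iff_psd psd_conv mtrace_conv psd_carrier)

text \<open>Linearity in the second argument, stated on quadratic forms so that it applies both to
  the spectral decomposition of \<open>\<sigma>\<close> and to the resolution of the
  identity.\<close>

lemma qform_conv_linear:
  assumes "\<rho> \<in> carrier_mat D D" "\<sigma> \<in> carrier_mat D D" "\<And>j. j \<in> J \<Longrightarrow> A j \<in> carrier_mat D D"
    and "\<And>a b. a < D \<Longrightarrow> b < D \<Longrightarrow> \<sigma> $$ (a,b) = (\<Sum>j\<in>J. m j * A j $$ (a,b))"
  shows "qform D (cv \<rho> \<sigma>) v = (\<Sum>j\<in>J. m j * qform D (cv \<rho> (A j)) v)"
proof -
  have e: "cv \<rho> \<sigma> $$ (E x, E x') = (\<Sum>j\<in>J. m j * cv \<rho> (A j) $$ (E x, E x'))" for x x'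
  proof -
    have "cv \<rho> \<sigma> $$ (E x, E x') = (\<Sum>y\<in>Z. \<Sum>j\<in>J. m j * (
      \<rho> $$ (E (\<lambda>k. g00 * x k + g10 * y k), E (\<lambda>k. g00 * x' k + g10 * y k)) *
      A j $$ (E (\<lambda>k. g01 * x k + g11 * y k), E (\<lambda>k. g01 * x' k + g11 * y k))))"
      unfolding conv_entry[OF assms(1,2)]
      by (simp add: assms(4) sum_distrib_left mult.left_commute)
    also have "\<dots> = (\<Sum>j\<in>J. m j * cv \<rho> (A j) $$ (E x, E x'))"
      by (subst sum.swap) (simp add: conv_entry[OF assms(1,3)] sum_distrib_left)
    finally show ?thesis .
  qed
  have "qform D (cv \<rho> \<sigma>) v = (\<Sum>a\<in>Z. \<Sum>b\<in>Z. \<Sum>j\<in>J. m j * (cnj (v (E a)) * cv \<rho> (A j) $$ (E a, E b) * v (E b)))"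
    unfolding qform_enc e sum_distrib_left sum_distrib_right by (simp add: mult_ac)
  also have "\<dots> = (\<Sum>j\<in>J. m j * qform D (cv \<rho> (A j)) v)"
    unfolding qform_enc sum_distrib_left by (rule sum_rotate)
  finally show ?thesis .
qed

lemma vn_entropy_conv_ge:
  assumes "density d n \<rho>" "density d n \<sigma>"
  shows "vn_entropy \<sigma> \<le> vn_entropy (cv \<rho> \<sigma>)"
proof -
  have psd: "psd D \<rho>" "psd D \<sigma>" and tr: "mtrace \<rho> = 1" "mtrace \<sigma> = 1"
    using assms by (auto simp: density_iff_psd)
  note c = psd_carrier[OF psd(1)] psd_carrier[OF psd(2)]
  note psd' = psd_conv[OF psd]
  obtain V m where s: "eigensystem D \<sigma> V m" using hermitian_eigensystem c psd_adj psd by blast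
  obtain X l where t: "eigensystem D (cv \<rho> \<sigma>) X l"
    using hermitian_eigensystem conv_carrier psd_adj psd' by blast
  define A where "A j = mat D D (\<lambda>(a,b). V a j * cnj (V b j))" for j
  have A: "A j \<in> carrier_mat D D" for j by (simp add: A_def)
  have psdA: "psd D (A j)" for j unfolding A_def by (rule psd_rank_one)
  \<comment> \<open>\<open>q i j\<close> is the weight of the i-th output eigenvector in the image
    of the j-th eigenprojection of \<open>\<sigma>\<close>; these weights carry the spectrum of
    \<open>\<sigma>\<close> to that of the output.\<close>
  define q where "q i j = qform D (cv \<rho> (A j)) (\<lambda>a. X a i)" for i j
  define b where "b i j = Re (q i j)" for i j
  have b0: "0 \<le> b i j" for i j
    unfolding b_def q_def by (rule psd_qform[OF psd_conv[OF psd(1) psdA]])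
  have l: "of_real (l i) = (\<Sum>j<D. of_real (m j) * q i j)" if "i < D" for i
    unfolding eigensystemD(7)[OF t that] q_def
    by (rule qform_conv_linear) (use c A eigensystemD(3)[OF s] in \<open>auto simp: A_def mult.assoc\<close>)
  have lb: "l i = (\<Sum>j<D. b i j * m j)" if "i < D" for i
    using arg_cong[OF l[OF that], of Re] by (simp add: b_def mult.commute)
  \<comment> \<open>Row sums: the eigenprojections add up to the identity, whose image is the
    identity by unitality.\<close>
  have "(\<Sum>j<D. q i j) = 1" if "i < D" for i
  proof -
    have "qform D (cv \<rho> (1\<^sub>m D)) (\<lambda>a. X a i) = (\<Sum>j<D. 1 * q i j)"
      unfolding q_def by (rule qform_conv_linear)
        (use c A eigensystemD(2)[OF s] in \<open>auto simp: A_def\<close>)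
    also have "qform D (cv \<rho> (1\<^sub>m D)) (\<lambda>a. X a i) = (\<Sum>a<D. \<Sum>a'<D. if a = a' then cnj (X a i) * X a i else 0)"
      unfolding conv_one[OF c(1)] tr qform_def by (intro sum.cong) auto
    also have "\<dots> = 1" using eigensystemD(1)[OF t that that] by simp
    finally show ?thesis by simp
  qed
  hence b1: "(\<Sum>j<D. b i j) = 1" if "i < D" for i
    using that unfolding b_def Re_sum[symmetric] by simp
  \<comment> \<open>Column sums: trace preservation, with the trace taken in the output
    eigenbasis.\<close>
  have "(\<Sum>i<D. q i j) = 1" if "j < D" for j
  proof -
    have "(\<Sum>i<D. q i j) = mtrace (cv \<rho> (A j))"
      unfolding q_def by (rule sum_qform_basis) (use eigensystemD(2)[OF t] in auto)
    also have "\<dots> = mtrace (A j)" by (simp add: mtrace_conv[OF c(1) A] tr)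
    also have "\<dots> = 1"
      using eigensystemD(1)[OF s that that] by (simp add: mtrace_def A_def mult.commute)
    finally show ?thesis .
  qed
  hence b2: "(\<Sum>i<D. b i j) = 1" if "j < D" for j
    using that unfolding b_def Re_sum[symmetric] by simp
  have "(\<Sum>i<D. ent_term (l i)) \<le> (\<Sum>i<D. \<Sum>j<D. b i j * ent_term (m j))"
  proof (rule sum_mono)
    fix i assume "i \<in> {..<D}"
    thus "ent_term (l i) \<le> (\<Sum>j<D. b i j * ent_term (m j))"
      using lb b1 b0 psd_eigenvalue_nonneg[OF psd(2) s] by (auto intro!: ent_term_jensen)
  qed
  also have "\<dots> = (\<Sum>j<D. (\<Sum>i<D. b i j) * ent_term (m j))"
    by (subst sum.swap) (simp add: sum_distrib_right)
  also have "\<dots> = (\<Sum>j<D. ent_term (m j))" by (rule sum.cong) (auto simp: b2)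
  finally show ?thesis using eigensystemD(5)[OF s] eigensystemD(5)[OF t] by simp
qed

end

section \<open>Stabiliser states\<close>

text \<open>The size is an explicit argument because matrices of all sizes share one type, where an
  empty sum would have no canonical value.\<close>

definition msum :: "nat \<Rightarrow> 'i set \<Rightarrow> ('i \<Rightarrow> complex mat) \<Rightarrow> complex mat" where
  "msum N I F = mat N N (\<lambda>ij. \<Sum>i\<in>I. F i $$ ij)"

lemma msum_carrier [simp]: "msum N I F \<in> carrier_mat N N"
  by (simp add: msum_def)

lemma msum_entry: "a < N \<Longrightarrow> b < N \<Longrightarrow> msum N I F $$ (a,b) = (\<Sum>i\<in>I. F i $$ (a,b))"
  by (simp add: msum_def)

lemma msum_cong: "(\<And>i. i \<in> I \<Longrightarrow> F i = G i) \<Longrightarrow> msum N I F = msum N I G"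
  by (simp add: msum_def)

lemma mult_msum:
  assumes "A \<in> carrier_mat N N" "\<And>i. i \<in> I \<Longrightarrow> F i \<in> carrier_mat N N"
  shows "A * msum N I F = msum N I (\<lambda>i. A * F i)"
proof (rule eq_matI)
  fix a b assume "a < dim_row (msum N I (\<lambda>i. A * F i))" "b < dim_col (msum N I (\<lambda>i. A * F i))"
  hence ab: "a < N" "b < N" by (auto simp: msum_def)
  have "(A * msum N I F) $$ (a,b) = (\<Sum>k<N. \<Sum>i\<in>I. A $$ (a,k) * F i $$ (k,b))"
    unfolding mult_entry[OF assms(1) msum_carrier ab]
    by (rule sum.cong) (auto simp: msum_entry ab sum_distrib_left)
  also have "\<dots> = (\<Sum>i\<in>I. \<Sum>k<N. A $$ (a,k) * F i $$ (k,b))" by (rule sum.swap)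
  also have "\<dots> = msum N I (\<lambda>i. A * F i) $$ (a,b)"
    unfolding msum_entry[OF ab] by (rule sum.cong) (simp_all only: mult_entry[OF assms ab])
  finally show "(A * msum N I F) $$ (a,b) = msum N I (\<lambda>i. A * F i) $$ (a,b)" .
qed (use assms in \<open>auto simp: msum_def\<close>)

lemma msum_mult:
  assumes "A \<in> carrier_mat N N" "\<And>i. i \<in> I \<Longrightarrow> F i \<in> carrier_mat N N"
  shows "msum N I F * A = msum N I (\<lambda>i. F i * A)"
proof (rule eq_matI)
  fix a b assume "a < dim_row (msum N I (\<lambda>i. F i * A))" "b < dim_col (msum N I (\<lambda>i. F i * A))"
  hence ab: "a < N" "b < N" by (auto simp: msum_def)
  have "(msum N I F * A) $$ (a,b) = (\<Sum>k<N. \<Sum>i\<in>I. F i $$ (a,k) * A $$ (k,b))"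
    unfolding mult_entry[OF msum_carrier assms(1) ab]
    by (rule sum.cong) (auto simp: msum_entry ab sum_distrib_right)
  also have "\<dots> = (\<Sum>i\<in>I. \<Sum>k<N. F i $$ (a,k) * A $$ (k,b))" by (rule sum.swap)
  also have "\<dots> = msum N I (\<lambda>i. F i * A) $$ (a,b)"
    unfolding msum_entry[OF ab] by (rule sum.cong) (simp_all only: mult_entry[OF assms(2,1) ab])
  finally show "(msum N I F * A) $$ (a,b) = msum N I (\<lambda>i. F i * A) $$ (a,b)" .
qed (use assms in \<open>auto simp: msum_def\<close>)

lemma mtrace_msum:
  assumes "\<And>i. i \<in> I \<Longrightarrow> F i \<in> carrier_mat N N"
  shows "mtrace (msum N I F) = (\<Sum>i\<in>I. mtrace (F i))"
proof -
  have "mtrace (msum N I F) = (\<Sum>a<N. \<Sum>i\<in>I. F i $$ (a,a))"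
    by (simp add: mtrace_def msum_def)
  also have "\<dots> = (\<Sum>i\<in>I. \<Sum>a<N. F i $$ (a,a))" by (rule sum.swap)
  also have "\<dots> = (\<Sum>i\<in>I. mtrace (F i))"
    unfolding mtrace_def by (rule sum.cong) (use assms in auto)
  finally show ?thesis .
qed

lemma adj_msum:
  assumes "\<And>i. i \<in> I \<Longrightarrow> F i \<in> carrier_mat N N"
  shows "adj (msum N I F) = msum N I (\<lambda>i. adj (F i))"
proof (rule eq_matI)
  fix a b assume "a < dim_row (msum N I (\<lambda>i. adj (F i)))" "b < dim_col (msum N I (\<lambda>i. adj (F i)))"
  hence ab: "a < N" "b < N" by (auto simp: msum_def)
  thus "adj (msum N I F) $$ (a,b) = msum N I (\<lambda>i. adj (F i)) $$ (a,b)"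
    by (simp add: adj_entry[OF msum_carrier] msum_entry adj_entry[OF assms])
qed (auto simp: msum_def adj_def)

lemma smult_msum:
  assumes "\<And>i. i \<in> I \<Longrightarrow> F i \<in> carrier_mat N N"
  shows "c \<cdot>\<^sub>m msum N I F = msum N I (\<lambda>i. c \<cdot>\<^sub>m F i)"
proof (rule eq_matI)
  fix a b assume "a < dim_row (msum N I (\<lambda>i. c \<cdot>\<^sub>m F i))" "b < dim_col (msum N I (\<lambda>i. c \<cdot>\<^sub>m F i))"
  hence ab: "a < N" "b < N" by (auto simp: msum_def)
  have "(c \<cdot>\<^sub>m msum N I F) $$ (a,b) = c * msum N I F $$ (a,b)" using ab by (simp add: msum_def)
  also have "\<dots> = (\<Sum>i\<in>I. (c \<cdot>\<^sub>m F i) $$ (a,b))"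
    unfolding msum_entry[OF ab] sum_distrib_left
  proof (rule sum.cong)
    fix i assume "i \<in> I"
    thus "c * F i $$ (a,b) = (c \<cdot>\<^sub>m F i) $$ (a,b)" using assms[of i] ab by auto
  qed simp
  finally show "(c \<cdot>\<^sub>m msum N I F) $$ (a,b) = msum N I (\<lambda>i. c \<cdot>\<^sub>m F i) $$ (a,b)"
    unfolding msum_entry[OF ab] .
qed (auto simp: msum_def)

lemma msum_swap: "msum N I (\<lambda>i. msum N J (F i)) = msum N J (\<lambda>j. msum N I (\<lambda>i. F i j))"
  by (rule eq_matI) (auto simp: msum_def intro: sum.swap)

lemma msum_reindex: "bij_betw h I J \<Longrightarrow> msum N I (\<lambda>i. F (h i)) = msum N J F"
  unfolding msum_def by (intro cong_mat refl) (rule sum.reindex_bij_betw)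

lemma msum_const: "A \<in> carrier_mat N N \<Longrightarrow> msum N I (\<lambda>_. A) = of_nat (card I) \<cdot>\<^sub>m A"
  by (rule eq_matI) (auto simp: msum_def)

lemma mtrace_smult: "A \<in> carrier_mat N N \<Longrightarrow> mtrace (c \<cdot>\<^sub>m A) = c * mtrace A"
  by (auto simp: mtrace_def sum_distrib_left)

lemma adj_smult: "adj (c \<cdot>\<^sub>m A) = cnj c \<cdot>\<^sub>m adj A"
  by (rule eq_matI) (auto simp: adj_def)

lemma mult_smult_right:
  "(A :: complex mat) \<in> carrier_mat N N \<Longrightarrow> B \<in> carrier_mat N N \<Longrightarrow> A * (c \<cdot>\<^sub>m B) = c \<cdot>\<^sub>m (A * B)"
  by (rule mult_smult_distrib)

lemma mult_smult_left:
  "(A :: complex mat) \<in> carrier_mat N N \<Longrightarrow> B \<in> carrier_mat N N \<Longrightarrow> (c \<cdot>\<^sub>m A) * B = c \<cdot>\<^sub>m (A * B)"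
  by (rule mult_smult_assoc_mat)

lemmas mult_smult = mult_smult_right mult_smult_left

lemma smult_smult: "a \<cdot>\<^sub>m (b \<cdot>\<^sub>m A) = (a * b :: complex) \<cdot>\<^sub>m A"
  by (rule eq_matI) auto

lemma one_smult: "(1::complex) \<cdot>\<^sub>m A = A"
  by (rule eq_matI) auto

section \<open>Isotropic sets, their characters and stabiliser sums\<close>

type_synonym phase_point = "(nat \<Rightarrow> int) \<times> (nat \<Rightarrow> int)"

context odd_qudits
begin

definition padd :: "phase_point \<Rightarrow> phase_point \<Rightarrow> phase_point" where
  "padd x y = (red (\<lambda>k. fst x k + fst y k), red (\<lambda>k. snd x k + snd y k))"

definition pneg :: "phase_point \<Rightarrow> phase_point" where
  "pneg x = (red (\<lambda>k. - fst x k), red (\<lambda>k. - snd x k))"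

definition pzero :: phase_point where "pzero = (\<lambda>_. 0, \<lambda>_. 0)"

definition sympl :: "phase_point \<Rightarrow> phase_point \<Rightarrow> int" where
  "sympl x y = dotp (fst x) (snd y) - dotp (snd x) (fst y)"

definition Wab :: "int \<Rightarrow> int \<Rightarrow> phase_point \<Rightarrow> complex mat" where
  "Wab a b x = W (\<lambda>k. a * fst x k) (\<lambda>k. b * snd x k)"

definition isotropic :: "phase_point set \<Rightarrow> bool" where
  "isotropic S \<longleftrightarrow> S \<subseteq> Z \<times> Z \<and> pzero \<in> S \<and> (\<forall>x\<in>S. \<forall>y\<in>S. padd x y \<in> S \<and> int d dvd sympl x y)"

definition character :: "phase_point set \<Rightarrow> (phase_point \<Rightarrow> complex) \<Rightarrow> bool" where
  "character S c \<longleftrightarrow> (\<forall>x\<in>S. cmod (c x) = 1) \<and> (\<forall>x\<in>S. \<forall>y\<in>S. c (padd x y) = c x * c y)"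

text \<open>
  The scalings \<open>a\<close>, \<open>b\<close> are needed because the convolution rescales the two coordinates of phase space
  independently, which is not a symplectic map; it still preserves isotropy.
\<close>

definition stab :: "phase_point set \<Rightarrow> (phase_point \<Rightarrow> complex) \<Rightarrow> int \<Rightarrow> int \<Rightarrow> complex mat" where
  "stab S c a b = msum D S (\<lambda>x. (c x / of_nat D) \<cdot>\<^sub>m Wab a b x)"

lemma Wab_carrier [simp]: "Wab a b x \<in> carrier_mat D D"
  by (simp add: Wab_def)

lemma stab_carrier [simp]: "stab S c a b \<in> carrier_mat D D"
  by (simp add: stab_def)

lemma pzero_in_ZZ [simp]: "pzero \<in> Z \<times> Z"
  by (simp add: pzero_def)

lemma padd_in_ZZ [simp]: "padd x y \<in> Z \<times> Z"
  by (simp add: padd_def)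

lemma ZZ_eqI:
  "x \<in> Z \<times> Z \<Longrightarrow> y \<in> Z \<times> Z \<Longrightarrow> vcong (fst x) (fst y) \<Longrightarrow> vcong (snd x) (snd y) \<Longrightarrow> x = y"
  by (metis Z_eqI mem_Times_iff prod_eq_iff)

lemma padd_commute: "padd x y = padd y x"
  by (simp add: padd_def add.commute)

lemma padd_pneg: "padd x (pneg x) = pzero"
proof (rule ZZ_eqI)
  show "vcong (fst (padd x (pneg x))) (fst pzero)" "vcong (snd (padd x (pneg x))) (snd pzero)"
    by (auto simp: padd_def pneg_def pzero_def vcong_def red_def cong_def mod_simps)
qed auto

lemma padd_inj:
  assumes "y \<in> Z \<times> Z" "z \<in> Z \<times> Z" "padd x y = padd x z"
  shows "y = z"
proof (rule ZZ_eqI[OF assms(1,2)])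
  have "vcong (\<lambda>k. fst x k + fst y k) (\<lambda>k. fst x k + fst z k)"
    "vcong (\<lambda>k. snd x k + snd y k) (\<lambda>k. snd x k + snd z k)"
    using assms(3) by (auto simp: padd_def red_eq_iff)
  thus "vcong (fst y) (fst z)" "vcong (snd y) (snd z)"
    by (auto simp: vcong_def cong_add_lcancel)
qed

lemma isotropic_subset: "isotropic S \<Longrightarrow> S \<subseteq> Z \<times> Z"
  by (simp add: isotropic_def)

lemma isotropic_zero: "isotropic S \<Longrightarrow> pzero \<in> S"
  by (simp add: isotropic_def)

lemma isotropic_finite: "isotropic S \<Longrightarrow> finite S"
  using isotropic_subset finite_subset[of S "Z \<times> Z"] by auto

lemma isotropic_card: "isotropic S \<Longrightarrow> 0 < card S"
  using isotropic_finite isotropic_zero card_gt_0_iff by blast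

lemma padd_bij:
  assumes "isotropic S" "x \<in> S"
  shows "bij_betw (padd x) S S"
proof -
  have "inj_on (padd x) S"
    using isotropic_subset[OF assms(1)] by (auto intro!: inj_onI dest: padd_inj[rotated 2])
  moreover have "padd x ` S \<subseteq> S" using assms by (auto simp: isotropic_def)
  ultimately show ?thesis
    by (simp add: bij_betw_def endo_inj_surj isotropic_finite[OF assms(1)])
qed

text \<open>Translation by \<open>x\<close> is an injective self-map of the finite set
  \<open>S\<close>, hence surjective, so it reaches \<open>pzero\<close>; closure under addition
  thus yields inverses.\<close>

lemma pneg_in:
  assumes "isotropic S" "x \<in> S"
  shows "pneg x \<in> S"
proof -
  have "pzero \<in> padd x ` S"
    using bij_betw_imp_surj_on[OF padd_bij[OF assms]] isotropic_zero[OF assms(1)] by simp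
  then obtain y where y: "y \<in> S" "pzero = padd x y" by (rule imageE)
  have "y = pneg x"
  proof (rule padd_inj)
    show "y \<in> Z \<times> Z" using y isotropic_subset[OF assms(1)] by blast
    show "pneg x \<in> Z \<times> Z" by (simp add: pneg_def)
    show "padd x y = padd x (pneg x)" using y padd_pneg by simp
  qed
  thus ?thesis using y by simp
qed

lemma pneg_pneg: "x \<in> Z \<times> Z \<Longrightarrow> pneg (pneg x) = x"
  by (rule ZZ_eqI, simp add: pneg_def) (auto simp: pneg_def vcong_def red_def cong_def mod_simps)

lemma pneg_bij:
  assumes "isotropic S"
  shows "bij_betw pneg S S"
proof (rule bij_betw_byWitness[where f' = pneg])
  show "\<forall>a\<in>S. pneg (pneg a) = a" using pneg_pneg isotropic_subset[OF assms] by blast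
  thus "\<forall>a\<in>S. pneg (pneg a) = a" .
  show "pneg ` S \<subseteq> S" "pneg ` S \<subseteq> S" using pneg_in[OF assms] by auto
qed

lemma character_norm: "character S c \<Longrightarrow> x \<in> S \<Longrightarrow> cmod (c x) = 1"
  by (simp add: character_def)

lemma character_zero:
  assumes "isotropic S" "character S c"
  shows "c pzero = 1"
proof -
  have z: "pzero \<in> S" by (rule isotropic_zero[OF assms(1)])
  have "padd pzero pzero = pzero" by (simp add: padd_def pzero_def)
  hence "c pzero = c pzero * c pzero" using assms(2) z unfolding character_def by metis
  moreover have "c pzero \<noteq> 0" using character_norm[OF assms(2) z] by auto
  ultimately show ?thesis by simp
qed

lemma character_neg:
  assumes "isotropic S" "character S c" "x \<in> S"
  shows "c (pneg x) = cnj (c x)"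
proof -
  have "c x * c (pneg x) = 1"
    using assms pneg_in[OF assms(1,3)] padd_pneg[of x] character_zero[OF assms(1,2)]
    unfolding character_def by metis
  moreover have "c x * cnj (c x) = 1"
    using character_norm[OF assms(2,3)] by (simp add: complex_norm_square[symmetric])
  moreover hence "c x \<noteq> 0" by auto
  ultimately show ?thesis by (metis mult_left_cancel)
qed

lemma Wab_zero: "Wab a b pzero = 1\<^sub>m D"
  by (simp add: Wab_def pzero_def weyl_zero)

lemma Wab_mult_phase:
  "Wab a b x * Wab a b y = chi d (half * (a * b * sympl x y)) \<cdot>\<^sub>m Wab a b (padd x y)"
proof -
  have "W (\<lambda>k. a * fst x k + a * fst y k) (\<lambda>k. b * snd x k + b * snd y k) = Wab a b (padd x y)"
    unfolding Wab_def padd_def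
    by (rule weyl_cong) (auto simp: vcong_def red_def cong_def mod_simps distrib_left[symmetric])
  thus ?thesis
    unfolding Wab_def[of a b x] Wab_def[of a b y] weyl_mult
    by (simp add: sympl_def dotp_simps algebra_simps)
qed

lemma chi_dvd: "int d dvd k \<Longrightarrow> chi d (m * k) = 1"
  using chi_cong[OF d_pos, of "m * k" 0] by (simp add: cong_0_iff)

text \<open>Scaling multiplies the symplectic form by \<open>a * b\<close>, so on an isotropic set
  the product phase is trivial for every scaling.\<close>

lemma Wab_mult:
  assumes "isotropic S" "x \<in> S" "y \<in> S"
  shows "Wab a b x * Wab a b y = Wab a b (padd x y)"
proof -
  have "int d dvd sympl x y" using assms by (simp add: isotropic_def)
  hence "chi d (half * (a * b * sympl x y)) = 1"
    using chi_dvd[of "sympl x y" "half * (a * b)"] by (simp add: mult.assoc)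
  thus ?thesis by (simp add: Wab_mult_phase one_smult)
qed

lemma Wab_adj: "adj (Wab a b x) = Wab a b (pneg x)"
  unfolding Wab_def weyl_adj pneg_def
  by (rule weyl_cong) (auto simp: vcong_def red_def cong_def mod_simps)

lemma weyl_unitary: "W p q * adj (W p q) = 1\<^sub>m D"
  by (simp add: weyl_adj weyl_mult dotp_simps dotp_commute[of q p] weyl_zero one_smult)

lemma stab_adj:
  assumes "isotropic S" "character S c"
  shows "adj (stab S c a b) = stab S c a b"
proof -
  have "adj (stab S c a b) = msum D S (\<lambda>x. (c (pneg x) / of_nat D) \<cdot>\<^sub>m Wab a b (pneg x))"
    unfolding stab_def by (subst adj_msum, simp, rule msum_cong)
      (simp add: adj_smult Wab_adj character_neg[OF assms])
  also have "\<dots> = stab S c a b"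
    unfolding stab_def by (rule msum_reindex[OF pneg_bij[OF assms(1)]])
  finally show ?thesis .
qed

text \<open>Translating the summation index by \<open>x\<close> trades \<open>c y\<close> for
  \<open>c (padd x y)\<close>, which differs by a phase only. So the range of \<open>stab\<close>
  lies in a joint eigenspace of the scaled Weyl operators in \<open>S\<close>.\<close>

lemma Wab_stab:
  assumes "isotropic S" "character S c" "x \<in> S"
  shows "Wab a b x * stab S c a b = cnj (c x) \<cdot>\<^sub>m stab S c a b"
proof -
  have "Wab a b x * stab S c a b = msum D S (\<lambda>y. (c y / of_nat D) \<cdot>\<^sub>m Wab a b (padd x y))"
    unfolding stab_def
    by (subst mult_msum, simp, simp, rule msum_cong) (simp add: mult_smult[of _ D] Wab_mult[OF assms(1,3)])
  also have "\<dots> = msum D S (\<lambda>y. (cnj (c x) * c (padd x y) / of_nat D) \<cdot>\<^sub>m Wab a b (padd x y))"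
  proof (rule msum_cong)
    fix y assume "y \<in> S"
    hence "cnj (c x) * c (padd x y) = (c x * cnj (c x)) * c y"
      using assms unfolding character_def by (simp add: algebra_simps)
    also have "c x * cnj (c x) = 1"
      using character_norm[OF assms(2,3)] by (simp add: complex_norm_square[symmetric])
    finally show "(c y / of_nat D) \<cdot>\<^sub>m Wab a b (padd x y) = (cnj (c x) * c (padd x y) / of_nat D) \<cdot>\<^sub>m Wab a b (padd x y)"
      by simp
  qed
  also have "\<dots> = msum D S (\<lambda>y. (cnj (c x) * c y / of_nat D) \<cdot>\<^sub>m Wab a b y)"
    by (rule msum_reindex[OF padd_bij[OF assms(1,3)]])
  also have "\<dots> = cnj (c x) \<cdot>\<^sub>m stab S c a b"
    unfolding stab_def by (subst smult_msum) (simp_all add: smult_smult)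
  finally show ?thesis .
qed

text \<open>Each of the \<open>card S\<close> summands reproduces the matrix with weight
  \<open>1 / D\<close>, because \<open>c x\<close> cancels against the eigenvalue
  \<open>cnj (c x)\<close>.\<close>

lemma stab_square:
  assumes "isotropic S" "character S c"
  shows "stab S c a b * stab S c a b = of_real (real (card S) / real D) \<cdot>\<^sub>m stab S c a b"
proof -
  have "stab S c a b * stab S c a b = msum D S (\<lambda>x. (c x / of_nat D) \<cdot>\<^sub>m Wab a b x * stab S c a b)"
    by (subst stab_def) (rule msum_mult, auto)
  also have "\<dots> = msum D S (\<lambda>x. (1 / of_nat D) \<cdot>\<^sub>m stab S c a b)"
  proof (rule msum_cong)
    fix x assume x: "x \<in> S"
    have "c x * cnj (c x) = 1"
      using character_norm[OF assms(2) x] by (simp add: complex_norm_square[symmetric])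
    thus "(c x / of_nat D) \<cdot>\<^sub>m Wab a b x * stab S c a b = (1 / of_nat D) \<cdot>\<^sub>m stab S c a b"
      by (simp add: mult_smult[of _ D] Wab_stab[OF assms x] smult_smult)
  qed
  also have "\<dots> = of_real (real (card S) / real D) \<cdot>\<^sub>m stab S c a b"
    by (subst msum_const) (simp_all add: smult_smult)
  finally show ?thesis .
qed

lemma mtrace_Wab_mult:
  assumes "coprime a (int d)" "coprime b (int d)" "x \<in> Z \<times> Z" "y \<in> Z \<times> Z"
  shows "mtrace (Wab a b x * Wab (- a) (- b) y) = (if x = y then of_nat D else 0)"
proof -
  have 1: "vcong (\<lambda>k. m * u k + - m * v k) (\<lambda>_. 0) \<longleftrightarrow> vcong u v" if "coprime m (int d)" for m u v
  proof -
    have "int d dvd m * u k + - m * v k \<longleftrightarrow> int d dvd u k - v k" for k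
      using coprime_dvd_mult_right_iff[of "int d" m "u k - v k"] that
      by (simp add: right_diff_distrib coprime_commute)
    thus ?thesis by (simp add: vcong_def cong_0_iff cong_iff_dvd_diff)
  qed
  have 2: "vcong (fst x) (fst y) \<and> vcong (snd x) (snd y) \<longleftrightarrow> x = y"
    using ZZ_eqI[OF assms(3,4)] by auto
  show ?thesis
    unfolding Wab_def weyl_mult mtrace_smult[OF weyl_carrier] mtrace_weyl 1[OF assms(1)] 1[OF assms(2)] 2
    by (auto simp: dotp_simps dotp_commute[of "snd y" "fst y"] algebra_simps)
qed

text \<open>Orthogonality of Weyl operators: tracing against an inverse reads off one coefficient.
  That \<open>a\<close> and \<open>b\<close> are units guarantees that different labels give
  different operators.\<close>

lemma mtrace_stab_mult:
  assumes "coprime a (int d)" "coprime b (int d)" "S \<subseteq> Z \<times> Z" "y \<in> Z \<times> Z"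
  shows "mtrace (stab S c a b * Wab (- a) (- b) y) = (if y \<in> S then c y else 0)"
proof -
  have fin: "finite S" using assms(3) finite_subset[of S "Z \<times> Z"] by auto
  have "mtrace (stab S c a b * Wab (- a) (- b) y)
    = (\<Sum>x\<in>S. mtrace ((c x / of_nat D) \<cdot>\<^sub>m Wab a b x * Wab (- a) (- b) y))"
    unfolding stab_def by (subst msum_mult, simp, simp, rule mtrace_msum) simp
  also have "\<dots> = (\<Sum>x\<in>S. if x = y then c y else 0)"
  proof (rule sum.cong)
    fix x assume "x \<in> S"
    hence x: "x \<in> Z \<times> Z" using assms by auto
    show "mtrace ((c x / of_nat D) \<cdot>\<^sub>m Wab a b x * Wab (- a) (- b) y) = (if x = y then c y else 0)"
      by (simp add: mult_smult[of _ D] mtrace_smult[of _ D] mtrace_Wab_mult[OF assms(1,2) x assms(4)])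
  qed simp
  also have "\<dots> = (if y \<in> S then c y else 0)" using fin by simp
  finally show ?thesis .
qed

lemma mtrace_stab:
  assumes "coprime a (int d)" "coprime b (int d)" "isotropic S" "character S c"
  shows "mtrace (stab S c a b) = 1"
  using mtrace_stab_mult[OF assms(1,2) isotropic_subset[OF assms(3)] pzero_in_ZZ, of c]
    isotropic_zero[OF assms(3)] character_zero[OF assms(3,4)]
  by (simp add: Wab_zero right_mult_one_mat[OF stab_carrier])

text \<open>Positivity comes from \<open>A * adj A = r * A\<close> with \<open>r > 0\<close>:
  dividing by \<open>r\<close> exhibits \<open>A\<close> as a Gram matrix.\<close>

lemma density_stab:
  assumes "coprime a (int d)" "coprime b (int d)" "isotropic S" "character S c"
  shows "density d n (stab S c a b)"
proof -
  let ?A = "stab S c a b"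
  define r where "r = real (card S) / real D"
  have r: "0 < r" using isotropic_card[OF assms(3)] by (simp add: r_def)
  have "psd D ?A"
  proof (rule psd_of_gram[OF stab_carrier])
    fix x x'
    have "of_real r * ?A $$ (E x, E x') = (?A * adj ?A) $$ (E x, E x')"
      unfolding stab_adj[OF assms(3,4)] stab_square[OF assms(3,4)] r_def
      using carrier_matD[OF stab_carrier] by simp
    also have "\<dots> = (\<Sum>k<D. ?A $$ (E x, k) * cnj (?A $$ (E x', k)))"
      by (subst mult_entry[OF stab_carrier adj_carrier[OF stab_carrier]])
        (auto simp: adj_entry[OF stab_carrier])
    finally have "?A $$ (E x, E x') = (\<Sum>k<D. ?A $$ (E x, k) * cnj (?A $$ (E x', k))) / of_real r"
      using r by (simp add: field_simps)
    also have "\<dots> = (\<Sum>k<D. (?A $$ (E x, k) / of_real (sqrt r)) * cnj (?A $$ (E x', k) / of_real (sqrt r)))"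
    proof -
      have "(of_real r :: complex) = of_real (sqrt r) * of_real (sqrt r)"
        using r by (simp flip: of_real_mult)
      thus ?thesis by (simp add: sum_divide_distrib)
    qed
    finally show "?A $$ (E x, E x') = (\<Sum>k<D. (?A $$ (E x, k) / of_real (sqrt r)) * cnj (?A $$ (E x', k) / of_real (sqrt r)))" .
  qed
  thus ?thesis by (simp add: density_iff_psd mtrace_stab[OF assms])
qed

text \<open>The value ignores \<open>a\<close>, \<open>b\<close> and \<open>c\<close>; this makes
  the outputs of all twisted inputs comparable with the mean state.\<close>

lemma vn_entropy_stab:
  assumes "coprime a (int d)" "coprime b (int d)" "isotropic S" "character S c"
  shows "vn_entropy (stab S c a b) = - ln (real (card S) / real D)"
  by (rule vn_entropy_scaled_projection[OF stab_carrier])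
    (use assms isotropic_card[OF assms(3)] in \<open>auto simp: stab_adj stab_square mtrace_stab\<close>)

end

section \<open>Mean states\<close>

lemma msum_smult_const:
  assumes "A \<in> carrier_mat N N"
  shows "msum N I (\<lambda>i. f i \<cdot>\<^sub>m A) = (\<Sum>i\<in>I. f i) \<cdot>\<^sub>m A"
  by (rule eq_matI) (use carrier_matD[OF assms] in \<open>auto simp: msum_def sum_distrib_right\<close>)

context odd_qudits
begin

text \<open>For fixed \<open>q\<close> the traces against \<open>W p q\<close> are, up to a phase,
  the Fourier transform in \<open>p\<close> of the entries on one shifted diagonal of
  \<open>A\<close>.\<close>

lemma mtrace_mult_weyl:
  assumes A: "A \<in> carrier_mat D D"
  shows "mtrace (A * W p q) = chi d (half * dotp p q) * (\<Sum>z\<in>Z. chi d (dotp p z) * A $$ (E z, E (\<lambda>k. z k + q k)))"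
proof -
  have *: "(\<Sum>v\<in>Z. A $$ (E z, E v) * W p q $$ (E v, E z))
     = chi d (half * dotp p q) * (chi d (dotp p z) * A $$ (E z, E (\<lambda>k. z k + q k)))" for z
  proof -
    define F where "F v = A $$ (E z, E v) * chi d (- half * dotp p q + dotp p v)" for v
    have "(\<Sum>v\<in>Z. A $$ (E z, E v) * W p q $$ (E v, E z)) = (\<Sum>v\<in>Z. if vcong v (\<lambda>k. z k + q k) then F v else 0)"
      by (auto simp: weyl_entry F_def intro!: sum.cong)
    also have "\<dots> = F (\<lambda>k. z k + q k)"
    proof (rule sum_delta)
      fix u v assume "vcong u v"
      hence "chi d (- half * dotp p q + dotp p u) = chi d (- half * dotp p q + dotp p v)" "E u = E v"
        by (auto simp: enc_eq_iff intro!: chi_cong cong_diff cong_mult dotp_cong)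
      thus "F u = F v" by (simp add: F_def)
    qed
    also have "\<dots> = chi d (- half * dotp p q + dotp p (\<lambda>k. z k + q k)) * A $$ (E z, E (\<lambda>k. z k + q k))"
      by (simp add: F_def)
    also have "chi d (- half * dotp p q + dotp p (\<lambda>k. z k + q k)) = chi d (half * dotp p q + dotp p z)"
    proof -
      obtain t where t: "1 = 2 * half + int d * t" using half_cong by (auto simp: cong_iff_lin)
      have "- half * dotp p q + dotp p (\<lambda>k. z k + q k) = - half * dotp p q + dotp p z + 1 * dotp p q"
        by (simp add: dotp_simps)
      also have "\<dots> = half * dotp p q + dotp p z + int d * (t * dotp p q)"
        by (subst t) (simp add: algebra_simps)
      finally show ?thesis by (rule chi_eqI[OF d_pos])
    qed
    finally show ?thesis by (simp add: chi_add)
  qed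
  show ?thesis
    unfolding mtrace_enc[OF square_mult_carrier[OF A weyl_carrier]] mult_entry_enc[OF A weyl_carrier] *
    by (simp add: sum_distrib_left)
qed

text \<open>Fourier inversion on every shifted diagonal. It gives the uniqueness that the definite
  description in \<open>mean_state\<close> depends on.\<close>

lemma weyl_traces_determine:
  assumes A: "A \<in> carrier_mat D D" and B: "B \<in> carrier_mat D D"
    and eq: "\<And>p q. p \<in> Z \<Longrightarrow> q \<in> Z \<Longrightarrow> char_fn d n A p q = char_fn d n B p q"
  shows "A = B"
proof (rule mat_eqI[OF A B])
  fix x x' :: "nat \<Rightarrow> int"
  have tr: "mtrace (A * W p q) = mtrace (B * W p q)" for p q
  proof -
    have "W p q = W (\<lambda>k. - red (\<lambda>k. - p k) k) (\<lambda>k. - red (\<lambda>k. - q k) k)"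
      by (rule weyl_cong) (auto simp: vcong_def red_def cong_def mod_simps)
    thus ?thesis using eq[of "red (\<lambda>k. - p k)" "red (\<lambda>k. - q k)"] by (simp add: char_fn_def)
  qed
  \<comment> \<open>Selects the shifted diagonal through the entry at
    \<open>(x, x')\<close>.\<close>
  define q where "q = (\<lambda>k. x' k - x k)"
  define f where "f C z = (C $$ (E z, E (\<lambda>k. z k + q k)) :: complex)" for C z
  have inv: "(\<Sum>p\<in>Z. chi d (- dotp p x) * (\<Sum>z\<in>Z. chi d (dotp p z) * f C z)) = of_nat D * f C x" for C
  proof -
    have "(\<Sum>p\<in>Z. chi d (- dotp p x) * (\<Sum>z\<in>Z. chi d (dotp p z) * f C z))
        = (\<Sum>p\<in>Z. \<Sum>z\<in>Z. chi d (dotp p (\<lambda>k. z k - x k)) * f C z)"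
      unfolding sum_distrib_left by (simp add: dotp_simps chi_add[symmetric] flip: mult.assoc)
    also have "\<dots> = (\<Sum>z\<in>Z. (\<Sum>p\<in>Z. chi d (dotp p (\<lambda>k. z k - x k))) * f C z)"
      unfolding sum_distrib_right by (rule sum.swap)
    also have "\<dots> = (\<Sum>z\<in>Z. if vcong z x then of_nat D * f C z else 0)"
      unfolding sum_chi by (intro sum.cong refl) (auto simp: vcong_def cong_iff_dvd_diff)
    also have "\<dots> = of_nat D * f C x"
    proof (rule sum_delta)
      fix u v assume uv: "vcong u v"
      hence "E u = E v" "E (\<lambda>k. u k + q k) = E (\<lambda>k. v k + q k)"
        by (auto simp: enc_eq_iff vcong_def cong_add_rcancel)
      thus "of_nat D * f C u = of_nat D * f C v" by (simp add: f_def)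
    qed
    finally show ?thesis .
  qed
  have "(\<Sum>z\<in>Z. chi d (dotp p z) * f A z) = (\<Sum>z\<in>Z. chi d (dotp p z) * f B z)" for p
    using tr[of p q] unfolding mtrace_mult_weyl[OF A] mtrace_mult_weyl[OF B] f_def by simp
  hence "of_nat D * f A x = of_nat D * f B x"
    unfolding inv[symmetric] by simp
  hence "f A x = f B x" by simp
  thus "A $$ (E x, E x') = B $$ (E x, E x')" by (simp add: f_def q_def)
qed

lemma mean_state_eqI:
  assumes "\<tau> \<in> carrier_mat D D"
    and "\<And>p q. p \<in> Z \<Longrightarrow> q \<in> Z \<Longrightarrow> char_fn d n \<tau> p q
      = (if cmod (char_fn d n \<sigma> p q) = 1 then char_fn d n \<sigma> p q else 0)"
  shows "mean_state d n \<sigma> = \<tau>"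
  unfolding mean_state_def
proof (rule the_equality)
  fix \<tau>' assume *: "\<tau>' \<in> carrier_mat D D \<and>
     (\<forall>p \<in> Z. \<forall>q \<in> Z.
        char_fn d n \<tau>' p q = (if cmod (char_fn d n \<sigma> p q) = 1 then char_fn d n \<sigma> p q else 0))"
  show "\<tau>' = \<tau>"
    by (rule weyl_traces_determine) (use * assms in auto)
qed (use assms in auto)

text \<open>
  With \<open>c = Tr[\<sigma> w]\<close> of modulus one, \<open>Tr[\<sigma> (w - c)(w - c)\<^sup>\<dagger>] = 0\<close>, so positivity of \<open>\<sigma>\<close> kills every
  column of \<open>w - c\<close>.
\<close>

lemma weyl_eigenoperator:
  assumes "density d n \<sigma>" and one: "cmod (mtrace (\<sigma> * W p q)) = 1"
  shows "\<sigma> * W p q = mtrace (\<sigma> * W p q) \<cdot>\<^sub>m \<sigma>"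
proof -
  have psd: "psd D \<sigma>" and tr: "mtrace \<sigma> = 1" using assms by (auto simp: density_iff_psd)
  note s = psd_carrier[OF psd]
  define U where "U = W p q"
  have U: "U \<in> carrier_mat D D" by (simp add: U_def)
  define c where "c = mtrace (\<sigma> * U)"
  have cc: "cnj c * c = 1"
    using one by (simp add: c_def U_def mult.commute complex_norm_square[symmetric])
  define B where "B k j = U $$ (j,k) - (if j = k then c else 0)" for k j
  have UU: "(\<Sum>k<D. U $$ (j,k) * cnj (U $$ (i,k))) = (if j = i then 1 else 0)" if "i < D" "j < D" for i j
  proof -
    have "(\<Sum>k<D. U $$ (j,k) * cnj (U $$ (i,k))) = (U * adj U) $$ (j,i)"
      using that by (subst mult_entry[OF U adj_carrier[OF U]]) (auto simp: adj_entry[OF U])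
    thus ?thesis using that by (simp add: U_def weyl_unitary)
  qed
  \<comment> \<open>The 2 has two sources, \<open>U * adj U = 1\<close> and
    \<open>cnj c * c = 1\<close>; after tracing against \<open>\<sigma>\<close> the two cross terms
    contribute -2.\<close>
  have BB: "(\<Sum>k<D. B k j * cnj (B k i)) = (if j = i then 2 else 0) - cnj c * U $$ (j,i) - c * cnj (U $$ (i,j))"
    if "i < D" "j < D" for i j
  proof -
    have "B k j * cnj (B k i) = U $$ (j,k) * cnj (U $$ (i,k)) - (if k = i then cnj c * U $$ (j,i) else 0)
       - (if k = j then c * cnj (U $$ (i,j)) else 0) + (if k = i then (if j = i then 1 else 0) else 0)" for k
      using cc by (auto simp: B_def algebra_simps)
    hence "(\<Sum>k<D. B k j * cnj (B k i)) = (if j = i then 1 else 0) - cnj c * U $$ (j,i)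
       - c * cnj (U $$ (i,j)) + (if j = i then 1 else 0)"
      using that by (simp add: sum.distrib sum_subtractf UU)
    thus ?thesis by simp
  qed
  have herm: "\<sigma> $$ (i,j) = cnj (\<sigma> $$ (j,i))" if "i < D" "j < D" for i j
    using adj_entry[OF s that] psd_adj[OF psd] by simp
  have sU: "mtrace (\<sigma> * U) = (\<Sum>i<D. \<Sum>j<D. \<sigma> $$ (i,j) * U $$ (j,i))"
  proof -
    have "mtrace (\<sigma> * U) = (\<Sum>i<D. (\<sigma> * U) $$ (i,i))" using s by (simp add: mtrace_def)
    thus ?thesis using mult_entry[OF s U] by simp
  qed
  have "(\<Sum>k<D. qform D \<sigma> (B k)) = (\<Sum>i<D. \<Sum>j<D. \<Sum>k<D. cnj (B k i) * \<sigma> $$ (i,j) * B k j)"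
    unfolding qform_def by (rule sum_rotate[symmetric])
  also have "\<dots> = (\<Sum>i<D. \<Sum>j<D. \<sigma> $$ (i,j) * (\<Sum>k<D. B k j * cnj (B k i)))"
    by (simp add: sum_distrib_left mult_ac)
  also have "\<dots> = (\<Sum>i<D. \<Sum>j<D. (if j = i then 2 * \<sigma> $$ (i,i) else 0)
      - cnj c * (\<sigma> $$ (i,j) * U $$ (j,i)) - c * (\<sigma> $$ (i,j) * cnj (U $$ (i,j))))"
    by (intro sum.cong refl) (auto simp: BB algebra_simps)
  also have "\<dots> = 2 * mtrace \<sigma> - cnj c * mtrace (\<sigma> * U) - c * (\<Sum>i<D. \<Sum>j<D. \<sigma> $$ (i,j) * cnj (U $$ (i,j)))"
    using s unfolding sU by (simp add: sum_subtractf sum_distrib_left mtrace_def)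
  also have "(\<Sum>i<D. \<Sum>j<D. \<sigma> $$ (i,j) * cnj (U $$ (i,j))) = cnj (mtrace (\<sigma> * U))"
  proof -
    have "(\<Sum>i<D. \<Sum>j<D. \<sigma> $$ (i,j) * cnj (U $$ (i,j))) = (\<Sum>i<D. \<Sum>j<D. cnj (\<sigma> $$ (j,i)) * cnj (U $$ (i,j)))"
      by (intro sum.cong refl arg_cong2[where f = "(*)"] herm) auto
    also have "\<dots> = cnj (mtrace (\<sigma> * U))" unfolding sU by (subst sum.swap) simp
    finally show ?thesis .
  qed
  also have "2 * mtrace \<sigma> - cnj c * mtrace (\<sigma> * U) - c * cnj (mtrace (\<sigma> * U)) = 0"
    using cc tr by (simp add: c_def[symmetric] mult.commute)
  finally have "(\<Sum>k<D. Re (qform D \<sigma> (B k))) = 0" by (simp flip: Re_sum)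
  hence q0: "Re (qform D \<sigma> (B k)) = 0" if "k < D" for k
    using that psd_qform[OF psd] by (subst (asm) sum_nonneg_eq_0_iff) auto
  have "\<sigma> * U = c \<cdot>\<^sub>m \<sigma>"
  proof (rule eq_matI)
    fix i k assume "i < dim_row (c \<cdot>\<^sub>m \<sigma>)" "k < dim_col (c \<cdot>\<^sub>m \<sigma>)"
    hence ik: "i < D" "k < D" using s by auto
    have "0 = (\<Sum>j<D. \<sigma> $$ (i,j) * B k j)" using psd_kernel[OF psd q0[OF ik(2)] ik(1)] by simp
    also have "\<dots> = (\<Sum>j<D. \<sigma> $$ (i,j) * U $$ (j,k) - (if j = k then c * \<sigma> $$ (i,k) else 0))"
      by (rule sum.cong) (auto simp: B_def algebra_simps)
    also have "\<dots> = (\<sigma> * U) $$ (i,k) - c * \<sigma> $$ (i,k)"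
      using ik by (simp add: sum_subtractf mult_entry[OF s U ik] del: index_mult_mat)
    finally show "(\<sigma> * U) $$ (i,k) = (c \<cdot>\<^sub>m \<sigma>) $$ (i,k)" using s ik by simp
  qed (use s U in auto)
  thus ?thesis unfolding c_def U_def .
qed

text \<open>A phase equal to its own inverse has square 1, and squaring turns \<open>half\<close>
  into 1 modulo \<open>d\<close>. It is applied where two orders of a product are compared, since
  exchanging the factors negates \<open>sympl\<close>.\<close>

lemma dvd_of_chi_symmetric:
  assumes "chi d (half * (m * k)) = chi d (half * (m * (- k)))" "coprime m (int d)"
  shows "int d dvd k"
proof -
  have "chi d (2 * half * (m * k)) = chi d (half * (m * k)) * chi d (half * (m * k))"
    by (simp add: chi_add[symmetric] algebra_simps)
  also have "\<dots> = chi d (half * (m * k)) * chi d (half * (m * (- k)))" using assms(1) by simp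
  also have "\<dots> = 1" by (simp add: chi_add[symmetric])
  finally have "int d dvd 2 * half * (m * k)" using chi_eq_1_imp_dvd[OF d_pos] by blast
  moreover have "[2 * half * (m * k) = 1 * (m * k)] (mod int d)"
    by (intro cong_mult half_cong) auto
  ultimately have "int d dvd m * k" by (simp add: cong_dvd_iff)
  thus ?thesis using assms(2) by (simp add: coprime_dvd_mult_right_iff coprime_commute)
qed

lemma sympl_commute: "sympl y x = - sympl x y"
  by (simp add: sympl_def dotp_commute)

text \<open>For units \<open>a\<close>, \<open>b\<close> this relabels bijectively the points that
  survive in the mean state, so its cardinality depends on neither.\<close>

definition unimod :: "complex mat \<Rightarrow> int \<Rightarrow> int \<Rightarrow> phase_point set" where
  "unimod \<sigma> a b = {x \<in> Z \<times> Z. cmod (mtrace (\<sigma> * Wab a b x)) = 1}"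

text \<open>Right multiplication by the first Weyl operator acts on \<open>\<sigma>\<close> as a
  scalar, so the trace against the product of both factorises; the left side is the same trace with
  the two operators merged.\<close>

lemma unimod_product:
  assumes "density d n \<sigma>" "x \<in> unimod \<sigma> a b" "y \<in> unimod \<sigma> a b"
  shows "chi d (half * (a * b * sympl x y)) * mtrace (\<sigma> * Wab a b (padd x y))
    = mtrace (\<sigma> * Wab a b x) * mtrace (\<sigma> * Wab a b y)"
proof -
  have s: "\<sigma> \<in> carrier_mat D D" using assms(1) by (simp add: density_def)
  have "\<sigma> * (Wab a b x * Wab a b y) = \<sigma> * Wab a b x * Wab a b y"
    using s by (simp add: assoc_mult_mat[of _ D D _ D _ D])
  also have "\<sigma> * Wab a b x = mtrace (\<sigma> * Wab a b x) \<cdot>\<^sub>m \<sigma>"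
    unfolding Wab_def by (rule weyl_eigenoperator) (use assms in \<open>auto simp: unimod_def Wab_def\<close>)
  finally have "mtrace (\<sigma> * (Wab a b x * Wab a b y)) = mtrace (\<sigma> * Wab a b x) * mtrace (\<sigma> * Wab a b y)"
    using s by (simp add: mult_smult[of _ D] mtrace_smult[of _ D])
  thus ?thesis unfolding Wab_mult_phase using s by (simp add: mult_smult[of _ D] mtrace_smult[of _ D])
qed

lemma unimod_isotropic:
  assumes "density d n \<sigma>" "coprime a (int d)" "coprime b (int d)"
  shows "isotropic (unimod \<sigma> a b)" "character (unimod \<sigma> a b) (\<lambda>x. mtrace (\<sigma> * Wab a b x))"
proof -
  let ?S = "unimod \<sigma> a b"
  define c where "c x = mtrace (\<sigma> * Wab a b x)" for x
  have s: "\<sigma> \<in> carrier_mat D D" and tr: "mtrace \<sigma> = 1" using assms(1) by (auto simp: density_def)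
  have n1: "cmod (c x) = 1" if "x \<in> ?S" for x using that by (simp add: unimod_def c_def)
  have prod: "chi d (half * (a * b * sympl x y)) * c (padd x y) = c x * c y" if "x \<in> ?S" "y \<in> ?S" for x y
    using unimod_product[OF assms(1) that] by (simp add: c_def)
  have np: "cmod (c (padd x y)) = 1" if "x \<in> ?S" "y \<in> ?S" for x y
    using arg_cong[OF prod[OF that], of cmod] n1 that by (simp add: norm_mult)
  have add: "padd x y \<in> ?S" if "x \<in> ?S" "y \<in> ?S" for x y
    using np[OF that] by (simp add: unimod_def c_def del: mem_Sigma_iff)
  have sy: "int d dvd sympl x y" if "x \<in> ?S" "y \<in> ?S" for x y
  proof -
    \<comment> \<open>The product rule in both orders has the same right side and opposite phases on
      the left, while the common factor has modulus one.\<close>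
    have "chi d (half * (a * b * sympl x y)) * c (padd x y) = chi d (half * (a * b * (- sympl x y))) * c (padd x y)"
      using prod[OF that] prod[OF that(2,1)] by (simp add: padd_commute[of y x] sympl_commute[of y x] mult.commute)
    moreover have "c (padd x y) \<noteq> 0" using np[OF that] by auto
    ultimately have "chi d (half * (a * b * sympl x y)) = chi d (half * (a * b * (- sympl x y)))" by simp
    thus ?thesis by (rule dvd_of_chi_symmetric) (use assms in simp)
  qed
  have "pzero \<in> ?S"
    using s tr by (simp add: unimod_def Wab_zero right_mult_one_mat[OF s] del: mem_Sigma_iff)
  thus "isotropic ?S"
    using add sy by (auto simp: isotropic_def unimod_def)
  have "c (padd x y) = c x * c y" if "x \<in> ?S" "y \<in> ?S" for x y
    using prod[OF that] chi_dvd[OF sy[OF that], of "half * (a * b)"] by (simp add: mult.assoc)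
  thus "character ?S (\<lambda>x. mtrace (\<sigma> * Wab a b x))"
    using n1 by (simp add: character_def c_def)
qed

lemma ex_scaled:
  assumes "coprime a (int d)" "p \<in> Z"
  shows "\<exists>v\<in>Z. vcong p (\<lambda>k. a * v k)"
proof -
  obtain v where "v \<in> Z" "p = red (\<lambda>k. a * v k + 0)"
    using bij_affine[OF assms(1), of "\<lambda>_. 0"] assms(2) unfolding bij_betw_def by force
  thus ?thesis by (intro bexI[of _ v]) auto
qed

text \<open>Since \<open>char_fn\<close> negates its labels, the traces against
  \<open>Wab (- a) (- b)\<close> are the values of the characteristic function at the points scaled
  by \<open>a\<close>, \<open>b\<close>. They serve both as selection rule and as
  coefficients.\<close>

lemma mean_state_eq_stab:
  assumes "density d n \<sigma>" "coprime a (int d)" "coprime b (int d)"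
  shows "mean_state d n \<sigma> = stab (unimod \<sigma> (- a) (- b)) (\<lambda>x. mtrace (\<sigma> * Wab (- a) (- b) x)) a b"
proof (rule mean_state_eqI)
  fix p q assume "p \<in> Z" "q \<in> Z"
  then obtain p' q' where p': "p' \<in> Z" "vcong p (\<lambda>k. a * p' k)" and q': "q' \<in> Z" "vcong q (\<lambda>k. b * q' k)"
    using ex_scaled assms by meson
  define y where "y = (p', q')"
  have y: "y \<in> Z \<times> Z" using p' q' by (simp add: y_def)
  have "W (\<lambda>k. - p k) (\<lambda>k. - q k) = Wab (- a) (- b) y"
    unfolding Wab_def y_def using p' q'
    by (intro weyl_cong) (auto simp: vcong_def cong_minus_minus_iff)
  hence cf: "char_fn d n \<tau> p q = mtrace (\<tau> * Wab (- a) (- b) y)" for \<tau>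
    by (simp add: char_fn_def)
  have "unimod \<sigma> (- a) (- b) \<subseteq> Z \<times> Z" by (auto simp: unimod_def)
  thus "char_fn d n (stab (unimod \<sigma> (- a) (- b)) (\<lambda>x. mtrace (\<sigma> * Wab (- a) (- b) x)) a b) p q
    = (if cmod (char_fn d n \<sigma> p q) = 1 then char_fn d n \<sigma> p q else 0)"
    unfolding cf using y by (subst mtrace_stab_mult[OF assms(2,3)]) (auto simp: unimod_def)
qed simp

text \<open>For \<open>a = b = 1\<close>, multiplying the coefficients of \<open>stab\<close> by
  this phase amounts to conjugation with the Weyl operator at \<open>u\<close>: a twist is a
  displaced stabiliser state.\<close>

definition sympl_char :: "phase_point \<Rightarrow> phase_point \<Rightarrow> complex" where
  "sympl_char u x = chi d (sympl u x)"

lemma sympl_char_character: "character S (sympl_char u)"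
proof -
  have "chi d (sympl u (padd x y)) = chi d (sympl u x + sympl u y)" for x y
  proof (rule chi_cong[OF d_pos])
    have "[dotp (fst u) (red (\<lambda>k. snd x k + snd y k)) - dotp (snd u) (red (\<lambda>k. fst x k + fst y k))
      = dotp (fst u) (\<lambda>k. snd x k + snd y k) - dotp (snd u) (\<lambda>k. fst x k + fst y k)] (mod int d)"
      by (intro cong_diff dotp_cong) auto
    thus "[sympl u (padd x y) = sympl u x + sympl u y] (mod int d)"
      by (simp add: sympl_def padd_def dotp_simps algebra_simps)
  qed
  thus ?thesis by (simp add: character_def sympl_char_def chi_add)
qed

lemma character_mult: "character S c \<Longrightarrow> character S c' \<Longrightarrow> character S (\<lambda>x. c x * c' x)"
  by (simp add: character_def norm_mult)

lemma sum_sympl_char: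
  assumes "x \<in> Z \<times> Z"
  shows "(\<Sum>u\<in>Z \<times> Z. sympl_char u x) = (if x = pzero then of_nat (D * D) else 0)"
proof -
  have "(\<Sum>u\<in>Z \<times> Z. sympl_char u x) = (\<Sum>u1\<in>Z. \<Sum>u2\<in>Z. chi d (dotp u1 (snd x)) * chi d (dotp u2 (\<lambda>k. - fst x k)))"
    by (simp add: sum.cartesian_product split_def sympl_char_def sympl_def dotp_simps chi_add[symmetric])
  also have "\<dots> = (\<Sum>u\<in>Z. chi d (dotp u (snd x))) * (\<Sum>u\<in>Z. chi d (dotp u (\<lambda>k. - fst x k)))"
    by (simp add: sum_product)
  also have "\<dots> = (if vcong (snd x) (\<lambda>_. 0) \<and> vcong (fst x) (\<lambda>_. 0) then of_nat (D * D) else 0)"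
    unfolding sum_chi by (auto simp: vcong_def cong_0_iff)
  also have "vcong (snd x) (\<lambda>_. 0) \<and> vcong (fst x) (\<lambda>_. 0) \<longleftrightarrow> x = pzero"
    using ZZ_eqI[OF assms pzero_in_ZZ] by (auto simp: pzero_def)
  finally show ?thesis .
qed

text \<open>Summing over \<open>u\<close> kills every label except \<open>pzero\<close>, which keeps
  \<open>D * D\<close> copies of weight \<open>1 / D\<close>. It serves twice: for the maximally
  mixed output, and as completeness of the twisted projections inside a Weyl algebra.\<close>

lemma sum_stab_twists:
  assumes "isotropic S" "character S c"
  shows "msum D (Z \<times> Z) (\<lambda>u. stab S (\<lambda>x. sympl_char u x * c x) a b) = of_nat D \<cdot>\<^sub>m 1\<^sub>m D"
proof -
  note fin = isotropic_finite[OF assms(1)] and sub = isotropic_subset[OF assms(1)]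
  have "msum D (Z \<times> Z) (\<lambda>u. stab S (\<lambda>x. sympl_char u x * c x) a b)
    = msum D S (\<lambda>x. msum D (Z \<times> Z) (\<lambda>u. (sympl_char u x * c x / of_nat D) \<cdot>\<^sub>m Wab a b x))"
    unfolding stab_def by (rule msum_swap)
  also have "\<dots> = msum D S (\<lambda>x. (if x = pzero then of_nat D else 0) \<cdot>\<^sub>m Wab a b x)"
  proof (rule msum_cong)
    fix x assume x: "x \<in> S"
    have "msum D (Z \<times> Z) (\<lambda>u. (sympl_char u x * c x / of_nat D) \<cdot>\<^sub>m Wab a b x)
      = ((\<Sum>u\<in>Z \<times> Z. sympl_char u x) * c x / of_nat D) \<cdot>\<^sub>m Wab a b x"
      by (subst msum_smult_const) (simp_all add: sum_distrib_right sum_divide_distrib)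
    also have "\<dots> = (if x = pzero then of_nat D else 0) \<cdot>\<^sub>m Wab a b x"
      using x sub by (subst sum_sympl_char) (auto simp: character_zero[OF assms])
    finally show "msum D (Z \<times> Z) (\<lambda>u. (sympl_char u x * c x / of_nat D) \<cdot>\<^sub>m Wab a b x)
       = (if x = pzero then of_nat D else 0) \<cdot>\<^sub>m Wab a b x" .
  qed
  also have "\<dots> = of_nat D \<cdot>\<^sub>m 1\<^sub>m D"
  proof (rule eq_matI)
    fix i j assume "i < dim_row (of_nat D \<cdot>\<^sub>m 1\<^sub>m D :: complex mat)" "j < dim_col (of_nat D \<cdot>\<^sub>m 1\<^sub>m D :: complex mat)"
    hence ij: "i < D" "j < D" by auto
    have "msum D S (\<lambda>x. (if x = pzero then of_nat D else 0) \<cdot>\<^sub>m Wab a b x) $$ (i,j)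
       = (\<Sum>x\<in>S. if x = pzero then of_nat D * 1\<^sub>m D $$ (i,j) else 0)"
      unfolding msum_entry[OF ij]
    proof (rule sum.cong)
      fix x
      have "dim_row (Wab a b x) = D" "dim_col (Wab a b x) = D" using carrier_matD[OF Wab_carrier] by auto
      thus "((if x = pzero then of_nat D else 0) \<cdot>\<^sub>m Wab a b x) $$ (i,j)
         = (if x = pzero then of_nat D * 1\<^sub>m D $$ (i,j) else 0)"
        using ij by (auto simp: Wab_zero)
    qed simp
    also have "\<dots> = (of_nat D \<cdot>\<^sub>m 1\<^sub>m D) $$ (i,j)"
      using fin isotropic_zero[OF assms(1)] ij by simp
    finally show "msum D S (\<lambda>x. (if x = pzero then of_nat D else 0) \<cdot>\<^sub>m Wab a b x) $$ (i,j)
       = (of_nat D \<cdot>\<^sub>m 1\<^sub>m D) $$ (i,j)" .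
  qed (auto simp: msum_def)
  finally show ?thesis .
qed

end

section \<open>Minimal projections and the Holevo capacity\<close>

lemma gen_alg_carrier:
  assumes "A \<in> gen_alg S" "S \<subseteq> carrier_mat N N"
  shows "A \<in> carrier_mat N N"
  using assms by (induction rule: gen_alg.induct) auto

text \<open>The induction starts from a singleton because \<open>gen_alg\<close> has no rule that
  supplies an empty sum.\<close>

lemma msum_in_gen_alg:
  assumes "finite I" "I \<noteq> {}" "S \<subseteq> carrier_mat N N" "\<And>i. i \<in> I \<Longrightarrow> F i \<in> gen_alg S"
  shows "msum N I F \<in> gen_alg S"
  using assms(1,2,4)
proof (induction I rule: finite_ne_induct)
  case (singleton i)
  have "F i \<in> carrier_mat N N" using singleton gen_alg_carrier[OF _ assms(3)] by auto
  hence "msum N {i} F = F i" by (intro eq_matI) (auto simp: msum_def)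
  thus ?case using singleton by simp
next
  case (insert i I)
  have c: "F j \<in> carrier_mat N N" if "j \<in> insert i I" for j
    using insert(5)[OF that] gen_alg_carrier[OF _ assms(3)] by auto
  have "msum N (insert i I) F = F i + msum N I F"
    using insert(1,3) carrier_matD[OF c[of i]] by (intro eq_matI) (auto simp: msum_def)
  thus ?case using insert by (auto intro: gen_alg.add)
qed

context odd_qudits
begin

lemma Wab_one: "Wab 1 1 (p, q) = W p q"
  by (simp add: Wab_def)

lemma stab_Wab:
  assumes "isotropic S" "character S c" "x \<in> S"
  shows "stab S c a b * Wab a b x = cnj (c x) \<cdot>\<^sub>m stab S c a b"
proof -
  have "stab S c a b * Wab a b x = adj (adj (Wab a b x) * stab S c a b)"
    by (simp add: adj_mult[of _ D D _ D] stab_adj[OF assms(1,2)])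
  also have "adj (Wab a b x) * stab S c a b = cnj (c (pneg x)) \<cdot>\<^sub>m stab S c a b"
    unfolding Wab_adj by (rule Wab_stab[OF assms(1,2) pneg_in[OF assms(1,3)]])
  also have "adj \<dots> = cnj (c x) \<cdot>\<^sub>m stab S c a b"
    by (simp add: adj_smult stab_adj[OF assms(1,2)] character_neg[OF assms])
  finally show ?thesis .
qed

text \<open>Scalar action holds for the generators and passes through all closure rules; asking for
  it on both sides carries the adjoint, which exchanges the sides. In effect the rescaled stabiliser
  matrices are minimal projections of the algebra.\<close>

lemma gen_alg_stab_scalar:
  assumes "isotropic S" "character S c" "A \<in> gen_alg (Wab a b ` S)"
  shows "\<exists>l. A * stab S c a b = l \<cdot>\<^sub>m stab S c a b \<and> stab S c a b * A = l \<cdot>\<^sub>m stab S c a b"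
  using assms(3)
proof (induction rule: gen_alg.induct)
  case (base A)
  thus ?case using Wab_stab[OF assms(1,2)] stab_Wab[OF assms(1,2)] by auto
next
  let ?P = "stab S c a b"
  have carr: "B \<in> carrier_mat D D" if "B \<in> gen_alg (Wab a b ` S)" for B
    by (rule gen_alg_carrier[OF that]) auto
  {
    case (add A B)
    then obtain l m where "A * ?P = l \<cdot>\<^sub>m ?P" "?P * A = l \<cdot>\<^sub>m ?P" "B * ?P = m \<cdot>\<^sub>m ?P" "?P * B = m \<cdot>\<^sub>m ?P" by blast
    moreover have "(A + B) * ?P = A * ?P + B * ?P"
      by (rule add_mult_distrib_mat[OF carr[OF add(1)] carr[OF add(2)] stab_carrier])
    moreover have "?P * (A + B) = ?P * A + ?P * B"
      by (rule mult_add_distrib_mat[OF stab_carrier carr[OF add(1)] carr[OF add(2)]])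
    moreover have "(l + m) \<cdot>\<^sub>m ?P = l \<cdot>\<^sub>m ?P + m \<cdot>\<^sub>m ?P"
      by (rule eq_matI) (auto simp: algebra_simps)
    ultimately show ?case by (intro exI[of _ "l + m"]) simp
  next
    case (smult A k)
    then obtain l where "A * ?P = l \<cdot>\<^sub>m ?P" "?P * A = l \<cdot>\<^sub>m ?P" by blast
    thus ?case using carr[OF smult(1)]
      by (intro exI[of _ "k * l"]) (simp add: mult_smult[of _ D] smult_smult)
  next
    case (mult A B)
    then obtain l m where lm: "A * ?P = l \<cdot>\<^sub>m ?P" "?P * A = l \<cdot>\<^sub>m ?P" "B * ?P = m \<cdot>\<^sub>m ?P" "?P * B = m \<cdot>\<^sub>m ?P" by blast
    have c: "A \<in> carrier_mat D D" "B \<in> carrier_mat D D" using carr mult by auto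
    have "A * B * ?P = A * (B * ?P)" using c by (simp add: assoc_mult_mat[of _ D D _ D _ D])
    moreover have "?P * (A * B) = (?P * A) * B" using c by (simp add: assoc_mult_mat[of _ D D _ D _ D])
    ultimately show ?case using c lm
      by (intro exI[of _ "l * m"]) (simp add: mult_smult[of _ D] smult_smult mult.commute)
  next
    case (adjoint A)
    then obtain l where l: "A * ?P = l \<cdot>\<^sub>m ?P" "?P * A = l \<cdot>\<^sub>m ?P" by blast
    have c: "A \<in> carrier_mat D D" using carr adjoint by auto
    have "adj A * ?P = adj (?P * A)" "?P * adj A = adj (A * ?P)"
      using c by (simp_all add: adj_mult[of _ D D _ D] stab_adj[OF assms(1,2)])
    thus ?case using l by (intro exI[of _ "cnj l"]) (simp add: adj_smult stab_adj[OF assms(1,2)])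
  }
qed

text \<open>Equality of the two products means equality of two opposite phases on the same Weyl
  operator, which unitarity strips off.\<close>

lemma weyl_abelian_group_isotropic:
  assumes "weyl_abelian_group d n S"
  shows "isotropic S"
proof -
  have sub: "S \<subseteq> Z \<times> Z" and z: "pzero \<in> S"
    using assms by (auto simp: weyl_abelian_group_def pzero_def)
  have "padd x y \<in> S \<and> int d dvd sympl x y" if xy: "x \<in> S" "y \<in> S" for x y
  proof -
    obtain p q p' q' where e: "x = (p, q)" "y = (p', q')" by fastforce
    have Zs: "p \<in> Z" "q \<in> Z" "p' \<in> Z" "q' \<in> Z" using xy sub e by auto
    have ax: "((\<lambda>k. (p k + p' k) mod int d), (\<lambda>k. (q k + q' k) mod int d)) \<in> S"
      and com: "W p q * W p' q' = W p' q' * W p q"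
      using assms xy e unfolding weyl_abelian_group_def by fast+
    have "padd x y = ((\<lambda>k. (p k + p' k) mod int d), (\<lambda>k. (q k + q' k) mod int d))"
      using Zs by (auto simp: padd_def e red_def zvecs_def intro!: ext)
    hence 1: "padd x y \<in> S" using ax by simp
    have "chi d (half * (1 * 1 * sympl x y)) \<cdot>\<^sub>m Wab 1 1 (padd x y) = chi d (half * (1 * 1 * sympl y x)) \<cdot>\<^sub>m Wab 1 1 (padd x y)"
      using com unfolding Wab_one[symmetric] e[symmetric] Wab_mult_phase padd_commute[of y x] .
    hence "(chi d (half * (1 * sympl x y)) \<cdot>\<^sub>m Wab 1 1 (padd x y)) * adj (Wab 1 1 (padd x y))
      = (chi d (half * (1 * (- sympl x y))) \<cdot>\<^sub>m Wab 1 1 (padd x y)) * adj (Wab 1 1 (padd x y))"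
      by (simp add: sympl_commute[of y x])
    hence "chi d (half * (1 * sympl x y)) \<cdot>\<^sub>m 1\<^sub>m D = chi d (half * (1 * (- sympl x y))) \<cdot>\<^sub>m 1\<^sub>m D"
      by (simp add: mult_smult[of _ D] Wab_def weyl_unitary)
    from arg_cong[OF this, of "\<lambda>M. M $$ (0,0)"]
    have "chi d (half * (1 * sympl x y)) = chi d (half * (1 * (- sympl x y)))" by simp
    hence "int d dvd sympl x y" by (rule dvd_of_chi_symmetric) simp
    thus ?thesis using 1 by blast
  qed
  thus ?thesis using sub z by (simp add: isotropic_def)
qed

text \<open>The twisted stabiliser matrices add up to a multiple of the identity, so a nonzero
  projection \<open>P\<close> of the algebra meets one of them; as \<open>P\<close> acts on it by a
  scalar, minimality makes \<open>P\<close> a multiple of it.\<close>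

lemma MSPS_eq_stab:
  assumes "density d n \<sigma>" "MSPS d n \<sigma>"
  obtains S c where "isotropic S" "character S c" "\<sigma> = stab S c 1 1"
proof -
  obtain S P where S: "weyl_abelian_group d n S"
    and P: "minimal_proj D (gen_alg ((\<lambda>(p,q). W p q) ` S)) P"
    and s: "\<sigma> = (1 / of_nat (vec_space.rank D P)) \<cdot>\<^sub>m P"
    using assms(2) unfolding MSPS_def by blast
  have iso: "isotropic S" by (rule weyl_abelian_group_isotropic[OF S])
  note fin = isotropic_finite[OF iso] and card = isotropic_card[OF iso]
  have im: "(\<lambda>(p,q). W p q) ` S = Wab 1 1 ` S" by (auto simp: Wab_def split_def)
  define Alg where "Alg = gen_alg (Wab 1 1 ` S)"
  have W_sub: "Wab 1 1 ` S \<subseteq> carrier_mat D D" by auto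
  have PA: "P \<in> Alg" and Pp: "adj P = P" "P * P = P" and P0: "P \<noteq> 0\<^sub>m D D"
    and min: "\<And>Q. Q \<in> Alg \<Longrightarrow> is_proj Q \<Longrightarrow> Q * P = Q \<Longrightarrow> Q = 0\<^sub>m D D \<or> Q = P"
    using P unfolding minimal_proj_def im Alg_def[symmetric] by (auto simp: is_proj_def)
  have Pc: "P \<in> carrier_mat D D" using gen_alg_carrier[OF _ W_sub] PA unfolding Alg_def by blast
  define T where "T u = stab S (sympl_char u) 1 1" for u
  have Tc: "T u \<in> carrier_mat D D" for u by (simp add: T_def)
  have ch: "character S (sympl_char u)" for u by (rule sympl_char_character)
  \<comment> \<open>The reciprocal of the factor \<open>card S / D\<close> in the square of
    \<open>T u\<close>, so that \<open>m\<close> times \<open>T u\<close> is idempotent.\<close>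
  define m :: complex where "m = of_nat D / of_nat (card S)"
  have m0: "m \<noteq> 0" using card by (simp add: m_def)
  have TA: "T u \<in> Alg" for u
    unfolding T_def stab_def Alg_def
    by (rule msum_in_gen_alg) (use fin isotropic_zero[OF iso] W_sub in \<open>auto intro!: gen_alg.intros\<close>)
  have one: "character S (\<lambda>_. 1)" by (simp add: character_def)
  have "\<exists>u\<in>Z \<times> Z. T u * P \<noteq> 0\<^sub>m D D"
  proof (rule ccontr)
    assume none: "\<not> ?thesis"
    have "msum D (Z \<times> Z) (\<lambda>u. T u * P) = 0\<^sub>m D D"
    proof -
      have "msum D (Z \<times> Z) (\<lambda>u. T u * P) = msum D (Z \<times> Z) (\<lambda>_. 0\<^sub>m D D)"
        by (rule msum_cong) (use none in blast)
      also have "\<dots> = 0\<^sub>m D D" by (rule eq_matI) (auto simp: msum_def)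
      finally show ?thesis .
    qed
    moreover have "msum D (Z \<times> Z) (\<lambda>u. T u * P) = msum D (Z \<times> Z) T * P"
      by (rule msum_mult[symmetric]) (use Pc Tc in auto)
    moreover have "msum D (Z \<times> Z) T = of_nat D \<cdot>\<^sub>m 1\<^sub>m D"
      using sum_stab_twists[OF iso one, of 1 1] by (simp add: T_def[abs_def])
    ultimately have "of_nat D \<cdot>\<^sub>m P = 0\<^sub>m D D"
      using Pc by (simp add: mult_smult[of _ D])
    hence "(1 / of_nat D) \<cdot>\<^sub>m (of_nat D \<cdot>\<^sub>m P) = (1 / of_nat D) \<cdot>\<^sub>m 0\<^sub>m D D" by simp
    hence "P = 0\<^sub>m D D" by (simp add: smult_smult one_smult)
    thus False using P0 by simp
  qed
  then obtain u where u: "T u * P \<noteq> 0\<^sub>m D D" by blast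
  obtain l where l: "P * T u = l \<cdot>\<^sub>m T u" "T u * P = l \<cdot>\<^sub>m T u"
    using gen_alg_stab_scalar[OF iso ch] PA unfolding T_def Alg_def by blast
  \<comment> \<open>The part of \<open>P\<close> inside the projection \<open>m\<close> times
    \<open>T u\<close>. The two commute by the scalar action, so \<open>Q\<close> is a projection
    below \<open>P\<close>.\<close>
  define Q where "Q = m \<cdot>\<^sub>m (T u * P)"
  have TT: "T u * T u = (1 / m) \<cdot>\<^sub>m T u"
    using stab_square[OF iso ch, of u 1 1] by (simp add: T_def m_def)
  have mc: "cnj m = m" by (simp add: m_def)
  have "Q \<in> Alg" using TA PA unfolding Q_def Alg_def by (intro gen_alg.smult gen_alg.mult)
  moreover have QP: "Q * P = Q"
    using Tc Pc Pp by (simp add: Q_def mult_smult[of _ D] assoc_mult_mat[of _ D D _ D _ D])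
  moreover have "is_proj Q"
  proof -
    have "adj Q = m \<cdot>\<^sub>m (P * T u)"
      using Tc Pc Pp stab_adj[OF iso ch, of u 1 1] by (simp add: Q_def adj_smult mc adj_mult[of _ D D _ D] T_def)
    hence "adj Q = Q" using l by (simp add: Q_def)
    moreover have "Q * Q = Q"
    proof -
      have "T u * P * (T u * P) = T u * (P * T u) * P"
        using Tc[of u] Pc by (simp add: assoc_mult_mat[of _ D D _ D _ D])
      also have "P * T u = T u * P" using l by simp
      also have "T u * (T u * P) * P = (T u * T u) * (P * P)"
        using Tc[of u] Pc by (simp add: assoc_mult_mat[of _ D D _ D _ D])
      also have "\<dots> = (1 / m) \<cdot>\<^sub>m (T u * P)"
        unfolding TT Pp using Tc[of u] Pc by (simp add: mult_smult[of _ D])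
      finally show ?thesis
        using Tc[of u] Pc m0 by (simp add: Q_def mult_smult[of _ D] smult_smult)
    qed
    ultimately show ?thesis by (simp add: is_proj_def)
  qed
  ultimately have "Q = 0\<^sub>m D D \<or> Q = P" using min by blast
  moreover have "Q \<noteq> 0\<^sub>m D D"
  proof
    assume "Q = 0\<^sub>m D D"
    hence "(1 / m) \<cdot>\<^sub>m (m \<cdot>\<^sub>m (T u * P)) = (1 / m) \<cdot>\<^sub>m 0\<^sub>m D D" by (simp add: Q_def)
    hence "T u * P = 0\<^sub>m D D" using m0 by (simp add: smult_smult one_smult)
    thus False using u by simp
  qed
  ultimately have "P = m \<cdot>\<^sub>m (T u * P)" by (simp add: Q_def)
  hence "P = (m * l) \<cdot>\<^sub>m T u" unfolding l by (simp add: smult_smult)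
  then obtain k where k: "\<sigma> = k \<cdot>\<^sub>m T u" using s by (auto simp: smult_smult)
  \<comment> \<open>Both matrices have trace 1, which fixes the scalar whatever the rank of
    \<open>P\<close> is.\<close>
  have "mtrace \<sigma> = 1" "mtrace (T u) = 1"
    using assms(1) mtrace_stab[OF _ _ iso ch] by (auto simp: density_def T_def)
  hence "k = 1" using k Tc[of u] by (simp add: mtrace_smult[of _ D])
  hence "\<sigma> = stab S (sympl_char u) 1 1" using k by (simp add: one_smult T_def)
  thus thesis using that[OF iso ch] by blast
qed

text \<open>The characteristic function of a stabiliser state has modulus 1 on \<open>S\<close> and
  is 0 elsewhere, so the cut-off in the mean state removes nothing.\<close>

lemma mean_state_MSPS:
  assumes "density d n \<sigma>" "MSPS d n \<sigma>"
  shows "mean_state d n \<sigma> = \<sigma>"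
proof -
  obtain S c where S: "isotropic S" "character S c" "\<sigma> = stab S c 1 1"
    using MSPS_eq_stab[OF assms] by blast
  show ?thesis
  proof (rule mean_state_eqI)
    fix p q assume pq: "p \<in> Z" "q \<in> Z"
    have "char_fn d n \<sigma> p q = mtrace (stab S c 1 1 * Wab (- 1) (- 1) (p, q))"
      by (simp add: char_fn_def S(3) Wab_def)
    also have "\<dots> = (if (p, q) \<in> S then c (p, q) else 0)"
      by (rule mtrace_stab_mult) (use pq isotropic_subset[OF S(1)] in auto)
    finally show "char_fn d n \<sigma> p q = (if cmod (char_fn d n \<sigma> p q) = 1 then char_fn d n \<sigma> p q else 0)"
      using character_norm[OF S(2)] by auto
  qed (simp add: S)
qed

end

section \<open>Weyl operators and stabiliser sums under the convolution\<close>

context qudit_convolution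
begin

text \<open>The Kronecker delta of the Weyl operator involves only the difference of
  \<open>a\<close> and \<open>b\<close>, so it leaves the sum over \<open>y\<close>. With
  \<open>g11 * y + g01 * a\<close> as new variable the sum becomes the Fourier transform of
  \<open>\<sigma>\<close> along the diagonal shifted by \<open>- g01 * q\<close>, that is, a trace
  against a Weyl operator.\<close>

lemma conv_weyl:
  assumes s: "\<sigma> \<in> carrier_mat D D"
  shows "cv (Wab g11 g00 x) \<sigma> = mtrace (\<sigma> * Wab g10 (- g01) x) \<cdot>\<^sub>m Wab dt 1 x"
proof (rule mat_eqI)
  fix a b
  obtain p q where x: "x = (p, q)" by fastforce
  define f where "f z = \<sigma> $$ (E z, E (\<lambda>k. z k + - g01 * q k))" for z
  have fcong: "f u = f v" if "vcong u v" for u v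
  proof -
    have "E u = E v" "E (\<lambda>k. u k + - g01 * q k) = E (\<lambda>k. v k + - g01 * q k)"
      using that by (auto simp: enc_eq_iff vcong_def intro!: cong_diff)
    thus ?thesis by (simp add: f_def)
  qed
  have c1: "vcong (\<lambda>k. g00 * a k + g10 * y k) (\<lambda>k. g00 * b k + g10 * y k + g00 * q k) \<longleftrightarrow> vcong a (\<lambda>k. b k + q k)" for y
  proof -
    have "[g00 * a k + g10 * y k = g00 * b k + g10 * y k + g00 * q k] (mod int d) \<longleftrightarrow> [a k = b k + q k] (mod int d)" for k
    proof -
      have "[g00 * a k + g10 * y k = g00 * (b k + q k) + g10 * y k] (mod int d) \<longleftrightarrow> [a k = b k + q k] (mod int d)"
        by (simp only: cong_add_rcancel cong_mult_lcancel units)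
      thus ?thesis by (simp add: algebra_simps)
    qed
    thus ?thesis by (simp add: vcong_def)
  qed
  have e: "cv (Wab g11 g00 x) \<sigma> $$ (E a, E b) = (if vcong a (\<lambda>k. b k + q k) then
      (\<Sum>y\<in>Z. chi d (- half * dotp (\<lambda>k. g11 * p k) (\<lambda>k. g00 * q k)
         + dotp (\<lambda>k. g11 * p k) (\<lambda>k. g00 * a k + g10 * y k)) * f (\<lambda>k. g11 * y k + g01 * a k)) else 0)"
  proof (cases "vcong a (\<lambda>k. b k + q k)")
    case True
    have "\<sigma> $$ (E (\<lambda>k. g01 * a k + g11 * y k), E (\<lambda>k. g01 * b k + g11 * y k)) = f (\<lambda>k. g11 * y k + g01 * a k)" for y
    proof -
      have "[g01 * b k + g11 * y k = g11 * y k + g01 * a k + - g01 * q k] (mod int d)" if "k < n" for k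
      proof -
        have "[a k = b k + q k] (mod int d)" using True that by (simp add: vcong_def)
        hence "[g01 * a k + (g11 * y k - g01 * q k) = g01 * (b k + q k) + (g11 * y k - g01 * q k)] (mod int d)"
          by (intro cong_add cong_mult) auto
        thus ?thesis by (simp add: algebra_simps cong_sym)
      qed
      hence "E (\<lambda>k. g01 * b k + g11 * y k) = E (\<lambda>k. g11 * y k + g01 * a k + - g01 * q k)"
        by (simp add: enc_eq_iff vcong_def)
      thus ?thesis by (simp add: f_def add.commute)
    qed
    thus ?thesis unfolding conv_entry[OF Wab_carrier s] using True
      by (simp add: Wab_def x weyl_entry c1)
  next
    case False
    thus ?thesis unfolding conv_entry[OF Wab_carrier s] by (simp add: Wab_def x weyl_entry c1)
  qed
  \<comment> \<open>The exponent splits because \<open>g11 * (g00 * a + g10 * y) = dt * a + g10 *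
    (g11 * y + g01 * a)\<close>: the first part stays in \<open>K\<close>, the second follows the
    new variable.\<close>
  define K where "K = chi d (- half * (g11 * g00 * dotp p q) + dt * dotp p a)"
  define R where "R = (\<Sum>z\<in>Z. chi d (g10 * dotp p z) * f z)"
  have "(\<Sum>y\<in>Z. chi d (- half * dotp (\<lambda>k. g11 * p k) (\<lambda>k. g00 * q k)
         + dotp (\<lambda>k. g11 * p k) (\<lambda>k. g00 * a k + g10 * y k)) * f (\<lambda>k. g11 * y k + g01 * a k))
     = (\<Sum>y\<in>Z. K * (chi d (g10 * dotp p (\<lambda>k. g11 * y k + g01 * a k)) * f (\<lambda>k. g11 * y k + g01 * a k)))"
    unfolding K_def mult.assoc[symmetric] chi_add[symmetric] dotp_simps dt_def
    by (simp add: algebra_simps)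
  also have "\<dots> = K * (\<Sum>y\<in>Z. chi d (g10 * dotp p (\<lambda>k. g11 * y k + g01 * a k)) * f (\<lambda>k. g11 * y k + g01 * a k))"
    by (simp add: sum_distrib_left)
  also have "\<dots> = K * R"
    unfolding R_def
    by (subst sum_affine[of g11 "\<lambda>z. chi d (g10 * dotp p z) * f z"])
      (auto intro!: arg_cong2[where f = "(*)"] fcong chi_dotp_cong)
  finally have l: "cv (Wab g11 g00 x) \<sigma> $$ (E a, E b) = (if vcong a (\<lambda>k. b k + q k) then K * R else 0)"
    unfolding e by simp
  have tr: "mtrace (\<sigma> * Wab g10 (- g01) x) = chi d (- (half * (g10 * g01 * dotp p q))) * R"
    unfolding Wab_def mtrace_mult_weyl[OF s] R_def f_def x
    by (simp add: dotp_simps mult_ac)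
  \<comment> \<open>The half phases recombine since
    \<open>dt + g01 * g10 = g00 * g11\<close>.\<close>
  have "chi d (- (half * (g10 * g01 * dotp p q))) * chi d (- half * (dt * dotp p q) + dt * dotp p a) = K"
    unfolding K_def chi_add[symmetric] dt_def by (simp add: algebra_simps)
  hence "mtrace (\<sigma> * Wab g10 (- g01) x) * Wab dt 1 x $$ (E a, E b) = (if vcong a (\<lambda>k. b k + q k) then K * R else 0)"
    unfolding tr by (simp add: Wab_def x weyl_entry dotp_simps mult_ac)
  thus "cv (Wab g11 g00 x) \<sigma> $$ (E a, E b) = (mtrace (\<sigma> * Wab g10 (- g01) x) \<cdot>\<^sub>m Wab dt 1 x) $$ (E a, E b)"
    unfolding l using carrier_matD[OF Wab_carrier] by simp
qed auto

lemma conv_msum: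
  assumes "\<sigma> \<in> carrier_mat D D" "\<And>i. i \<in> I \<Longrightarrow> F i \<in> carrier_mat D D"
  shows "cv (msum D I (\<lambda>i. k i \<cdot>\<^sub>m F i)) \<sigma> = msum D I (\<lambda>i. k i \<cdot>\<^sub>m cv (F i) \<sigma>)"
proof (rule mat_eqI)
  fix x x'
  have "cv (msum D I (\<lambda>i. k i \<cdot>\<^sub>m F i)) \<sigma> $$ (E x, E x') = (\<Sum>y\<in>Z. \<Sum>i\<in>I. k i * (
      F i $$ (E (\<lambda>k. g00 * x k + g10 * y k), E (\<lambda>k. g00 * x' k + g10 * y k)) *
      \<sigma> $$ (E (\<lambda>k. g01 * x k + g11 * y k), E (\<lambda>k. g01 * x' k + g11 * y k))))"
    unfolding conv_entry[OF msum_carrier assms(1)] msum_entry[OF enc_lt enc_lt] sum_distrib_right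
    by (intro sum.cong refl) (use carrier_matD[OF assms(2)] in auto)
  also have "\<dots> = (\<Sum>i\<in>I. k i * cv (F i) \<sigma> $$ (E x, E x'))"
    by (subst sum.swap) (simp add: conv_entry[OF assms(2,1)] sum_distrib_left)
  also have "\<dots> = msum D I (\<lambda>i. k i \<cdot>\<^sub>m cv (F i) \<sigma>) $$ (E x, E x')"
    unfolding msum_entry[OF enc_lt enc_lt] using carrier_matD[OF conv_carrier] by simp
  finally show "cv (msum D I (\<lambda>i. k i \<cdot>\<^sub>m F i)) \<sigma> $$ (E x, E x') = msum D I (\<lambda>i. k i \<cdot>\<^sub>m cv (F i) \<sigma>) $$ (E x, E x')" .
qed auto

lemma conv_stab:
  assumes "\<sigma> \<in> carrier_mat D D"
  shows "cv (stab S c g11 g00) \<sigma> = stab S (\<lambda>x. c x * mtrace (\<sigma> * Wab g10 (- g01) x)) dt 1"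
  unfolding stab_def
  by (subst conv_msum[OF assms]) (auto simp: conv_weyl[OF assms] smult_smult intro!: msum_cong)

section \<open>Bounds on the Holevo quantity\<close>

definition holevo :: "complex mat \<Rightarrow> nat \<Rightarrow> (nat \<Rightarrow> real) \<Rightarrow> (nat \<Rightarrow> complex mat) \<Rightarrow> real" where
  "holevo \<sigma> m p \<rho>s = vn_entropy (mix D m p (\<lambda>i. cv (\<rho>s i) \<sigma>)) - (\<Sum>i<m. p i * vn_entropy (cv (\<rho>s i) \<sigma>))"

lemma holevo_le:
  assumes "density d n \<sigma>" "\<And>i. i < m \<Longrightarrow> 0 \<le> p i \<and> density d n (\<rho>s i)" "(\<Sum>i<m. p i) = 1"
  shows "holevo \<sigma> m p \<rho>s \<le> real n * ln (real d) - vn_entropy \<sigma>"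
proof -
  have "density d n (mix D m p (\<lambda>i. cv (\<rho>s i) \<sigma>))"
    using assms by (intro density_mix) (auto intro: density_conv)
  hence "vn_entropy (mix D m p (\<lambda>i. cv (\<rho>s i) \<sigma>)) \<le> ln (real D)"
    by (intro vn_entropy_le_ln) (auto simp: density_iff_psd)
  also have "ln (real D) = real n * ln (real d)" by (simp add: ln_realpow)
  finally have 1: "vn_entropy (mix D m p (\<lambda>i. cv (\<rho>s i) \<sigma>)) \<le> real n * ln (real d)" .
  have "vn_entropy \<sigma> = (\<Sum>i<m. p i * vn_entropy \<sigma>)"
    using assms(3) by (simp flip: sum_distrib_right)
  also have "\<dots> \<le> (\<Sum>i<m. p i * vn_entropy (cv (\<rho>s i) \<sigma>))"
    using assms by (intro sum_mono mult_left_mono vn_entropy_conv_ge) auto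
  finally show ?thesis using 1 by (simp add: holevo_def)
qed

lemma ex_holevo_eq:
  assumes "density d n \<sigma>"
  shows "\<exists>m p \<rho>s. (\<forall>i<m. 0 \<le> p i \<and> density d n (\<rho>s i)) \<and> (\<Sum>i<m. p i) = 1 \<and>
    holevo \<sigma> m p \<rho>s = real n * ln (real d) - vn_entropy (mean_state d n \<sigma>)"
proof -
  have s: "\<sigma> \<in> carrier_mat D D" using assms by (simp add: density_def)
  \<comment> \<open>With these scalings the traces produced by \<open>conv_weyl\<close> form a
    character of \<open>S\<close>, so the channel merely changes the phases of the input
    coefficients.\<close>
  define S where "S = unimod \<sigma> g10 (- g01)"
  define c where "c x = mtrace (\<sigma> * Wab g10 (- g01) x)" for x
  have iso: "isotropic S" and ch: "character S c"
    using unimod_isotropic[OF assms, of g10 "- g01"] by (auto simp: S_def c_def[abs_def])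
  \<comment> \<open>The scalings are negated because \<open>mean_state_eq_stab\<close> pairs them
    with the opposite labels; its selection set and traces are then exactly \<open>S\<close> and
    \<open>c\<close>.\<close>
  have "mean_state d n \<sigma> = stab S c (- g10) g01"
    using mean_state_eq_stab[OF assms, of "- g10" g01] by (simp add: S_def c_def[abs_def])
  hence Hm: "vn_entropy (mean_state d n \<sigma>) = - ln (real (card S) / real D)"
    using vn_entropy_stab[OF _ _ iso ch, of "- g10" g01] by simp
  define r where "r u = stab S (sympl_char u) g11 g00" for u
  have r: "density d n (r u)" for u
    unfolding r_def by (rule density_stab[OF _ _ iso sympl_char_character]) auto
  have cr: "cv (r u) \<sigma> = stab S (\<lambda>x. sympl_char u x * c x) dt 1" for u
    unfolding r_def conv_stab[OF s] c_def ..
  have H: "vn_entropy (cv (r u) \<sigma>) = vn_entropy (mean_state d n \<sigma>)" for u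
    unfolding cr Hm by (rule vn_entropy_stab[OF _ _ iso]) (auto intro: character_mult sympl_char_character ch)
  have card: "card (Z \<times> Z) = D * D" by (simp add: card_cartesian_product card_Z)
  obtain h where h: "bij_betw h {..<D * D} (Z \<times> Z)"
    using ex_bij_betw_nat_finite[of "Z \<times> Z"] card by (auto simp: atLeast0LessThan)
  \<comment> \<open>Uniform weights over the \<open>D * D\<close> points of phase space, one for
    each twist.\<close>
  define p :: "nat \<Rightarrow> real" where "p = (\<lambda>_. 1 / (real D * real D))"
  have p1: "(\<Sum>i<D * D. p i) = 1" by (simp add: p_def)
  define M where "M = mix D (D * D) p (\<lambda>i. cv (r (h i)) \<sigma>)"
  have "M = (1 / of_nat D) \<cdot>\<^sub>m 1\<^sub>m D"
  proof -
    have "M = (1 / (of_nat D * of_nat D)) \<cdot>\<^sub>m msum D {..<D * D} (\<lambda>i. cv (r (h i)) \<sigma>)"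
      by (rule eq_matI) (auto simp: M_def mix_def msum_def p_def sum_divide_distrib)
    also have "msum D {..<D * D} (\<lambda>i. cv (r (h i)) \<sigma>) = msum D (Z \<times> Z) (\<lambda>u. cv (r u) \<sigma>)"
      by (rule msum_reindex[OF h])
    \<comment> \<open>The outputs are themselves all the twists of the character \<open>c\<close>,
      so they add up to a multiple of the identity.\<close>
    also have "\<dots> = of_nat D \<cdot>\<^sub>m 1\<^sub>m D" unfolding cr by (rule sum_stab_twists[OF iso ch])
    finally show ?thesis by (simp add: smult_smult)
  qed
  hence "vn_entropy M = - ln (1 / real D)"
    by (intro vn_entropy_scaled_projection[of _ D])
      (auto simp: adj_smult mult_smult[of _ D] mtrace_smult[of _ D] smult_smult, auto simp: adj_def mtrace_def)
  hence "vn_entropy M = real n * ln (real d)" by (simp add: ln_div ln_realpow)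
  hence "holevo \<sigma> (D * D) p (\<lambda>i. r (h i)) = real n * ln (real d) - vn_entropy (mean_state d n \<sigma>)"
    unfolding holevo_def M_def[symmetric] H by (simp add: p1 flip: sum_distrib_right)
  thus ?thesis using r p1
    by (intro exI[of _ "D * D"] exI[of _ p] exI[of _ "\<lambda>i. r (h i)"]) (auto simp: p_def)
qed

lemma holevo_cap_bounds:
  assumes "density d n \<sigma>"
  shows "real n * ln (real d) - vn_entropy (mean_state d n \<sigma>) \<le> holevo_cap d n (\<lambda>\<rho>. cv \<rho> \<sigma>)"
    and "holevo_cap d n (\<lambda>\<rho>. cv \<rho> \<sigma>) \<le> real n * ln (real d) - vn_entropy \<sigma>"
proof -
  define X where "X = {holevo \<sigma> m p \<rho>s | m p \<rho>s.
      (\<forall>i<m. 0 \<le> p i \<and> density d n (\<rho>s i)) \<and> (\<Sum>i<m. p i) = 1}"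
  have cap: "holevo_cap d n (\<lambda>\<rho>. cv \<rho> \<sigma>) = Sup X"
    unfolding holevo_cap_def X_def holevo_def ..
  \<comment> \<open>Besides bounding the supremum from below, this member makes \<open>X\<close>
    nonempty, as a least upper bound in the reals requires.\<close>
  have mem: "real n * ln (real d) - vn_entropy (mean_state d n \<sigma>) \<in> X"
    using ex_holevo_eq[OF assms] unfolding X_def mem_Collect_eq by metis
  have le: "y \<le> real n * ln (real d) - vn_entropy \<sigma>" if "y \<in> X" for y
    using that holevo_le[OF assms] unfolding X_def by blast
  show "real n * ln (real d) - vn_entropy (mean_state d n \<sigma>) \<le> holevo_cap d n (\<lambda>\<rho>. cv \<rho> \<sigma>)"
    unfolding cap using mem le by (intro cSup_upper) (auto simp: bdd_above_def)
  show "holevo_cap d n (\<lambda>\<rho>. cv \<rho> \<sigma>) \<le> real n * ln (real d) - vn_entropy \<sigma>"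
    unfolding cap using mem le by (intro cSup_least) auto
qed

end

theorem mainTheorem15:
  fixes d n :: nat and g :: "nat \<Rightarrow> nat \<Rightarrow> int" and \<sigma> :: "complex mat"
  assumes "prime d" and "n \<ge> 1"
    and "\<forall>a<2. \<forall>b<2. \<not> (int d dvd g a b)"
    and "\<not> (int d dvd detG g)"
    and "density d n \<sigma>"
  shows "real n * ln (real d) - vn_entropy (mean_state d n \<sigma>) \<le> holevo_cap d n (\<lambda>\<rho>. conv d n g \<rho> \<sigma>)
       \<and> holevo_cap d n (\<lambda>\<rho>. conv d n g \<rho> \<sigma>) \<le> real n * ln (real d) - vn_entropy \<sigma>
       \<and> (MSPS d n \<sigma> \<longrightarrow> holevo_cap d n (\<lambda>\<rho>. conv d n g \<rho> \<sigma>) = real n * ln (real d) - vn_entropy \<sigma>)"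
proof -
  have pr: "prime (int d)" using assms(1) by simp
  have odd: "odd d"
  proof
    assume "even d"
    hence d2: "d = 2" using assms(1) by (metis primes_dvd_imp_eq two_is_prime_nat)
    hence "odd (g 0 0)" "odd (g 0 1)" "odd (g 1 0)" "odd (g 1 1)" using assms(3) by auto
    hence "even (detG g)" by (simp add: detG_def)
    thus False using assms(4) d2 by simp
  qed
  \<comment> \<open>Primality turns nonvanishing modulo \<open>d\<close> into coprimality with
    \<open>d\<close>.\<close>
  interpret qudit_convolution d n g
  proof
    show "1 < d" using assms(1) by (rule prime_gt_1_nat)
    show "odd d" by (rule odd)
    show "coprime (g a b) (int d)" if "a < 2" "b < 2" for a b
      using that assms(3) prime_imp_coprime[OF pr, of "g a b"] by (simp add: coprime_commute)
    show "coprime (detG g) (int d)"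
      using assms(4) prime_imp_coprime[OF pr, of "detG g"] by (simp add: coprime_commute)
  qed
  note b = holevo_cap_bounds[OF assms(5)]
  show ?thesis
  proof (intro conjI impI)
    assume "MSPS d n \<sigma>"
    thus "holevo_cap d n (\<lambda>\<rho>. conv d n g \<rho> \<sigma>) = real n * ln (real d) - vn_entropy \<sigma>"
      using b mean_state_MSPS[OF assms(5)] by simp
  qed (use b in auto)
qed

end
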